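(* Let $\mathfrak{f}_{c,d}$ denote the free class-$c$ nilpotent Lie ring on $d$ generators. For every prime $p$, $$\zeta_{\mathfrak{f}_{2,2}(\mathbb{F}_p)}^{\triangleleft}(s)=1+(1+p)t+t^2+t^3,$$ $$\zeta_{\mathfrak{f}_{3,2}(\mathbb{F}_p)}^{\triangleleft}(s)=\zeta_{\mathfrak{f}_{2,2}(\mathbb{F}_p)}^{\triangleleft}(s)+(1+p)t^4+t^5,$$ $$\zeta_{\mathfrak{f}_{4,2}(\mathbb{F}_p)}^{\triangleleft}(s)=\zeta_{\mathfrak{f}_{3,2}(\mathbb{F}_p)}^{\triangleleft}(s)+(p+p^2)t^5+(1+p+p^2)t^6+(1+p+p^2)t^7+t^8.$$
   Context: $\mathfrak{f}_{c,d}$ is the quotient of the free Lie ring (over $\mathbb{Z}$) on $d$ generators by the $(c+1)$-st term of its lower central series; it is additively a free $\mathbb{Z}$-module of finite rank ($\mathfrak{f}_{2,2},\mathfrak{f}_{3,2},\mathfrak{f}_{4,2}$ have ranks $3,5,8$). For a Lie ring $L\cong\mathbb{Z}^n$ (additively) and a prime $p$, $L(\mathbb{F}_p)=L\otimes_{\mathbb{Z}}\mathbb{F}_p$, and $\zeta_{L(\mathbb{F}_p)}^{\triangleleft}(s)=\sum_{i=0}^{n}a_{p^i}^{\triangleleft}(L(\mathbb{F}_p))\,t^{i}$, where $t=p^{-s}$ and $a_{p^i}^{\triangleleft}(L(\mathbb{F}_p))$ is the number of Lie ideals of $L(\mathbb{F}_p)$ of codimension $i$. *)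

theory Defs
  imports
    "HOL-Analysis.Complex_Transcendental"
    "HOL-Library.Poly_Mapping"
    "HOL-Algebra.Generated_Groups"
    "HOL-Algebra.IntRing"
    "HOL-Algebra.Module"
    "HOL-Algebra.QuotRing"
    "HOL-Number_Theory.Residues"
begin

text \<open>
  A not necessarily associative or unital algebra over a commutative ring is carried by the record
  \<^type>\<open>module\<close>, whose field \<^const>\<open>mult\<close> is its product; for Lie rings and Lie algebras this
  product is the Lie bracket. The field \<^const>\<open>one\<close> has no meaning here and is filled with the
  zero element. A Lie ring is a Lie algebra over \<^term>\<open>\<Z>\<close>.
\<close>

subsection \<open>Ideals and quotients\<close>

text \<open>Ideals are two-sided, which for a Lie bracket is the same as one-sided.\<close>

definition alg_ideal ::
    "('r, 'c) ring_scheme \<Rightarrow> ('r, 'a, 'm) module_scheme \<Rightarrow> 'a set \<Rightarrow> bool" where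
  "alg_ideal R A I \<longleftrightarrow> submodule I R A \<and>
     (\<forall>x\<in>carrier A. \<forall>y\<in>I. x \<otimes>\<^bsub>A\<^esub> y \<in> I \<and> y \<otimes>\<^bsub>A\<^esub> x \<in> I)"

definition alg_ideal_gen ::
    "('r, 'c) ring_scheme \<Rightarrow> ('r, 'a, 'm) module_scheme \<Rightarrow> 'a set \<Rightarrow> 'a set" where
  "alg_ideal_gen R A S = \<Inter>{I. alg_ideal R A I \<and> S \<subseteq> I}"

definition submodule_gen ::
    "('r, 'c) ring_scheme \<Rightarrow> ('r, 'a, 'm) module_scheme \<Rightarrow> 'a set \<Rightarrow> 'a set" where
  "submodule_gen R A S = \<Inter>{N. submodule N R A \<and> S \<subseteq> N}"

definition alg_quot ::
    "('r, 'a, 'm) module_scheme \<Rightarrow> 'a set \<Rightarrow> ('r, 'a set) module"  (infixl \<open>aQuot\<close> 65) where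
  "A aQuot I =
     \<lparr>carrier = a_rcosets\<^bsub>A\<^esub> I, mult = rcoset_mult A I, one = I, zero = I, add = set_add A,
      smult = (\<lambda>r X. \<Union>x\<in>X. I +>\<^bsub>A\<^esub> (r \<odot>\<^bsub>A\<^esub> x))\<rparr>"

subsection \<open>Rank\<close>

text \<open>The functions in \<^term>\<open>B \<rightarrow>\<^sub>E carrier R\<close> are the coordinate vectors with respect to \<open>B\<close>.\<close>

definition has_rank ::
    "('r, 'c) ring_scheme \<Rightarrow> ('r, 'a, 'm) module_scheme \<Rightarrow> nat \<Rightarrow> bool" where
  "has_rank R M n \<longleftrightarrow>
     (\<exists>B\<subseteq>carrier M. finite B \<and> card B = n \<and>
        (\<forall>x\<in>carrier M. \<exists>!c. c \<in> B \<rightarrow>\<^sub>E carrier R \<and> x = (\<Oplus>\<^bsub>M\<^esub>b\<in>B. c b \<odot>\<^bsub>M\<^esub> b)))"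

definition module_rank :: "('r, 'c) ring_scheme \<Rightarrow> ('r, 'a, 'm) module_scheme \<Rightarrow> nat" where
  "module_rank R M = (THE n. has_rank R M n)"

subsection \<open>Free Lie rings\<close>

text \<open>Bilinear extension of a binary operation from basis elements to the free
  \<open>\<int>\<close>-modules on them.\<close>

definition bilinear_extend ::
    "('a \<Rightarrow> 'b \<Rightarrow> 'c) \<Rightarrow> ('a \<Rightarrow>\<^sub>0 int) \<Rightarrow> ('b \<Rightarrow>\<^sub>0 int) \<Rightarrow> ('c \<Rightarrow>\<^sub>0 int)" where
  "bilinear_extend h f g = frag_extend (\<lambda>u. frag_extend (\<lambda>v. frag_of (h u v)) g) f"

datatype (letters: 'x) free_magma =
  Letter 'x | Join "'x free_magma" "'x free_magma"

definition free_nonassoc_ring :: "'x set \<Rightarrow> (int, 'x free_magma \<Rightarrow>\<^sub>0 int) module" where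
  "free_nonassoc_ring X =
     \<lparr>carrier = {f. \<forall>w\<in>Poly_Mapping.keys f. letters w \<subseteq> X},
      mult = bilinear_extend Join, one = 0, zero = 0, add = (+), smult = frag_cmul\<rparr>"

definition lie_relators :: "('r, 'a, 'm) module_scheme \<Rightarrow> 'a set" where
  "lie_relators A =
     {x \<otimes>\<^bsub>A\<^esub> x |x. x \<in> carrier A} \<union>
     {x \<otimes>\<^bsub>A\<^esub> (y \<otimes>\<^bsub>A\<^esub> z) \<oplus>\<^bsub>A\<^esub> y \<otimes>\<^bsub>A\<^esub> (z \<otimes>\<^bsub>A\<^esub> x) \<oplus>\<^bsub>A\<^esub> z \<otimes>\<^bsub>A\<^esub> (x \<otimes>\<^bsub>A\<^esub> y) |x y z.
        x \<in> carrier A \<and> y \<in> carrier A \<and> z \<in> carrier A}"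

definition free_lie_ring :: "'x set \<Rightarrow> (int, ('x free_magma \<Rightarrow>\<^sub>0 int) set) module" where
  "free_lie_ring X =
     (let A = free_nonassoc_ring X in A aQuot alg_ideal_gen \<Z> A (lie_relators A))"

text \<open>The numbering is the usual one, with first term \<open>\<gamma>\<^sub>1(L) = L\<close>; the value at index \<open>0\<close> is
  conventional.\<close>

fun lower_central ::
    "('r, 'c) ring_scheme \<Rightarrow> ('r, 'a, 'm) module_scheme \<Rightarrow> nat \<Rightarrow> 'a set" where
  "lower_central R L 0 = carrier L"
| "lower_central R L (Suc 0) = carrier L"
| "lower_central R L (Suc (Suc i)) =
     submodule_gen R L {x \<otimes>\<^bsub>L\<^esub> y |x y. x \<in> lower_central R L (Suc i) \<and> y \<in> carrier L}"

definition free_nilpotent_lie_ring ::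
    "nat \<Rightarrow> nat \<Rightarrow> (int, ((nat free_magma \<Rightarrow>\<^sub>0 int) set) set) module" where
  "free_nilpotent_lie_ring c d =
     (let L = free_lie_ring {..<d} in L aQuot lower_central \<Z> L (c + 1))"

subsection \<open>Extension of scalars\<close>

text \<open>
  \<open>L \<otimes>\<^sub>\<int> K\<close> is the quotient of the free \<open>\<int>\<close>-module on \<open>L \<times> K\<close> by the subgroup generated by the
  biadditivity relators (balancing over \<open>\<int>\<close> follows from these), with
  \<open>[x \<otimes> a, y \<otimes> b] = [x, y] \<otimes> ab\<close> and \<open>k (x \<otimes> a) = x \<otimes> ka\<close>. Before passing to the quotient the
  scalar multiplication is additive in the vector only.
\<close>

definition pre_extend_scalars ::
    "(int, 'a, 'm) module_scheme \<Rightarrow> ('k, 'c) ring_scheme \<Rightarrow> ('k, 'a \<times> 'k \<Rightarrow>\<^sub>0 int) module" where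
  "pre_extend_scalars L K =
     \<lparr>carrier = {f. Poly_Mapping.keys f \<subseteq> carrier L \<times> carrier K},
      mult = bilinear_extend (\<lambda>(x, a) (y, b). (x \<otimes>\<^bsub>L\<^esub> y, a \<otimes>\<^bsub>K\<^esub> b)),
      one = 0, zero = 0, add = (+),
      smult = (\<lambda>k. frag_extend (\<lambda>(x, a). frag_of (x, k \<otimes>\<^bsub>K\<^esub> a)))\<rparr>"

definition tensor_relators ::
    "(int, 'a, 'm) module_scheme \<Rightarrow> ('k, 'c) ring_scheme \<Rightarrow> ('a \<times> 'k \<Rightarrow>\<^sub>0 int) set" where
  "tensor_relators L K =
     {frag_of (x \<oplus>\<^bsub>L\<^esub> y, a) - frag_of (x, a) - frag_of (y, a) |x y a.
        x \<in> carrier L \<and> y \<in> carrier L \<and> a \<in> carrier K} \<union>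
     {frag_of (x, a \<oplus>\<^bsub>K\<^esub> b) - frag_of (x, a) - frag_of (x, b) |x a b.
        x \<in> carrier L \<and> a \<in> carrier K \<and> b \<in> carrier K}"

definition extend_scalars ::
    "(int, 'a, 'm) module_scheme \<Rightarrow> ('k, 'c) ring_scheme \<Rightarrow> ('k, ('a \<times> 'k \<Rightarrow>\<^sub>0 int) set) module" where
  "extend_scalars L K =
     (let P = pre_extend_scalars L K in P aQuot generate (add_monoid P) (tensor_relators L K))"

subsection \<open>The ideal zeta function\<close>

definition ideal_count ::
    "('r, 'c) ring_scheme \<Rightarrow> ('r, 'a, 'm) module_scheme \<Rightarrow> nat \<Rightarrow> nat" where
  "ideal_count K L i = card {I. alg_ideal K L I \<and> has_rank K (L aQuot I) i}"

text \<open>The ideal zeta function of \<open>L \<otimes>\<^sub>\<int> F\<^sub>p\<close>, for a Lie ring \<open>L\<close> with underlying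
  group \<open>\<int>\<^sup>n\<close>.\<close>

definition ideal_zeta_mod :: "(int, 'a, 'm) module_scheme \<Rightarrow> nat \<Rightarrow> complex \<Rightarrow> complex" where
  "ideal_zeta_mod L p s =
     (let K = residue_ring (int p); n = module_rank \<Z> L; t = of_nat p powr (- s)
      in \<Sum>i=0..n. of_nat (ideal_count K (extend_scalars L K) i) * t ^ i)"

end

theory Submission
  imports Defs "HOL-Algebra.Free_Abelian_Groups"
begin

text \<open>
  The free class-4 Lie ring on \<open>x, y\<close> has the basis \<open>x\<close>, \<open>y\<close>, \<open>z = [x, y]\<close>, \<open>u = [z, x]\<close>, \<open>v = [z, y]\<close>,
  \<open>[u, x]\<close>, \<open>[u, y] = [v, x]\<close>, \<open>[v, y]\<close>: these words span because, by the Jacobi identity, right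
  multiplication by any word is generated by right multiplication by the letters, and they are
  independent because the resulting structure constants do define a Lie ring. Classes 2 and 3
  are truncations, and tensoring with \<open>F\<^sub>p\<close> reduces coordinates modulo \<open>p\<close>.

  Passing from class \<open>c\<close> to the previous one, the ideals containing the last term \<open>\<gamma>\<^sub>c\<close> of the lower
  central series are the ideals of the smaller algebra. An ideal that does not contain \<open>\<gamma>\<^sub>c\<close>
  cannot leave \<open>\<gamma>\<^sub>3\<close> (\<open>\<gamma>\<^sub>2\<close> for \<open>c = 2\<close>), since otherwise it would contain an element
  \<open>z + \<dots>\<close> and hence everything of higher weight. So it is a proper subspace of \<open>\<gamma>\<^sub>c\<close>, counted by
  Gaussian binomials, except for \<open>p + p\<^sup>2\<close> ideals in class 4: such an ideal is one of the \<open>p + 1\<close> lines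
  \<open>\<langle>w\<rangle>\<close> of \<open>\<gamma>\<^sub>3/\<gamma>\<^sub>4\<close>, lifted in one of \<open>p\<close> ways modulo the plane \<open>\<langle>[w, x], [w, y]\<rangle>\<close> of \<open>\<gamma>\<^sub>4\<close>.
\<close>

subsection \<open>Ideals and quotients of nonassociative algebras\<close>

locale nonassoc_algebra = abelian_group A
  for R :: "('r, 'c) ring_scheme" and A :: "('r, 'a, 'm) module_scheme" (structure) +
  assumes mult_closed: "\<lbrakk>x \<in> carrier A; y \<in> carrier A\<rbrakk> \<Longrightarrow> x \<otimes> y \<in> carrier A"
    and mult_l_distr: "\<lbrakk>x \<in> carrier A; y \<in> carrier A; z \<in> carrier A\<rbrakk> \<Longrightarrow> (x \<oplus> y) \<otimes> z = x \<otimes> z \<oplus> y \<otimes> z"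
    and mult_r_distr: "\<lbrakk>x \<in> carrier A; y \<in> carrier A; z \<in> carrier A\<rbrakk> \<Longrightarrow> z \<otimes> (x \<oplus> y) = z \<otimes> x \<oplus> z \<otimes> y"
    and scale_closed: "\<lbrakk>r \<in> carrier R; x \<in> carrier A\<rbrakk> \<Longrightarrow> r \<odot>\<^bsub>A\<^esub> x \<in> carrier A"
    and scale_distr: "\<lbrakk>r \<in> carrier R; x \<in> carrier A; y \<in> carrier A\<rbrakk> \<Longrightarrow>
      r \<odot>\<^bsub>A\<^esub> (x \<oplus> y) = r \<odot>\<^bsub>A\<^esub> x \<oplus> r \<odot>\<^bsub>A\<^esub> y"

definition alg_epi ::
    "('r, 'c) ring_scheme \<Rightarrow> ('r, 'a, 'm) module_scheme \<Rightarrow> ('r, 'b, 'n) module_scheme \<Rightarrow> ('a \<Rightarrow> 'b) \<Rightarrow> bool" where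
  "alg_epi R A B f \<longleftrightarrow> f ` carrier A = carrier B \<and> f \<zero>\<^bsub>A\<^esub> = \<zero>\<^bsub>B\<^esub> \<and>
     (\<forall>x\<in>carrier A. \<forall>y\<in>carrier A. f (x \<oplus>\<^bsub>A\<^esub> y) = f x \<oplus>\<^bsub>B\<^esub> f y \<and> f (x \<otimes>\<^bsub>A\<^esub> y) = f x \<otimes>\<^bsub>B\<^esub> f y) \<and>
     (\<forall>r\<in>carrier R. \<forall>x\<in>carrier A. f (r \<odot>\<^bsub>A\<^esub> x) = r \<odot>\<^bsub>B\<^esub> f x)"

lemma alg_epiD:
  assumes "alg_epi R A B f"
  shows "f ` carrier A = carrier B" "f \<zero>\<^bsub>A\<^esub> = \<zero>\<^bsub>B\<^esub>"
    "\<And>x. x \<in> carrier A \<Longrightarrow> f x \<in> carrier B"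
    "\<And>x y. \<lbrakk>x \<in> carrier A; y \<in> carrier A\<rbrakk> \<Longrightarrow> f (x \<oplus>\<^bsub>A\<^esub> y) = f x \<oplus>\<^bsub>B\<^esub> f y"
    "\<And>x y. \<lbrakk>x \<in> carrier A; y \<in> carrier A\<rbrakk> \<Longrightarrow> f (x \<otimes>\<^bsub>A\<^esub> y) = f x \<otimes>\<^bsub>B\<^esub> f y"
    "\<And>r x. \<lbrakk>r \<in> carrier R; x \<in> carrier A\<rbrakk> \<Longrightarrow> f (r \<odot>\<^bsub>A\<^esub> x) = r \<odot>\<^bsub>B\<^esub> f x"
  using assms by (auto simp: alg_epi_def)

lemma alg_epi_abelian_group:
  assumes A: "abelian_group A" and f: "alg_epi R A B f"
  shows "abelian_group B"
proof -
  interpret A: abelian_group A by fact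
  note f = alg_epiD[OF f]
  have ex: "\<exists>a\<in>carrier A. x = f a" if "x \<in> carrier B" for x
    using that f(1) by auto
  show ?thesis
  proof (rule abelian_groupI)
    fix x y assume "x \<in> carrier B" "y \<in> carrier B"
    then obtain a b where ab: "a \<in> carrier A" "b \<in> carrier A" "x = f a" "y = f b" using ex by metis
    then show "x \<oplus>\<^bsub>B\<^esub> y \<in> carrier B" "x \<oplus>\<^bsub>B\<^esub> y = y \<oplus>\<^bsub>B\<^esub> x"
      using f(3,4) by (metis A.a_closed, metis A.a_comm f(4))
  next
    show "\<zero>\<^bsub>B\<^esub> \<in> carrier B" using f(2,3) by (metis A.zero_closed)
  next
    fix x y z assume "x \<in> carrier B" "y \<in> carrier B" "z \<in> carrier B"
    then obtain a b c where ab: "a \<in> carrier A" "b \<in> carrier A" "c \<in> carrier A" "x = f a" "y = f b" "z = f c"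
      using ex by metis
    then show "x \<oplus>\<^bsub>B\<^esub> y \<oplus>\<^bsub>B\<^esub> z = x \<oplus>\<^bsub>B\<^esub> (y \<oplus>\<^bsub>B\<^esub> z)"
      by (metis A.a_assoc A.a_closed f(4))
  next
    fix x assume "x \<in> carrier B"
    then obtain a where ab: "a \<in> carrier A" "x = f a" using ex by metis
    then show "\<zero>\<^bsub>B\<^esub> \<oplus>\<^bsub>B\<^esub> x = x" by (metis A.l_zero A.zero_closed f(2,4))
    show "\<exists>y\<in>carrier B. y \<oplus>\<^bsub>B\<^esub> x = \<zero>\<^bsub>B\<^esub>"
      using ab by (metis A.a_inv_closed A.l_neg f(2,3,4))
  qed
qed

lemma alg_epi_nonassoc_algebra:
  assumes A: "nonassoc_algebra R A" and f: "alg_epi R A B f"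
  shows "nonassoc_algebra R B"
proof -
  interpret A: nonassoc_algebra R A by fact
  interpret B: abelian_group B
    by (rule alg_epi_abelian_group[OF A.abelian_group_axioms f])
  note f = alg_epiD[OF f]
  have ex: "\<exists>a\<in>carrier A. x = f a" if "x \<in> carrier B" for x
    using that f(1) by auto
  show ?thesis
  proof
    fix x y assume "x \<in> carrier B" "y \<in> carrier B"
    then obtain a b where ab: "a \<in> carrier A" "b \<in> carrier A" "x = f a" "y = f b" using ex by metis
    then show "x \<otimes>\<^bsub>B\<^esub> y \<in> carrier B"
      by (metis A.mult_closed f(3,5))
    fix r assume "r \<in> carrier R"
    with ab show "r \<odot>\<^bsub>B\<^esub> (x \<oplus>\<^bsub>B\<^esub> y) = r \<odot>\<^bsub>B\<^esub> x \<oplus>\<^bsub>B\<^esub> r \<odot>\<^bsub>B\<^esub> y"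
      by (simp flip: f(4,6) add: A.scale_distr A.scale_closed)
  next
    fix x y z assume "x \<in> carrier B" "y \<in> carrier B" "z \<in> carrier B"
    then obtain a b c where ab: "a \<in> carrier A" "b \<in> carrier A" "c \<in> carrier A" "x = f a" "y = f b" "z = f c"
      using ex by metis
    then show "(x \<oplus>\<^bsub>B\<^esub> y) \<otimes>\<^bsub>B\<^esub> z = x \<otimes>\<^bsub>B\<^esub> z \<oplus>\<^bsub>B\<^esub> y \<otimes>\<^bsub>B\<^esub> z"
      "z \<otimes>\<^bsub>B\<^esub> (x \<oplus>\<^bsub>B\<^esub> y) = z \<otimes>\<^bsub>B\<^esub> x \<oplus>\<^bsub>B\<^esub> z \<otimes>\<^bsub>B\<^esub> y"
      by (simp_all flip: f(4,5) add: A.mult_closed A.mult_l_distr A.mult_r_distr)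
  next
    fix r x assume r: "r \<in> carrier R" "x \<in> carrier B"
    then obtain a where ab: "a \<in> carrier A" "x = f a" using ex by metis
    then show "r \<odot>\<^bsub>B\<^esub> x \<in> carrier B" using r by (metis A.scale_closed f(3,6))
  qed
qed

lemma alg_epi_module:
  assumes A: "module R A" and f: "alg_epi R A B f"
  shows "module R B"
proof -
  interpret A: module R A by fact
  interpret B: abelian_group B
    by (rule alg_epi_abelian_group[OF A.abelian_group_axioms f])
  note f = alg_epiD[OF f]
  have ex: "\<exists>a\<in>carrier A. x = f a" if "x \<in> carrier B" for x
    using that f(1) by auto
  show ?thesis
  proof
    fix r x assume r: "r \<in> carrier R" "x \<in> carrier B"
    then obtain a where a: "a \<in> carrier A" "x = f a" using ex by metis
    then show "r \<odot>\<^bsub>B\<^esub> x \<in> carrier B" using r by (metis A.smult_closed f(3,6))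
    fix s assume s: "s \<in> carrier R"
    show "(r \<oplus>\<^bsub>R\<^esub> s) \<odot>\<^bsub>B\<^esub> x = r \<odot>\<^bsub>B\<^esub> x \<oplus>\<^bsub>B\<^esub> s \<odot>\<^bsub>B\<^esub> x"
      "(r \<otimes>\<^bsub>R\<^esub> s) \<odot>\<^bsub>B\<^esub> x = r \<odot>\<^bsub>B\<^esub> (s \<odot>\<^bsub>B\<^esub> x)"
      using r s a by (simp_all flip: f(4,6) add: A.smult_l_distr A.smult_assoc1)
    fix y assume "y \<in> carrier B"
    then obtain b where b: "b \<in> carrier A" "y = f b" using ex by metis
    then show "r \<odot>\<^bsub>B\<^esub> (x \<oplus>\<^bsub>B\<^esub> y) = r \<odot>\<^bsub>B\<^esub> x \<oplus>\<^bsub>B\<^esub> r \<odot>\<^bsub>B\<^esub> y"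
      using r a by (simp flip: f(4,6) add: A.smult_r_distr)
  next
    fix x assume r: "x \<in> carrier B"
    then obtain a where a: "a \<in> carrier A" "x = f a" using ex by metis
    then show "\<one>\<^bsub>R\<^esub> \<odot>\<^bsub>B\<^esub> x = x" by (simp flip: f(6))
  qed
qed

lemma alg_epi_minus:
  assumes "abelian_group A" "alg_epi R A B f" "x \<in> carrier A"
  shows "f (\<ominus>\<^bsub>A\<^esub> x) = \<ominus>\<^bsub>B\<^esub> f x"
proof -
  interpret A: abelian_group A by fact
  interpret B: abelian_group B by (rule alg_epi_abelian_group) fact+
  note f = alg_epiD[OF assms(2)]
  show ?thesis
    using assms(3) by (metis A.a_inv_closed A.l_neg B.minus_equality f(2,3,4))
qed

lemma alg_epi_eq_iff:
  assumes "abelian_group A" "alg_epi R A B f" "x \<in> carrier A" "y \<in> carrier A"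
  shows "f x = f y \<longleftrightarrow> f (x \<ominus>\<^bsub>A\<^esub> y) = \<zero>\<^bsub>B\<^esub>"
proof -
  interpret A: abelian_group A by fact
  interpret B: abelian_group B by (rule alg_epi_abelian_group) fact+
  note f = alg_epiD[OF assms(2)]
  have "f (x \<ominus>\<^bsub>A\<^esub> y) = f x \<ominus>\<^bsub>B\<^esub> f y"
    using assms by (simp add: A.minus_eq B.minus_eq f alg_epi_minus)
  then show ?thesis
    using assms f(3) by (metis B.minus_eq B.r_neg B.add.inv_closed B.minus_equality B.minus_minus)
qed

lemma alg_epi_comp:
  assumes "alg_epi R A B f" "alg_epi R B C g"
  shows "alg_epi R A C (g \<circ> f)"
  using alg_epiD[OF assms(1)] alg_epiD[OF assms(2)]
  unfolding alg_epi_def comp_def by (simp flip: image_image[of g f])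

lemma alg_epi_factor:
  assumes A: "abelian_group A" and f: "alg_epi R A B f" and g: "alg_epi R A C g"
    and closed: "\<And>x y. \<lbrakk>x \<in> carrier A; y \<in> carrier A\<rbrakk> \<Longrightarrow> x \<otimes>\<^bsub>A\<^esub> y \<in> carrier A"
      "\<And>r x. \<lbrakk>r \<in> carrier R; x \<in> carrier A\<rbrakk> \<Longrightarrow> r \<odot>\<^bsub>A\<^esub> x \<in> carrier A"
    and ker: "\<And>a. \<lbrakk>a \<in> carrier A; f a = \<zero>\<^bsub>B\<^esub>\<rbrakk> \<Longrightarrow> g a = \<zero>\<^bsub>C\<^esub>"
  obtains h where "alg_epi R B C h" "\<And>a. a \<in> carrier A \<Longrightarrow> h (f a) = g a"
proof -
  interpret A: abelian_group A by fact
  define h where "h b = g (SOME a. a \<in> carrier A \<and> f a = b)" for b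
  have h: "h (f a) = g a" if a: "a \<in> carrier A" for a
  proof -
    define a' where "a' = (SOME x. x \<in> carrier A \<and> f x = f a)"
    have a': "a' \<in> carrier A \<and> f a' = f a"
      unfolding a'_def by (rule someI[where x = a]) (simp add: a)
    then have "g a' = g a"
      using alg_epi_eq_iff[OF A f, of a' a] alg_epi_eq_iff[OF A g, of a' a] ker[of "a' \<ominus>\<^bsub>A\<^esub> a"] a by simp
    then show ?thesis by (simp add: h_def a'_def)
  qed
  note f = alg_epiD[OF f] and g = alg_epiD[OF g]
  have ex: "\<exists>a\<in>carrier A. x = f a" if "x \<in> carrier B" for x
    using that f(1) by auto
  have "alg_epi R B C h"
    unfolding alg_epi_def
  proof (intro conjI ballI)
    show "h ` carrier B = carrier C"
      unfolding f(1)[symmetric] g(1)[symmetric] image_image by (simp add: h)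
    show "h \<zero>\<^bsub>B\<^esub> = \<zero>\<^bsub>C\<^esub>" by (metis A.zero_closed f(2) g(2) h)
  next
    fix x y assume "x \<in> carrier B" "y \<in> carrier B"
    then obtain a b where ab: "a \<in> carrier A" "b \<in> carrier A" "x = f a" "y = f b" using ex by metis
    then show "h (x \<oplus>\<^bsub>B\<^esub> y) = h x \<oplus>\<^bsub>C\<^esub> h y" "h (x \<otimes>\<^bsub>B\<^esub> y) = h x \<otimes>\<^bsub>C\<^esub> h y"
      by (simp_all add: h f(4,5)[symmetric] g(4,5) closed)
  next
    fix r x assume r: "r \<in> carrier R" "x \<in> carrier B"
    then obtain a where ab: "a \<in> carrier A" "x = f a" using ex by metis
    then show "h (r \<odot>\<^bsub>B\<^esub> x) = r \<odot>\<^bsub>C\<^esub> h x"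
      using r by (simp add: h f(6)[symmetric] g(6) closed)
  qed
  then show ?thesis using that h by blast
qed

lemma (in nonassoc_algebra) mult_zero:
  assumes "x \<in> carrier A"
  shows "x \<otimes> \<zero> = \<zero>" "\<zero> \<otimes> x = \<zero>"
proof -
  have "x \<otimes> \<zero> \<oplus> x \<otimes> \<zero> = x \<otimes> \<zero>" "\<zero> \<otimes> x \<oplus> \<zero> \<otimes> x = \<zero> \<otimes> x"
    using assms mult_r_distr[of \<zero> \<zero> x] mult_l_distr[of \<zero> \<zero> x] by simp_all
  then show "x \<otimes> \<zero> = \<zero>" "\<zero> \<otimes> x = \<zero>"
    using assms mult_closed by (metis add.r_cancel_one' zero_closed)+
qed

lemma (in nonassoc_algebra) scale_zero:
  assumes "r \<in> carrier R"
  shows "r \<odot>\<^bsub>A\<^esub> \<zero> = \<zero>"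
  using assms scale_closed scale_distr[of r \<zero> \<zero>] by (metis add.r_cancel_one' zero_closed l_zero)

lemma submodule_iff:
  assumes "abelian_group A"
  shows "submodule H R A \<longleftrightarrow> H \<subseteq> carrier A \<and> \<zero>\<^bsub>A\<^esub> \<in> H \<and> (\<forall>x\<in>H. \<forall>y\<in>H. x \<oplus>\<^bsub>A\<^esub> y \<in> H) \<and>
    (\<forall>x\<in>H. \<ominus>\<^bsub>A\<^esub> x \<in> H) \<and> (\<forall>r\<in>carrier R. \<forall>x\<in>H. r \<odot>\<^bsub>A\<^esub> x \<in> H)"
  unfolding submodule_def submodule_axioms_def subgroup_def a_inv_def by auto


lemma submodule_image:
  assumes A: "abelian_group A" and f: "alg_epi R A B f" and N: "submodule N R A"
  shows "submodule (f ` N) R B"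
proof -
  have B: "abelian_group B" by (rule alg_epi_abelian_group) fact+
  note f' = alg_epiD[OF f]
  note N' = N[unfolded submodule_iff[OF A]]
  have sub: "x \<in> carrier A" if "x \<in> N" for x using N' that by auto
  show ?thesis
    unfolding submodule_iff[OF B]
  proof (intro conjI ballI)
    show "f ` N \<subseteq> carrier B" using f'(3) sub by auto
    show "\<zero>\<^bsub>B\<^esub> \<in> f ` N" using N' f'(2) by (metis imageI)
    fix x assume "x \<in> f ` N"
    then obtain a where a: "a \<in> N" "x = f a" by auto
    show "\<ominus>\<^bsub>B\<^esub> x \<in> f ` N"
      using a N' sub alg_epi_minus[OF A f] by (metis imageI)
    show "r \<odot>\<^bsub>B\<^esub> x \<in> f ` N" if "r \<in> carrier R" for r
      using that a N' sub f'(6) by (metis imageI)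
    fix y assume "y \<in> f ` N"
    then obtain b where "b \<in> N" "y = f b" by auto
    then show "x \<oplus>\<^bsub>B\<^esub> y \<in> f ` N"
      using a N' sub f'(4) by (metis imageI)
  qed
qed

lemma submodule_preimage:
  assumes A: "nonassoc_algebra R A" and f: "alg_epi R A B f" and N: "submodule N R B"
  shows "submodule {a \<in> carrier A. f a \<in> N} R A"
proof -
  interpret A: nonassoc_algebra R A by fact
  have B: "abelian_group B" by (rule alg_epi_abelian_group[OF _ f]) unfold_locales
  note f' = alg_epiD[OF f]
  note N' = N[unfolded submodule_iff[OF B]]
  show ?thesis
    unfolding submodule_iff[OF A.abelian_group_axioms]
    using N' by (auto simp: f' A.scale_closed alg_epi_minus[OF A.abelian_group_axioms f])
qed

lemma alg_ideal_image:
  assumes A: "nonassoc_algebra R A" and f: "alg_epi R A B f" and I: "alg_ideal R A I"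
  shows "alg_ideal R B (f ` I)"
proof -
  interpret A: nonassoc_algebra R A by fact
  note f' = alg_epiD[OF f]
  have sub: "x \<in> carrier A" if "x \<in> I" for x
    using I that unfolding alg_ideal_def submodule_iff[OF A.abelian_group_axioms] by auto
  have "submodule (f ` I) R B"
    using submodule_image[OF A.abelian_group_axioms f] I by (simp add: alg_ideal_def)
  moreover have "f x \<otimes>\<^bsub>B\<^esub> f y \<in> f ` I \<and> f y \<otimes>\<^bsub>B\<^esub> f x \<in> f ` I" if "x \<in> carrier A" "y \<in> I" for x y
    using that sub I by (auto simp: f'(5)[symmetric] alg_ideal_def)
  ultimately show ?thesis
    unfolding alg_ideal_def f'(1)[symmetric] by blast
qed

lemma alg_ideal_preimage:
  assumes A: "nonassoc_algebra R A" and f: "alg_epi R A B f" and J: "alg_ideal R B J"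
  shows "alg_ideal R A {a \<in> carrier A. f a \<in> J}"
proof -
  interpret A: nonassoc_algebra R A by fact
  note f' = alg_epiD[OF f]
  show ?thesis
    using submodule_preimage[OF A f] J unfolding alg_ideal_def
    by (auto simp: f' A.mult_closed)
qed

lemma image_preimage_ideal:
  assumes "alg_epi R A B f" "alg_ideal R B J"
    and B: "abelian_group B"
  shows "f ` {a \<in> carrier A. f a \<in> J} = J"
proof -
  have "J \<subseteq> f ` carrier A"
    using assms(2) unfolding alg_ideal_def submodule_iff[OF B] alg_epiD(1)[OF assms(1)] by auto
  then show ?thesis by auto
qed

lemma preimage_image_submodule:
  assumes A: "abelian_group A" and f: "alg_epi R A B f" and I: "submodule I R A"
    and ker: "{a \<in> carrier A. f a = \<zero>\<^bsub>B\<^esub>} \<subseteq> I"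
  shows "{a \<in> carrier A. f a \<in> f ` I} = I"
proof -
  interpret A: abelian_group A by fact
  note I' = I[unfolded submodule_iff[OF A]]
  have "a \<in> I" if a: "a \<in> carrier A" "x \<in> I" "f a = f x" for a x
  proof -
    have x: "x \<in> carrier A" using a I' by auto
    then have "a \<ominus>\<^bsub>A\<^esub> x \<in> I" using ker a alg_epi_eq_iff[OF A f a(1) x] by auto
    then have "(a \<ominus>\<^bsub>A\<^esub> x) \<oplus>\<^bsub>A\<^esub> x \<in> I" using I' a by auto
    then show ?thesis using a x by (simp add: A.minus_eq A.a_assoc A.l_neg)
  qed
  then show ?thesis using I' by auto
qed

lemma card_image_submodule:
  assumes A: "abelian_group A" and f: "alg_epi R A B f" and I: "submodule I R A"
    and ker: "{a \<in> carrier A. f a = \<zero>\<^bsub>B\<^esub>} \<subseteq> I" and fin: "finite (carrier A)"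
  shows "card I = card {a \<in> carrier A. f a = \<zero>\<^bsub>B\<^esub>} * card (f ` I)"
proof -
  interpret A: abelian_group A by fact
  interpret B: abelian_group B by (rule alg_epi_abelian_group) fact+
  note f' = alg_epiD[OF f]
  note I' = I[unfolded submodule_iff[OF A]]
  have sub: "x \<in> carrier A" if "x \<in> I" for x using I' that by auto
  let ?K = "{a \<in> carrier A. f a = \<zero>\<^bsub>B\<^esub>}"
  have fib: "card {a \<in> I. f a = b} = card ?K" if b: "b \<in> f ` I" for b
  proof -
    obtain x where x: "x \<in> I" "b = f x" using b by auto
    have "bij_betw (\<lambda>a. a \<oplus>\<^bsub>A\<^esub> x) ?K {a \<in> I. f a = b}"
    proof (rule bij_betwI[where g = "\<lambda>a. a \<ominus>\<^bsub>A\<^esub> x"])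
      show "(\<lambda>a. a \<oplus>\<^bsub>A\<^esub> x) \<in> ?K \<rightarrow> {a \<in> I. f a = b}"
        using x ker I' sub by (auto simp: f')
      show "(\<lambda>a. a \<ominus>\<^bsub>A\<^esub> x) \<in> {a \<in> I. f a = b} \<rightarrow> ?K"
        using x I' sub alg_epi_eq_iff[OF A f] by auto
    qed (use x sub in \<open>auto simp: A.minus_eq A.a_assoc A.l_neg A.r_neg\<close>)
    then show ?thesis by (simp add: bij_betw_same_card)
  qed
  have "finite I" using fin sub by (meson finite_subset subsetI)
  then have "card I = (\<Sum>b\<in>f ` I. card {a \<in> I. f a = b})"
    unfolding card_eq_sum by (rule sum.image_gen)
  then show ?thesis using fib by simp
qed

lemma card_ideals_epi:
  assumes A: "nonassoc_algebra R A" and f: "alg_epi R A B f" and fin: "finite (carrier A)"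
  shows "card {J. alg_ideal R B J \<and> card (carrier B) = d * card J} =
    card {I. alg_ideal R A I \<and> {a \<in> carrier A. f a = \<zero>\<^bsub>B\<^esub>} \<subseteq> I \<and> card (carrier A) = d * card I}"
    (is "card ?S = card ?T")
proof -
  interpret A: nonassoc_algebra R A by fact
  note ab = A.abelian_group_axioms
  interpret B: abelian_group B by (rule alg_epi_abelian_group[OF ab f])
  let ?K = "{a \<in> carrier A. f a = \<zero>\<^bsub>B\<^esub>}"
  have carr: "card (carrier A) = card ?K * card (carrier B)"
    using card_image_submodule[OF ab f _ _ fin, of "carrier A"] alg_epiD(1)[OF f]
    by (auto simp: submodule_iff[OF ab] A.scale_closed)
  have "\<zero>\<^bsub>A\<^esub> \<in> ?K" using alg_epiD(2)[OF f] by simp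
  then have pos: "card ?K \<noteq> 0" using fin by auto
  have "bij_betw (\<lambda>I. f ` I) ?T ?S"
  proof (rule bij_betwI[where g = "\<lambda>J. {a \<in> carrier A. f a \<in> J}"])
    show "(\<lambda>I. f ` I) \<in> ?T \<rightarrow> ?S"
      using alg_ideal_image[OF A f] card_image_submodule[OF ab f _ _ fin] carr pos
      by (auto simp: alg_ideal_def)
    show "(\<lambda>J. {a \<in> carrier A. f a \<in> J}) \<in> ?S \<rightarrow> ?T"
    proof
      fix J assume J: "J \<in> ?S"
      let ?I = "{a \<in> carrier A. f a \<in> J}"
      have I: "alg_ideal R A ?I" using alg_ideal_preimage[OF A f] J by blast
      have z: "\<zero>\<^bsub>B\<^esub> \<in> J" using J by (simp add: alg_ideal_def submodule_iff[OF B.abelian_group_axioms])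
      have "card ?I = card ?K * card (f ` ?I)"
        using I z by (intro card_image_submodule[OF ab f _ _ fin]) (auto simp: alg_ideal_def)
      also have "f ` ?I = J" using image_preimage_ideal[OF f] J B.abelian_group_axioms by blast
      finally show "?I \<in> ?T" using I J z carr by auto
    qed
    show "{a \<in> carrier A. f a \<in> f ` I} = I" if "I \<in> ?T" for I
      using preimage_image_submodule[OF ab f] that by (auto simp: alg_ideal_def)
    show "f ` {a \<in> carrier A. f a \<in> J} = J" if "J \<in> ?S" for J
      using image_preimage_ideal[OF f] that B.abelian_group_axioms by blast
  qed
  then show ?thesis by (simp add: bij_betw_same_card)
qed

lemma alg_quot_epi:
  assumes A: "nonassoc_algebra R A" and I: "alg_ideal R A I"
  shows "alg_epi R A (A aQuot I) (\<lambda>x. I +>\<^bsub>A\<^esub> x)"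
proof -
  interpret A: nonassoc_algebra R A by fact
  note ab = A.abelian_group_axioms
  have sub: "submodule I R A" and ide: "\<And>x y. \<lbrakk>x \<in> carrier A; y \<in> I\<rbrakk> \<Longrightarrow> x \<otimes>\<^bsub>A\<^esub> y \<in> I \<and> y \<otimes>\<^bsub>A\<^esub> x \<in> I"
    using I by (auto simp: alg_ideal_def)
  note I' = sub[unfolded submodule_iff[OF ab]]
  interpret I: abelian_subgroup I A
    using sub by (intro abelian_subgroupI2 A.a_comm_group) (simp add: submodule_def)
  have self: "x \<in> I +>\<^bsub>A\<^esub> x" if "x \<in> carrier A" for x
    using that by (rule I.a_rcos_self)
  have indep: "I +>\<^bsub>A\<^esub> x' = I +>\<^bsub>A\<^esub> x" if "x' \<in> I +>\<^bsub>A\<^esub> x" "x \<in> carrier A" for x x'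
    using I.a_repr_independence'[of x' x] that by simp
  have memI: "h \<oplus>\<^bsub>A\<^esub> x \<in> I +>\<^bsub>A\<^esub> x" if "h \<in> I" "x \<in> carrier A" for h x
    using that by (auto simp: a_r_coset_def')
  have memE: "\<exists>h\<in>I. x' = h \<oplus>\<^bsub>A\<^esub> x" if "x' \<in> I +>\<^bsub>A\<^esub> x" for x x'
    using that by (auto simp: a_r_coset_def')
  have c: "h \<in> carrier A" if "h \<in> I" for h using I' that by auto
  have mult: "x' \<otimes>\<^bsub>A\<^esub> y' \<in> I +>\<^bsub>A\<^esub> (x \<otimes>\<^bsub>A\<^esub> y)"
    if x: "x' \<in> I +>\<^bsub>A\<^esub> x" "x \<in> carrier A" and y: "y' \<in> I +>\<^bsub>A\<^esub> y" "y \<in> carrier A" for x x' y y'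
  proof -
    obtain h k where h: "h \<in> I" "x' = h \<oplus>\<^bsub>A\<^esub> x" and k: "k \<in> I" "y' = k \<oplus>\<^bsub>A\<^esub> y"
      using memE x y by metis
    have "x' \<otimes>\<^bsub>A\<^esub> y' = (h \<otimes>\<^bsub>A\<^esub> y' \<oplus>\<^bsub>A\<^esub> x \<otimes>\<^bsub>A\<^esub> k) \<oplus>\<^bsub>A\<^esub> x \<otimes>\<^bsub>A\<^esub> y"
      using x y h k c by (simp add: A.mult_l_distr A.mult_r_distr A.mult_closed A.a_ac)
    moreover have "h \<otimes>\<^bsub>A\<^esub> y' \<oplus>\<^bsub>A\<^esub> x \<otimes>\<^bsub>A\<^esub> k \<in> I"
      using h k x y c ide I' by simp
    ultimately show ?thesis using memI x y A.mult_closed by simp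
  qed
  have scale: "r \<odot>\<^bsub>A\<^esub> x' \<in> I +>\<^bsub>A\<^esub> (r \<odot>\<^bsub>A\<^esub> x)"
    if x: "x' \<in> I +>\<^bsub>A\<^esub> x" "x \<in> carrier A" and r: "r \<in> carrier R" for x x' r
  proof -
    obtain h where h: "h \<in> I" "x' = h \<oplus>\<^bsub>A\<^esub> x" using memE x by metis
    then show ?thesis
      using c x r I' memI by (simp add: A.scale_distr A.scale_closed)
  qed
  show ?thesis
    unfolding alg_epi_def
  proof (intro conjI ballI)
    show "(+>\<^bsub>A\<^esub>) I ` carrier A = carrier (A aQuot I)"
      by (auto simp: alg_quot_def A_RCOSETS_def')
    show "I +>\<^bsub>A\<^esub> \<zero>\<^bsub>A\<^esub> = \<zero>\<^bsub>A aQuot I\<^esub>"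
      using I' by (simp add: alg_quot_def)
    fix x assume x: "x \<in> carrier A"
    show "I +>\<^bsub>A\<^esub> r \<odot>\<^bsub>A\<^esub> x = r \<odot>\<^bsub>A aQuot I\<^esub> (I +>\<^bsub>A\<^esub> x)" if "r \<in> carrier R" for r
    proof -
      have "(\<Union>x'\<in>I +>\<^bsub>A\<^esub> x. I +>\<^bsub>A\<^esub> r \<odot>\<^bsub>A\<^esub> x') = (\<Union>x'\<in>I +>\<^bsub>A\<^esub> x. I +>\<^bsub>A\<^esub> r \<odot>\<^bsub>A\<^esub> x)"
        using x that indep[OF scale] A.scale_closed by (intro SUP_cong) auto
      then show ?thesis using self[OF x] by (auto simp: alg_quot_def)
    qed
    fix y assume y: "y \<in> carrier A"
    show "I +>\<^bsub>A\<^esub> (x \<oplus>\<^bsub>A\<^esub> y) = (I +>\<^bsub>A\<^esub> x) \<oplus>\<^bsub>A aQuot I\<^esub> (I +>\<^bsub>A\<^esub> y)"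
      using x y by (simp add: alg_quot_def I.a_rcos_sum)
    show "I +>\<^bsub>A\<^esub> x \<otimes>\<^bsub>A\<^esub> y = (I +>\<^bsub>A\<^esub> x) \<otimes>\<^bsub>A aQuot I\<^esub> (I +>\<^bsub>A\<^esub> y)"
    proof -
      have "(\<Union>x'\<in>I +>\<^bsub>A\<^esub> x. \<Union>y'\<in>I +>\<^bsub>A\<^esub> y. I +>\<^bsub>A\<^esub> x' \<otimes>\<^bsub>A\<^esub> y') =
          (\<Union>x'\<in>I +>\<^bsub>A\<^esub> x. \<Union>y'\<in>I +>\<^bsub>A\<^esub> y. I +>\<^bsub>A\<^esub> x \<otimes>\<^bsub>A\<^esub> y)"
        using x y indep[OF mult] A.mult_closed by (intro SUP_cong) auto
      then show ?thesis using self[OF x] self[OF y] by (auto simp: alg_quot_def rcoset_mult_def)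
    qed
  qed
qed

lemma alg_quot_zero_iff:
  assumes A: "abelian_group A" and I: "submodule I R A" and x: "x \<in> carrier A"
  shows "I +>\<^bsub>A\<^esub> x = \<zero>\<^bsub>A aQuot I\<^esub> \<longleftrightarrow> x \<in> I"
proof -
  interpret A: abelian_group A by fact
  have "subgroup I (add_monoid A)" using I by (simp add: submodule_def)
  then have "I +>\<^bsub>A\<^esub> x = I \<longleftrightarrow> x \<in> I"
    using x A.a_coset_join1 A.a_coset_join2 I by (metis submodule_iff[OF A])
  then show ?thesis by (simp add: alg_quot_def)
qed

lemma submodule_carrier: "nonassoc_algebra R A \<Longrightarrow> submodule (carrier A) R A"
  by (auto simp: submodule_iff nonassoc_algebra_def nonassoc_algebra_axioms_def abelian_group.a_inv_closed
      abelian_groupE)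

lemma submodule_submodule_gen:
  assumes A: "nonassoc_algebra R A" and S: "S \<subseteq> carrier A"
  shows "submodule (submodule_gen R A S) R A" "S \<subseteq> submodule_gen R A S"
proof -
  interpret A: nonassoc_algebra R A by fact
  show "submodule (submodule_gen R A S) R A"
    using S submodule_carrier[OF A]
    unfolding submodule_gen_def submodule_iff[OF A.abelian_group_axioms] by auto
qed (auto simp: submodule_gen_def)

lemma submodule_gen_least: "submodule N R A \<Longrightarrow> S \<subseteq> N \<Longrightarrow> submodule_gen R A S \<subseteq> N"
  by (auto simp: submodule_gen_def)

lemma submodule_gen_mono: "S \<subseteq> T \<Longrightarrow> submodule_gen R A S \<subseteq> submodule_gen R A T"
  by (auto simp: submodule_gen_def)

lemma alg_ideal_alg_ideal_gen:
  assumes A: "nonassoc_algebra R A" and S: "S \<subseteq> carrier A"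
  shows "alg_ideal R A (alg_ideal_gen R A S)" "S \<subseteq> alg_ideal_gen R A S"
proof -
  interpret A: nonassoc_algebra R A by fact
  have "alg_ideal R A (carrier A)"
    using submodule_carrier[OF A] A.mult_closed by (simp add: alg_ideal_def)
  then show "alg_ideal R A (alg_ideal_gen R A S)"
    using S unfolding alg_ideal_gen_def alg_ideal_def submodule_iff[OF A.abelian_group_axioms] by auto
qed (auto simp: alg_ideal_gen_def)

lemma alg_ideal_gen_least: "alg_ideal R A I \<Longrightarrow> S \<subseteq> I \<Longrightarrow> alg_ideal_gen R A S \<subseteq> I"
  by (auto simp: alg_ideal_gen_def)

subsection \<open>Rank\<close>

definition lincomb :: "('r, 'a, 'm) module_scheme \<Rightarrow> 'a set \<Rightarrow> ('a \<Rightarrow> 'r) \<Rightarrow> 'a" where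
  "lincomb M B c = (\<Oplus>\<^bsub>M\<^esub>b\<in>B. c b \<odot>\<^bsub>M\<^esub> b)"

lemma alg_epi_inj:
  assumes A: "abelian_group A" and f: "alg_epi R A B f"
    and ker: "\<And>x. \<lbrakk>x \<in> carrier A; f x = \<zero>\<^bsub>B\<^esub>\<rbrakk> \<Longrightarrow> x = \<zero>\<^bsub>A\<^esub>"
  shows "inj_on f (carrier A)"
proof (rule inj_onI)
  interpret A: abelian_group A by fact
  fix x y assume xy: "x \<in> carrier A" "y \<in> carrier A" "f x = f y"
  then have "x \<ominus>\<^bsub>A\<^esub> y = \<zero>\<^bsub>A\<^esub>" using ker alg_epi_eq_iff[OF A f xy(1,2)] by simp
  then show "x = y"
    using xy by (metis A.minus_eq A.r_neg A.add.inv_closed A.minus_equality A.minus_minus)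
qed

lemma bij_betw_iff_ex1:
  assumes "F \<in> D \<rightarrow> C"
  shows "bij_betw F D C \<longleftrightarrow> (\<forall>x\<in>C. \<exists>!c. c \<in> D \<and> x = F c)"
proof
  assume "bij_betw F D C"
  then have "inj_on F D" "F ` D = C" by (auto simp: bij_betw_def)
  then show "\<forall>x\<in>C. \<exists>!c. c \<in> D \<and> x = F c" by (blast dest: inj_onD)
next
  assume *: "\<forall>x\<in>C. \<exists>!c. c \<in> D \<and> x = F c"
  then have "inj_on F D" using assms by (intro inj_onI) (metis PiE)
  moreover have "F ` D = C" using * assms by blast
  ultimately show "bij_betw F D C" by (simp add: bij_betw_def)
qed

lemma has_rank_iff_bij:
  assumes M: "module R M"
  shows "has_rank R M n \<longleftrightarrow> (\<exists>B\<subseteq>carrier M. finite B \<and> card B = n \<and>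
    bij_betw (lincomb M B) (B \<rightarrow>\<^sub>E carrier R) (carrier M))"
proof -
  interpret M: module R M by fact
  have "(\<forall>x\<in>carrier M. \<exists>!c. c \<in> B \<rightarrow>\<^sub>E carrier R \<and> x = lincomb M B c) \<longleftrightarrow>
      bij_betw (lincomb M B) (B \<rightarrow>\<^sub>E carrier R) (carrier M)" if B: "B \<subseteq> carrier M" for B
  proof -
    have "lincomb M B c \<in> carrier M" if "c \<in> B \<rightarrow>\<^sub>E carrier R" for c
      using B that unfolding lincomb_def by (intro M.finsum_closed) (auto simp: PiE_def Pi_def)
    then show ?thesis by (intro bij_betw_iff_ex1[symmetric] funcsetI)
  qed
  then show ?thesis
    unfolding has_rank_def by (intro ex_cong1 conj_cong refl) (simp only: lincomb_def[abs_def])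
qed

lemma has_rank_card:
  assumes "module R M" "has_rank R M n"
  shows "card (carrier M) = card (carrier R) ^ n"
proof -
  obtain B where B: "finite B" "card B = n"
    and bij: "bij_betw (lincomb M B) (B \<rightarrow>\<^sub>E carrier R) (carrier M)"
    using assms(2) unfolding has_rank_iff_bij[OF assms(1)] by auto
  show ?thesis
    using bij_betw_same_card[OF bij] B by (simp add: card_PiE)
qed

lemma (in module) lincomb_props:
  assumes B: "finite B" "B \<subseteq> carrier M" and c: "c \<in> B \<rightarrow>\<^sub>E carrier R" and d: "d \<in> B \<rightarrow>\<^sub>E carrier R"
  shows "lincomb M B c \<in> carrier M"
    and "lincomb M B (\<lambda>b\<in>B. c b \<oplus> d b) = lincomb M B c \<oplus>\<^bsub>M\<^esub> lincomb M B d"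
    and "r \<in> carrier R \<Longrightarrow> lincomb M B (\<lambda>b\<in>B. r \<otimes> c b) = r \<odot>\<^bsub>M\<^esub> lincomb M B c"
    and "\<lbrakk>v \<in> carrier M; v \<notin> B; r \<in> carrier R\<rbrakk> \<Longrightarrow>
      lincomb M (insert v B) (c(v := r)) = r \<odot>\<^bsub>M\<^esub> v \<oplus>\<^bsub>M\<^esub> lincomb M B c"
proof -
  have cB: "c b \<in> carrier R" "d b \<in> carrier R" "b \<in> carrier M" if "b \<in> B" for b using c d B that by auto
  show "lincomb M B c \<in> carrier M" by (auto simp: lincomb_def cB intro!: finsum_closed)
  have "lincomb M B (\<lambda>b\<in>B. c b \<oplus> d b) = (\<Oplus>\<^bsub>M\<^esub>b\<in>B. c b \<odot>\<^bsub>M\<^esub> b \<oplus>\<^bsub>M\<^esub> d b \<odot>\<^bsub>M\<^esub> b)"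
    unfolding lincomb_def by (intro finsum_cong') (auto simp: cB smult_l_distr)
  then show "lincomb M B (\<lambda>b\<in>B. c b \<oplus> d b) = lincomb M B c \<oplus>\<^bsub>M\<^esub> lincomb M B d"
    unfolding lincomb_def by (subst finsum_addf[symmetric]) (auto simp: cB)
  show "lincomb M B (\<lambda>b\<in>B. r \<otimes> c b) = r \<odot>\<^bsub>M\<^esub> lincomb M B c" if r: "r \<in> carrier R"
    unfolding lincomb_def using r B(1)
    by (subst finsum_smult_ldistr) (auto simp: cB smult_assoc1 intro!: finsum_cong')
  show "lincomb M (insert v B) (c(v := r)) = r \<odot>\<^bsub>M\<^esub> v \<oplus>\<^bsub>M\<^esub> lincomb M B c"
    if v: "v \<in> carrier M" "v \<notin> B" "r \<in> carrier R"
  proof -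
    have "lincomb M (insert v B) (c(v := r)) = r \<odot>\<^bsub>M\<^esub> v \<oplus>\<^bsub>M\<^esub> (\<Oplus>\<^bsub>M\<^esub>b\<in>B. (c(v := r)) b \<odot>\<^bsub>M\<^esub> b)"
      unfolding lincomb_def using v B cB by (subst finsum_insert) (auto simp: Pi_def)
    also have "(\<Oplus>\<^bsub>M\<^esub>b\<in>B. (c(v := r)) b \<odot>\<^bsub>M\<^esub> b) = lincomb M B c"
      unfolding lincomb_def using v cB by (intro finsum_cong') auto
    finally show ?thesis .
  qed
qed

lemma (in module) lincomb_unit:
  assumes B: "finite B" "B \<subseteq> carrier M" and v: "v \<in> B"
  shows "lincomb M B (\<lambda>b\<in>B. if b = v then \<one> else \<zero>) = v"
proof -
  have "lincomb M B (\<lambda>b\<in>B. if b = v then \<one> else \<zero>) = (\<Oplus>\<^bsub>M\<^esub>b\<in>B. if v = b then b else \<zero>\<^bsub>M\<^esub>)"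
    unfolding lincomb_def using B by (intro finsum_cong') auto
  also have "\<dots> = v"
    using B v by (intro M.add.finprod_singleton) auto
  finally show ?thesis .
qed

lemma (in abelian_group) add_minus_cancel:
  assumes "a \<in> carrier G" "x \<in> carrier G" "y \<in> carrier G"
  shows "(a \<oplus> y) \<oplus> \<ominus> x \<oplus> \<ominus> a = y \<oplus> \<ominus> x"
proof -
  have "(a \<oplus> y) \<oplus> \<ominus> x \<oplus> \<ominus> a = a \<oplus> (\<ominus> a \<oplus> (y \<oplus> \<ominus> x))"
    using assms by (simp add: a_ac)
  then show ?thesis using assms by (simp add: r_neg2)
qed

lemma vector_space_has_rank:
  assumes "field K" and V: "module K V" and fin: "finite (carrier V)"
  shows "\<exists>n. has_rank K V n"
proof -
  interpret K: field K by fact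
  interpret V: module K V by fact
  define P where "P B \<longleftrightarrow> B \<subseteq> carrier V \<and> inj_on (lincomb V B) (B \<rightarrow>\<^sub>E carrier K)" for B
  have "P {}" by (simp add: P_def)
  moreover have "\<forall>B. P B \<longrightarrow> card B < Suc (card (carrier V))"
    using fin card_mono by (auto simp: P_def less_Suc_eq_le)
  ultimately obtain B where B: "P B" and max: "\<And>B'. P B' \<Longrightarrow> card B' \<le> card B"
    using ex_has_greatest_nat[of P "{}" card] by blast
  have B': "B \<subseteq> carrier V" "finite B" "inj_on (lincomb V B) (B \<rightarrow>\<^sub>E carrier K)"
    using B fin finite_subset by (auto simp: P_def)
  note props = V.lincomb_props[OF B'(2,1)]
  let ?S = "lincomb V B ` (B \<rightarrow>\<^sub>E carrier K)"
  have S_add: "x \<oplus>\<^bsub>V\<^esub> y \<in> ?S" if xy: "x \<in> ?S" "y \<in> ?S" for x y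
  proof -
    obtain c d where "c \<in> B \<rightarrow>\<^sub>E carrier K" "x = lincomb V B c" "d \<in> B \<rightarrow>\<^sub>E carrier K" "y = lincomb V B d"
      using xy by (elim imageE) blast
    then show ?thesis
      using props(2)[of c d] by (intro image_eqI[where x = "\<lambda>b\<in>B. c b \<oplus>\<^bsub>K\<^esub> d b"]) auto
  qed
  have S_scale: "r \<odot>\<^bsub>V\<^esub> x \<in> ?S" if x: "x \<in> ?S" and r: "r \<in> carrier K" for x r
  proof -
    obtain c where "c \<in> B \<rightarrow>\<^sub>E carrier K" "x = lincomb V B c" using x by (elim imageE) blast
    then show ?thesis
      using props(3)[of c c r] r by (intro image_eqI[where x = "\<lambda>b\<in>B. r \<otimes>\<^bsub>K\<^esub> c b"]) auto
  qed
  have "v \<in> ?S" if v: "v \<in> carrier V" for v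
  proof (rule ccontr)
    assume nS: "v \<notin> ?S"
    have vB: "v \<notin> B"
    proof
      assume "v \<in> B"
      then have "v = lincomb V B (\<lambda>b\<in>B. if b = v then \<one>\<^bsub>K\<^esub> else \<zero>\<^bsub>K\<^esub>)"
        using V.lincomb_unit[OF B'(2,1)] by simp
      moreover have "(\<lambda>b\<in>B. if b = v then \<one>\<^bsub>K\<^esub> else \<zero>\<^bsub>K\<^esub>) \<in> B \<rightarrow>\<^sub>E carrier K" by auto
      ultimately show False using nS by (metis imageI)
    qed
    have "P (insert v B)"
      unfolding P_def
    proof (intro conjI inj_onI)
      show "insert v B \<subseteq> carrier V" using B' v by auto
      fix c d assume c: "c \<in> insert v B \<rightarrow>\<^sub>E carrier K" and d: "d \<in> insert v B \<rightarrow>\<^sub>E carrier K"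
        and eq: "lincomb V (insert v B) c = lincomb V (insert v B) d"
      define c' d' where "c' = c(v := undefined)" and "d' = d(v := undefined)"
      have c': "c' \<in> B \<rightarrow>\<^sub>E carrier K" and d': "d' \<in> B \<rightarrow>\<^sub>E carrier K"
        using c d vB by (auto simp: c'_def d'_def PiE_iff extensional_def)
      have cc: "c = c'(v := c v)" and dd: "d = d'(v := d v)" by (auto simp: c'_def d'_def)
      have cv: "c v \<in> carrier K" "d v \<in> carrier K" using c d by auto
      let ?x = "lincomb V B c'" and ?y = "lincomb V B d'"
      have xy: "?x \<in> carrier V" "?y \<in> carrier V" "?x \<in> ?S" "?y \<in> ?S" using props(1) c' d' by auto
      have e: "c v \<odot>\<^bsub>V\<^esub> v \<oplus>\<^bsub>V\<^esub> ?x = d v \<odot>\<^bsub>V\<^esub> v \<oplus>\<^bsub>V\<^esub> ?y"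
        using eq props(4)[OF c' c' v vB cv(1)] props(4)[OF d' d' v vB cv(2)] cc dd by metis
      show "c = d"
      proof (cases "c v = d v")
        case True
        then have "?x \<oplus>\<^bsub>V\<^esub> c v \<odot>\<^bsub>V\<^esub> v = ?y \<oplus>\<^bsub>V\<^esub> c v \<odot>\<^bsub>V\<^esub> v"
          using e xy(1,2) v cv by (simp add: V.M.a_comm)
        then have "?x = ?y" using V.M.add.right_cancel[OF V.smult_closed] xy v cv by blast
        then have "c' = d'" using B'(3) c' d' by (auto dest: inj_onD)
        then show ?thesis using True cc dd by metis
      next
        case False
        let ?r = "c v \<ominus>\<^bsub>K\<^esub> d v"
        have r: "?r \<in> Units K" using False cv by (simp add: K.field_Units)
        have "?r \<odot>\<^bsub>V\<^esub> v = c v \<odot>\<^bsub>V\<^esub> v \<oplus>\<^bsub>V\<^esub> \<ominus>\<^bsub>V\<^esub> (d v \<odot>\<^bsub>V\<^esub> v)"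
          using cv v by (simp add: K.minus_eq V.smult_l_distr V.smult_l_minus)
        also have "\<dots> = (d v \<odot>\<^bsub>V\<^esub> v \<oplus>\<^bsub>V\<^esub> ?y) \<oplus>\<^bsub>V\<^esub> \<ominus>\<^bsub>V\<^esub> ?x \<oplus>\<^bsub>V\<^esub> \<ominus>\<^bsub>V\<^esub> (d v \<odot>\<^bsub>V\<^esub> v)"
          using e[symmetric] cv v xy by (simp add: V.M.a_assoc V.M.r_neg)
        also have "\<dots> = ?y \<oplus>\<^bsub>V\<^esub> \<ominus>\<^bsub>V\<^esub> ?x"
          by (rule V.M.add_minus_cancel) (use cv v xy in auto)
        also have "\<ominus>\<^bsub>V\<^esub> ?x = (\<ominus>\<^bsub>K\<^esub> \<one>\<^bsub>K\<^esub>) \<odot>\<^bsub>V\<^esub> ?x"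
          using xy by (simp add: V.smult_l_minus)
        finally have "?r \<odot>\<^bsub>V\<^esub> v \<in> ?S"
          using S_add S_scale xy by simp
        then have "inv\<^bsub>K\<^esub> ?r \<odot>\<^bsub>V\<^esub> (?r \<odot>\<^bsub>V\<^esub> v) \<in> ?S" using S_scale r K.Units_inv_closed by blast
        then have "v \<in> ?S"
          using r v cv by (simp flip: V.smult_assoc1)
        then show ?thesis using nS by blast
      qed
    qed
    then have "card (insert v B) \<le> card B" by (rule max)
    then show False using vB B' by simp
  qed
  moreover have "?S \<subseteq> carrier V" using props(1) by auto
  ultimately have "bij_betw (lincomb V B) (B \<rightarrow>\<^sub>E carrier K) (carrier V)"
    using B' by (auto simp: bij_betw_def)
  then show ?thesis
    using B' unfolding has_rank_iff_bij[OF V] by blast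
qed

lemma has_rank_iff_card:
  assumes "field K" "module K V" "finite (carrier V)" "1 < card (carrier K)"
  shows "has_rank K V n \<longleftrightarrow> card (carrier V) = card (carrier K) ^ n"
proof -
  obtain m where "has_rank K V m" using vector_space_has_rank assms by blast
  then show ?thesis using has_rank_card[OF assms(2)] assms(4) by (metis power_inject_exp)
qed

lemma ideal_count_card:
  assumes K: "field K" "1 < card (carrier K)"
    and N: "module K N" "nonassoc_algebra K N" "finite (carrier N)"
    and g: "alg_epi K N L g" and ker: "\<And>x. \<lbrakk>x \<in> carrier N; g x = \<zero>\<^bsub>L\<^esub>\<rbrakk> \<Longrightarrow> x = \<zero>\<^bsub>N\<^esub>"
  shows "ideal_count K L i =
    card {I. alg_ideal K N I \<and> card (carrier N) = card (carrier K) ^ i * card I}"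
proof -
  have L: "module K L" "nonassoc_algebra K L" "finite (carrier L)"
    using alg_epi_module[OF N(1) g] alg_epi_nonassoc_algebra[OF N(2) g] N(3)
    by (simp_all flip: alg_epiD(1)[OF g])
  interpret N: nonassoc_algebra K N by fact
  interpret L: nonassoc_algebra K L by fact
  have 1: "has_rank K (L aQuot I) i \<longleftrightarrow> card (carrier L) = card (carrier K) ^ i * card I"
    if I: "alg_ideal K L I" for I
  proof -
    have sub: "submodule I K L" using I by (simp add: alg_ideal_def)
    then have I': "I \<subseteq> carrier L" "\<zero>\<^bsub>L\<^esub> \<in> I" by (simp_all add: submodule_iff[OF L.abelian_group_axioms])
    note epi = alg_quot_epi[OF L(2) I]
    have k: "{a \<in> carrier L. I +>\<^bsub>L\<^esub> a = \<zero>\<^bsub>L aQuot I\<^esub>} = I"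
      using alg_quot_zero_iff[OF L.abelian_group_axioms sub] I' by auto
    have c: "card (carrier L) = card I * card (carrier (L aQuot I))"
      using card_image_submodule[OF L.abelian_group_axioms epi submodule_carrier[OF L(2)] _ L(3)]
      by (simp add: k I' alg_epiD(1)[OF epi])
    have "finite (carrier (L aQuot I))"
      unfolding alg_epiD(1)[OF epi, symmetric] using L(3) by (rule finite_imageI)
    then have "has_rank K (L aQuot I) i \<longleftrightarrow> card (carrier (L aQuot I)) = card (carrier K) ^ i"
      by (rule has_rank_iff_card[OF K(1) alg_epi_module[OF L(1) epi] _ K(2)])
    moreover have "finite I" using I'(1) L(3) by (rule finite_subset)
    then have "card I \<noteq> 0" using I'(2) by auto
    ultimately show ?thesis by (simp add: c)
  qed
  have "ideal_count K L i = card {I. alg_ideal K L I \<and> card (carrier L) = card (carrier K) ^ i * card I}"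
    unfolding ideal_count_def using 1 by (intro arg_cong[where f = card] Collect_cong conj_cong refl)
  also have "\<dots> = card {I. alg_ideal K N I \<and> {a \<in> carrier N. g a = \<zero>\<^bsub>L\<^esub>} \<subseteq> I
      \<and> card (carrier N) = card (carrier K) ^ i * card I}"
    by (rule card_ideals_epi[OF N(2) g N(3)])
  also have "\<dots> = card {I. alg_ideal K N I \<and> card (carrier N) = card (carrier K) ^ i * card I}"
    using ker by (intro arg_cong[where f = card] Collect_cong)
      (auto simp: alg_ideal_def submodule_iff[OF N.abelian_group_axioms])
  finally show ?thesis .
qed

lemma has_rank_int_free_Abelian_group:
  fixes M :: "(int, 'a, 'm) module_scheme"
  assumes M: "module \<Z> M" and r: "has_rank \<Z> M n"
  obtains B :: "'a set" where "finite B" "card B = n" "free_Abelian_group B \<cong> add_monoid M"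
proof -
  interpret M: module \<Z> M by fact
  obtain B where B: "B \<subseteq> carrier M" "finite B" "card B = n"
    and bij: "bij_betw (lincomb M B) (B \<rightarrow>\<^sub>E UNIV) (carrier M)"
    using r unfolding has_rank_iff_bij[OF M] by auto
  note props = M.lincomb_props[OF B(2,1)]
  define h where "h f = lincomb M B (restrict (Poly_Mapping.lookup f) B)" for f
  have "h \<in> iso (free_Abelian_group B) (add_monoid M)"
    unfolding iso_def
  proof (intro CollectI conjI homI)
    fix f g assume "f \<in> carrier (free_Abelian_group B)" "g \<in> carrier (free_Abelian_group B)"
    show "h f \<in> carrier (add_monoid M)"
      unfolding h_def using bij by (auto simp: bij_betw_def)
    have "h (f + g) = lincomb M B (\<lambda>b\<in>B. restrict (Poly_Mapping.lookup f) B b \<oplus>\<^bsub>\<Z>\<^esub> restrict (Poly_Mapping.lookup g) B b)"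
      unfolding h_def by (rule arg_cong[where f = "lincomb M B"]) (auto simp: lookup_add)
    also have "\<dots> = h f \<oplus>\<^bsub>M\<^esub> h g"
      unfolding h_def
      using props(2)[of "restrict (Poly_Mapping.lookup f) B" "restrict (Poly_Mapping.lookup g) B"] by simp
    finally show "h (f \<otimes>\<^bsub>free_Abelian_group B\<^esub> g) = h f \<otimes>\<^bsub>add_monoid M\<^esub> h g" by simp
  next
    have "bij_betw (\<lambda>f. restrict (Poly_Mapping.lookup f) B) {f. Poly_Mapping.keys f \<subseteq> B} (B \<rightarrow>\<^sub>E (UNIV :: int set))"
      unfolding bij_betw_def
    proof
      show "inj_on (\<lambda>f. restrict (Poly_Mapping.lookup f) B) {f :: 'a \<Rightarrow>\<^sub>0 int. Poly_Mapping.keys f \<subseteq> B}"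
      proof (rule inj_onI)
        fix f g :: "'a \<Rightarrow>\<^sub>0 int"
        assume k: "f \<in> {f. Poly_Mapping.keys f \<subseteq> B}" "g \<in> {f. Poly_Mapping.keys f \<subseteq> B}"
          and eq: "restrict (Poly_Mapping.lookup f) B = restrict (Poly_Mapping.lookup g) B"
        show "f = g"
        proof (rule poly_mapping_eqI)
          fix b show "Poly_Mapping.lookup f b = Poly_Mapping.lookup g b"
          proof (cases "b \<in> B")
            case False
            then have "b \<notin> Poly_Mapping.keys f" "b \<notin> Poly_Mapping.keys g" using k by auto
            then show ?thesis by (simp add: in_keys_iff)
          qed (use fun_cong[OF eq, of b] in auto)
        qed
      qed
      show "(\<lambda>f. restrict (Poly_Mapping.lookup f) B) ` {f. Poly_Mapping.keys f \<subseteq> B} = B \<rightarrow>\<^sub>E (UNIV :: int set)"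
      proof (intro equalityI subsetI)
        fix c :: "'a \<Rightarrow> int" assume c: "c \<in> B \<rightarrow>\<^sub>E UNIV"
        define f where "f = (\<Sum>b\<in>B. frag_cmul (c b) (frag_of b))"
        have l: "Poly_Mapping.lookup f b = (if b \<in> B then c b else 0)" for b
          using B(2) by (simp add: f_def lookup_sum lookup_single when_def sum.delta if_distrib cong: if_cong)
        have "Poly_Mapping.keys f \<subseteq> B" by (auto simp: in_keys_iff l split: if_splits)
        moreover have "c = restrict (Poly_Mapping.lookup f) B"
          using c by (auto simp: l PiE_def extensional_def)
        ultimately show "c \<in> (\<lambda>f. restrict (Poly_Mapping.lookup f) B) ` {f. Poly_Mapping.keys f \<subseteq> B}"
          by blast
      qed auto
    qed
    from bij_betw_trans[OF this bij]
    show "bij_betw h (carrier (free_Abelian_group B)) (carrier (add_monoid M))"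
      by (simp add: h_def[abs_def] comp_def free_Abelian_group_def)
  qed
  then show ?thesis by (intro that[OF B(2,3)] is_isoI)
qed

lemma module_rank_int:
  fixes M :: "(int, 'a, 'm) module_scheme"
  assumes M: "module \<Z> M" and r: "has_rank \<Z> M n"
  shows "module_rank \<Z> M = n"
  unfolding module_rank_def
proof (rule the_equality)
  fix m assume m: "has_rank \<Z> M m"
  obtain B :: "'a set" where B: "finite B" "card B = n" "free_Abelian_group B \<cong> add_monoid M"
    by (rule has_rank_int_free_Abelian_group[OF M r])
  obtain C :: "'a set" where C: "finite C" "card C = m" "free_Abelian_group C \<cong> add_monoid M"
    by (rule has_rank_int_free_Abelian_group[OF M m])
  have "free_Abelian_group B \<cong> free_Abelian_group C"
    using B(3) group.iso_sym[OF group_free_Abelian_group C(3)] by (rule iso_trans)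
  then have "B \<approx> C" by (simp add: isomorphic_free_Abelian_groups)
  then show "m = n" using B C by (simp add: eqpoll_iff_card)
qed (fact r)

lemma has_rank_iso:
  assumes M: "module R M" and f: "alg_epi R M N f" and r: "has_rank R M n"
    and ker: "\<And>x. \<lbrakk>x \<in> carrier M; f x = \<zero>\<^bsub>N\<^esub>\<rbrakk> \<Longrightarrow> x = \<zero>\<^bsub>M\<^esub>"
  shows "has_rank R N n"
proof -
  interpret M: module R M by fact
  have N: "module R N" by (rule alg_epi_module[OF M f])
  interpret N: module R N by fact
  note f' = alg_epiD[OF f]
  have inj: "inj_on f (carrier M)"
    using alg_epi_inj[OF M.abelian_group_axioms f] ker by blast
  obtain B where B: "B \<subseteq> carrier M" "finite B" "card B = n"
    and bij: "bij_betw (lincomb M B) (B \<rightarrow>\<^sub>E carrier R) (carrier M)"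
    using r unfolding has_rank_iff_bij[OF M] by auto
  have injB: "inj_on f B" using inj B(1) by (rule inj_on_subset)
  have fsum: "f (\<Oplus>\<^bsub>M\<^esub>b\<in>C. h b) = (\<Oplus>\<^bsub>N\<^esub>b\<in>C. f (h b))" if "finite C" "h \<in> C \<rightarrow> carrier M" for C h
    using that by (induction C) (auto simp: f' Pi_def)
  have eq: "lincomb N (f ` B) d = f (lincomb M B (restrict (d \<circ> f) B))" if d: "d \<in> f ` B \<rightarrow>\<^sub>E carrier R" for d
  proof -
    have B': "b \<in> carrier M" "d (f b) \<in> carrier R" if "b \<in> B" for b using that B(1) d by auto
    have "lincomb N (f ` B) d = (\<Oplus>\<^bsub>N\<^esub>b\<in>B. d (f b) \<odot>\<^bsub>N\<^esub> f b)"
      unfolding lincomb_def using B' injB f'(3) by (subst N.add.finprod_reindex) auto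
    also have "\<dots> = (\<Oplus>\<^bsub>N\<^esub>b\<in>B. f (restrict (d \<circ> f) B b \<odot>\<^bsub>M\<^esub> b))"
      using B' f'(3,6) M.smult_closed by (intro N.finsum_cong') auto
    also have "\<dots> = f (lincomb M B (restrict (d \<circ> f) B))"
      unfolding lincomb_def using B(2) B' by (subst fsum) auto
    finally show ?thesis .
  qed
  have "bij_betw (\<lambda>d. restrict (d \<circ> f) B) (f ` B \<rightarrow>\<^sub>E carrier R) (B \<rightarrow>\<^sub>E carrier R)"
  proof (rule bij_betwI[where g = "\<lambda>c. restrict (c \<circ> inv_into B f) (f ` B)"])
    show "(\<lambda>d. restrict (d \<circ> f) B) \<in> (f ` B \<rightarrow>\<^sub>E carrier R) \<rightarrow> B \<rightarrow>\<^sub>E carrier R" by auto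
    show "(\<lambda>c. restrict (c \<circ> inv_into B f) (f ` B)) \<in> (B \<rightarrow>\<^sub>E carrier R) \<rightarrow> f ` B \<rightarrow>\<^sub>E carrier R"
      using injB by auto
    show "restrict (restrict (d \<circ> f) B \<circ> inv_into B f) (f ` B) = d" if "d \<in> f ` B \<rightarrow>\<^sub>E carrier R" for d
      using that injB by (auto simp: fun_eq_iff PiE_def extensional_def)
    show "restrict (restrict (c \<circ> inv_into B f) (f ` B) \<circ> f) B = c" if "c \<in> B \<rightarrow>\<^sub>E carrier R" for c
      using that injB by (auto simp: fun_eq_iff PiE_def extensional_def)
  qed
  from bij_betw_trans[OF bij_betw_trans[OF this bij] bij_betw_imageI[OF inj f'(1)]]
  have "bij_betw (lincomb N (f ` B)) (f ` B \<rightarrow>\<^sub>E carrier R) (carrier N)"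
    by (rule bij_betw_cong[THEN iffD1, rotated]) (simp add: eq)
  then show ?thesis
    using B f'(3) injB by (auto simp: has_rank_iff_bij[OF N] card_image intro!: exI[of _ "f ` B"])
qed

subsection \<open>Structure constants\<close>

definition red :: "int \<Rightarrow> nat \<Rightarrow> (nat \<Rightarrow> int) \<Rightarrow> nat \<Rightarrow> int" where
  "red m n f = (\<lambda>i. if i < n then f i mod m else 0)"

text \<open>Coordinates of class-4 elements refer to the basis \<open>x\<close>, \<open>y\<close>, \<open>z = [x, y]\<close>, \<open>u = [z, x]\<close>,
  \<open>v = [z, y]\<close>, \<open>[u, x]\<close>, \<open>[u, y] = [v, x]\<close>, \<open>[v, y]\<close>, numbered from \<open>0\<close>; the equality of the two
  brackets of weight 4 is the Jacobi identity for \<open>z\<close>, \<open>x\<close>, \<open>y\<close>.\<close>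

definition br :: "(nat \<Rightarrow> int) \<Rightarrow> (nat \<Rightarrow> int) \<Rightarrow> nat \<Rightarrow> int" where
  "br f g k =
    (if k = 2 then f 0 * g 1 - f 1 * g 0
     else if k = 3 then f 2 * g 0 - f 0 * g 2
     else if k = 4 then f 2 * g 1 - f 1 * g 2
     else if k = 5 then f 3 * g 0 - f 0 * g 3
     else if k = 6 then f 3 * g 1 - f 1 * g 3 + f 4 * g 0 - f 0 * g 4
     else if k = 7 then f 4 * g 1 - f 1 * g 4
     else 0)"

text \<open>Modulus \<open>m = 0\<close> gives the Lie ring over \<open>\<int>\<close> (as \<open>a mod 0 = a\<close>), a prime \<open>m\<close> the Lie algebra over
  \<open>F\<^sub>m\<close>; truncation to \<open>n = 3, 5, 8\<close> coordinates gives class 2, 3, 4.\<close>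

definition nilp :: "int \<Rightarrow> nat \<Rightarrow> (int, nat \<Rightarrow> int) module" where
  "nilp m n = \<lparr>carrier = {f. red m n f = f}, mult = (\<lambda>f g. red m n (br f g)),
     one = (\<lambda>_. 0), ring.zero = (\<lambda>_. 0), add = (\<lambda>f g. red m n (\<lambda>i. f i + g i)),
     smult = (\<lambda>r f. red m n (\<lambda>i. r * f i))\<rparr>"

definition unit_vec :: "nat \<Rightarrow> nat \<Rightarrow> int" where
  "unit_vec k = (\<lambda>i. if i = k then 1 else 0)"

lemma nilp_simps [simp]:
  "f \<in> carrier (nilp m n) \<longleftrightarrow> red m n f = f"
  "f \<otimes>\<^bsub>nilp m n\<^esub> g = red m n (br f g)"
  "\<zero>\<^bsub>nilp m n\<^esub> = (\<lambda>_. 0)"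
  "f \<oplus>\<^bsub>nilp m n\<^esub> g = red m n (\<lambda>i. f i + g i)"
  "r \<odot>\<^bsub>nilp m n\<^esub> f = red m n (\<lambda>i. r * f i)"
  by (simp_all add: nilp_def)

lemma red_simps [simp]:
  "red m n (red m n f) = red m n f"
  "red m n (\<lambda>i. red m n f i + g i) = red m n (\<lambda>i. f i + g i)"
  "red m n (\<lambda>i. f i + red m n g i) = red m n (\<lambda>i. f i + g i)"
  "red m n (\<lambda>i. r * red m n f i) = red m n (\<lambda>i. r * f i)"
  "red m n (\<lambda>_. 0) = (\<lambda>_. 0)"
  by (auto simp: red_def fun_eq_iff mod_simps)

lemma red_eqI: "(\<And>i. i < n \<Longrightarrow> f i mod m = g i mod m) \<Longrightarrow> red m n f = red m n g"
  by (auto simp: red_def fun_eq_iff)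

lemma br_cong_mod:
  assumes "\<And>i. i < k \<Longrightarrow> f i mod m = f' i mod m" "\<And>i. i < k \<Longrightarrow> g i mod m = g' i mod m"
  shows "br f g k mod m = br f' g' k mod m"
proof -
  have *: "(f i * g j) mod m = (f' i * g' j) mod m" if "i < k" "j < k" for i j
    using assms that by (intro mod_mult_cong) auto
  show ?thesis
    unfolding br_def by (auto intro!: * mod_diff_cong mod_add_cong)
qed

lemma red_br [simp]:
  "red m n (br (red m n f) g) = red m n (br f g)"
  "red m n (br f (red m n g)) = red m n (br f g)"
  by (rule red_eqI, rule br_cong_mod; simp add: red_def)+

lemma br_add:
  "br (\<lambda>i. f i + g i) h = (\<lambda>i. br f h i + br g h i)"
  "br h (\<lambda>i. f i + g i) = (\<lambda>i. br h f i + br h g i)"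
  by (auto simp: br_def fun_eq_iff algebra_simps)

lemma br_scale:
  "br (\<lambda>i. r * f i) h = (\<lambda>i. r * br f h i)"
  "br h (\<lambda>i. r * f i) = (\<lambda>i. r * br h f i)"
  by (auto simp: br_def fun_eq_iff algebra_simps)

lemma br_self [simp]: "br f f = (\<lambda>_. 0)"
  by (auto simp: br_def fun_eq_iff)

lemma br_jacobi: "br f (br g h) i + br g (br h f) i + br h (br f g) i = 0"
  by (simp add: br_def algebra_simps)

lemma nonassoc_algebra_nilp: "nonassoc_algebra R (nilp m n)"
proof -
  have "abelian_group (nilp m n)"
  proof (rule abelian_groupI)
    show "\<exists>y\<in>carrier (nilp m n). y \<oplus>\<^bsub>nilp m n\<^esub> x = \<zero>\<^bsub>nilp m n\<^esub>" if "x \<in> carrier (nilp m n)" for x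
      by (rule bexI[of _ "red m n (\<lambda>i. - x i)"]) auto
  qed (auto simp: ac_simps)
  then interpret abelian_group "nilp m n" .
  show ?thesis
    by unfold_locales (auto simp: br_add distrib_left)
qed

lemma module_nilp:
  assumes "cring R"
    and "\<And>r s. \<lbrakk>r \<in> carrier R; s \<in> carrier R\<rbrakk> \<Longrightarrow> (r \<oplus>\<^bsub>R\<^esub> s) mod m = (r + s) mod m"
    and "\<And>r s. \<lbrakk>r \<in> carrier R; s \<in> carrier R\<rbrakk> \<Longrightarrow> (r \<otimes>\<^bsub>R\<^esub> s) mod m = (r * s) mod m"
    and "\<one>\<^bsub>R\<^esub> mod m = 1 mod m"
  shows "module R (nilp m n)"
proof -
  interpret nonassoc_algebra R "nilp m n" by (rule nonassoc_algebra_nilp)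
  have scale_cong: "red m n (\<lambda>i. r * f i) = red m n (\<lambda>i. s * f i)" if "r mod m = s mod m" for r s f
    using that by (intro red_eqI mod_mult_cong) auto
  show ?thesis
  proof (rule moduleI)
    show "cring R" by fact
    show "abelian_group (nilp m n)" by unfold_locales
  next
    fix r s f assume "r \<in> carrier R" "s \<in> carrier R" "f \<in> carrier (nilp m n)"
    then show "(r \<oplus>\<^bsub>R\<^esub> s) \<odot>\<^bsub>nilp m n\<^esub> f = (r \<odot>\<^bsub>nilp m n\<^esub> f) \<oplus>\<^bsub>nilp m n\<^esub> (s \<odot>\<^bsub>nilp m n\<^esub> f)"
      "(r \<otimes>\<^bsub>R\<^esub> s) \<odot>\<^bsub>nilp m n\<^esub> f = r \<odot>\<^bsub>nilp m n\<^esub> (s \<odot>\<^bsub>nilp m n\<^esub> f)"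
      using scale_cong[OF assms(2)] scale_cong[OF assms(3)] by (auto simp: distrib_right mult.assoc)
  next
    fix f assume "f \<in> carrier (nilp m n)"
    then show "\<one>\<^bsub>R\<^esub> \<odot>\<^bsub>nilp m n\<^esub> f = f" using scale_cong[OF assms(4)] by auto
  qed (auto simp: distrib_left)
qed

lemma module_int_nilp: "module \<Z> (nilp 0 n)"
  by (rule module_nilp) (auto simp: int.is_cring)

lemma (in residues) module_residue_nilp: "module R (nilp m n)"
  by (rule module_nilp[OF cring]) (simp_all add: res_add_eq res_mult_eq res_one_eq)

lemma nilp_lincomb:
  assumes "finite I" "I \<subseteq> {..<n}"
  shows "lincomb (nilp 0 n) (unit_vec ` I) c = (\<lambda>j. if j \<in> I then c (unit_vec j) else 0)"
  using assms
proof (induction I)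
  case empty
  interpret module \<Z> "nilp 0 n" by (rule module_int_nilp)
  show ?case by (simp add: lincomb_def)
next
  case (insert k I)
  interpret module \<Z> "nilp 0 n" by (rule module_int_nilp)
  have inj: "unit_vec i = unit_vec j \<longleftrightarrow> i = j" for i j by (auto simp: unit_vec_def fun_eq_iff)
  have "lincomb (nilp 0 n) (unit_vec ` insert k I) c =
      c (unit_vec k) \<odot>\<^bsub>nilp 0 n\<^esub> unit_vec k \<oplus>\<^bsub>nilp 0 n\<^esub> lincomb (nilp 0 n) (unit_vec ` I) c"
    unfolding lincomb_def image_insert using insert.hyps insert.prems
    by (subst finsum_insert) (auto simp: inj Pi_def)
  then show ?case
    using insert by (auto simp: fun_eq_iff red_def unit_vec_def)
qed

lemma has_rank_nilp: "has_rank \<Z> (nilp 0 n) n"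
  unfolding has_rank_iff_bij[OF module_int_nilp]
proof (intro exI conjI)
  let ?B = "unit_vec ` {..<n}"
  have inj: "inj unit_vec" by (auto simp: inj_def unit_vec_def fun_eq_iff)
  show "?B \<subseteq> carrier (nilp 0 n)" by (auto simp: red_def unit_vec_def fun_eq_iff)
  show "finite ?B" by simp
  show "card ?B = n" using card_image[OF inj_on_subset[OF inj subset_UNIV]] by simp
  show "bij_betw (lincomb (nilp 0 n) ?B) (?B \<rightarrow>\<^sub>E carrier \<Z>) (carrier (nilp 0 n))"
    unfolding nilp_lincomb[OF finite_lessThan subset_refl, abs_def]
  proof (rule bij_betwI[where g = "\<lambda>f. \<lambda>b\<in>?B. f (inv_into UNIV unit_vec b)"])
    show "(\<lambda>b\<in>?B. (\<lambda>j. if j \<in> {..<n} then c (unit_vec j) else 0) (inv_into UNIV unit_vec b)) = c"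
      if "c \<in> ?B \<rightarrow>\<^sub>E carrier \<Z>" for c
      using that inj by (auto simp: fun_eq_iff PiE_def extensional_def)
    show "(\<lambda>j. if j \<in> {..<n} then (\<lambda>b\<in>?B. f (inv_into UNIV unit_vec b)) (unit_vec j) else 0) = f"
      if "f \<in> carrier (nilp 0 n)" for f
    proof -
      have "f j = 0" if "\<not> j < n" for j
        using \<open>f \<in> carrier (nilp 0 n)\<close> that by (auto simp: red_def dest: fun_cong[of _ f j])
      then show ?thesis using inj by (auto simp: fun_eq_iff)
    qed
  qed (use inj in \<open>auto simp: red_def fun_eq_iff\<close>)
qed

lemma card_supported_functions:
  assumes "finite J"
  shows "card {f :: 'a \<Rightarrow> int. (\<forall>i\<in>J. f i \<in> A) \<and> (\<forall>i. i \<notin> J \<longrightarrow> f i = 0)} = card A ^ card J"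
proof -
  have "bij_betw (\<lambda>f. restrict f J) {f :: 'a \<Rightarrow> int. (\<forall>i\<in>J. f i \<in> A) \<and> (\<forall>i. i \<notin> J \<longrightarrow> f i = 0)} (J \<rightarrow>\<^sub>E A)"
    by (rule bij_betwI[where g = "\<lambda>f i. if i \<in> J then f i else 0"])
      (auto simp: fun_eq_iff PiE_def extensional_def)
  from bij_betw_same_card[OF this] show ?thesis using assms by (simp add: card_PiE)
qed

lemma nilp_carrier_iff:
  assumes "m > 0"
  shows "f \<in> carrier (nilp m n) \<longleftrightarrow> (\<forall>i<n. 0 \<le> f i \<and> f i < m) \<and> (\<forall>i\<ge>n. f i = 0)"
proof
  assume "f \<in> carrier (nilp m n)"
  then have f: "f i = (if i < n then f i mod m else 0)" for i
    by (simp add: red_def fun_eq_iff)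
  have "0 \<le> f i \<and> f i < m" if "i < n" for i
  proof -
    have "f i = f i mod m" using f[of i] that by simp
    then show ?thesis using pos_mod_sign[OF assms, of "f i"] pos_mod_bound[OF assms, of "f i"] by simp
  qed
  moreover have "f i = 0" if "i \<ge> n" for i using f[of i] that by simp
  ultimately show "(\<forall>i<n. 0 \<le> f i \<and> f i < m) \<and> (\<forall>i\<ge>n. f i = 0)" by blast
qed (auto simp: red_def fun_eq_iff)

lemma card_nilp_tail:
  assumes "m > 0"
  shows "card {f \<in> carrier (nilp m n). \<forall>i<k. f i = 0} = nat m ^ (n - k)"
proof -
  have "{f \<in> carrier (nilp m n). \<forall>i<k. f i = 0} =
      {f. (\<forall>i\<in>{k..<n}. f i \<in> {0..<m}) \<and> (\<forall>i. i \<notin> {k..<n} \<longrightarrow> f i = 0)}"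
    using assms by (auto simp: nilp_carrier_iff[OF assms] simp del: nilp_simps)
  then show ?thesis
    using card_supported_functions[of "{k..<n}" "{0..<m}"] by simp
qed

lemma card_nilp: "m > 0 \<Longrightarrow> card (carrier (nilp m n)) = nat m ^ n"
  using card_nilp_tail[of m n 0] by (simp del: nilp_simps)

lemma finite_nilp: "m > 0 \<Longrightarrow> finite (carrier (nilp m n))"
  using card_nilp[of m n] by (auto intro: card_ge_0_finite)

subsection \<open>The free nonassociative ring\<close>

definition lin_extend :: "('w \<Rightarrow> nat \<Rightarrow> int) \<Rightarrow> ('w \<Rightarrow>\<^sub>0 int) \<Rightarrow> nat \<Rightarrow> int" where
  "lin_extend h f i = (\<Sum>w\<in>Poly_Mapping.keys f. Poly_Mapping.lookup f w * h w i)"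

lemma lin_extend_superset:
  "finite S \<Longrightarrow> Poly_Mapping.keys f \<subseteq> S \<Longrightarrow>
    lin_extend h f i = (\<Sum>w\<in>S. Poly_Mapping.lookup f w * h w i)"
  unfolding lin_extend_def by (rule sum.mono_neutral_left) (auto simp: in_keys_iff)

lemma lin_extend_0 [simp]: "lin_extend h 0 = (\<lambda>_. 0)"
  by (simp add: lin_extend_def fun_eq_iff)

lemma lin_extend_frag_of [simp]: "lin_extend h (frag_of w) = h w"
  by (simp add: lin_extend_def fun_eq_iff keys_frag_of)

lemma lin_extend_add: "lin_extend h (f + g) = (\<lambda>i. lin_extend h f i + lin_extend h g i)"
proof
  fix i
  let ?S = "Poly_Mapping.keys f \<union> Poly_Mapping.keys g"
  have "lin_extend h (f + g) i = (\<Sum>w\<in>?S. Poly_Mapping.lookup (f + g) w * h w i)"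
    by (rule lin_extend_superset) (simp_all add: keys_add)
  also have "\<dots> = lin_extend h f i + lin_extend h g i"
    by (simp add: lin_extend_superset[of ?S] lookup_add distrib_right sum.distrib)
  finally show "lin_extend h (f + g) i = lin_extend h f i + lin_extend h g i" .
qed

lemma lin_extend_cmul: "lin_extend h (frag_cmul k f) = (\<lambda>i. k * lin_extend h f i)"
proof
  fix i
  have "lin_extend h (frag_cmul k f) i = (\<Sum>w\<in>Poly_Mapping.keys f. Poly_Mapping.lookup (frag_cmul k f) w * h w i)"
    by (rule lin_extend_superset) auto
  then show "lin_extend h (frag_cmul k f) i = k * lin_extend h f i"
    by (simp add: lin_extend_def sum_distrib_left mult.assoc)
qed

lemma lin_extend_diff: "lin_extend h (f - g) = (\<lambda>i. lin_extend h f i - lin_extend h g i)"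
  using lin_extend_add[of h f "- g"] lin_extend_cmul[of h "-1" g] by simp

lemma lin_extend_sum: "lin_extend h (sum F S) = (\<lambda>i. \<Sum>s\<in>S. lin_extend h (F s) i)"
  by (induction S rule: infinite_finite_induct) (simp_all add: lin_extend_add)

lemma frag_extend_add_fun:
  "frag_extend (\<lambda>u. F u + G u) f = frag_extend F f + frag_extend G f"
  by (simp add: frag_extend_def frag_cmul_distrib2 sum.distrib)

lemma bilinear_extend_frag_of [simp]:
  "bilinear_extend h (frag_of u) (frag_of v) = frag_of (h u v)"
  by (simp add: bilinear_extend_def)

lemma bilinear_extend_0 [simp]: "bilinear_extend h 0 f = 0" "bilinear_extend h g 0 = 0"
  by (simp_all add: bilinear_extend_def frag_extend_eq_0)

lemma bilinear_extend_add:
  "bilinear_extend h (f + g) k = bilinear_extend h f k + bilinear_extend h g k"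
  "bilinear_extend h k' (f' + g') = bilinear_extend h k' f' + bilinear_extend h k' g'"
  by (simp_all add: bilinear_extend_def frag_extend_add frag_extend_add_fun)

lemma bilinear_extend_diff:
  "bilinear_extend h (f - g) k = bilinear_extend h f k - bilinear_extend h g k"
  "bilinear_extend h k' (f' - g') = bilinear_extend h k' f' - bilinear_extend h k' g'"
  using bilinear_extend_add(1)[of h "f - g" g k] bilinear_extend_add(2)[of h k' "f' - g'" g']
  by (simp_all add: algebra_simps)

lemma bilinear_extend_cmul: "bilinear_extend h (frag_cmul c f) k = frag_cmul c (bilinear_extend h f k)"
  by (simp add: bilinear_extend_def frag_extend_cmul)

lemma bilinear_extend_sum: "bilinear_extend h (sum F S) k = (\<Sum>s\<in>S. bilinear_extend h (F s) k)"
  by (induction S rule: infinite_finite_induct) (simp_all add: bilinear_extend_add)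

lemma keys_bilinear_extend:
  "Poly_Mapping.keys (bilinear_extend h f g) \<subseteq> (\<lambda>(u, v). h u v) ` (Poly_Mapping.keys f \<times> Poly_Mapping.keys g)"
proof -
  have "Poly_Mapping.keys (bilinear_extend h f g) \<subseteq>
      (\<Union>u\<in>Poly_Mapping.keys f. Poly_Mapping.keys (frag_extend (\<lambda>v. frag_of (h u v)) g))"
    unfolding bilinear_extend_def by (rule keys_frag_extend)
  also have "\<dots> \<subseteq> (\<Union>u\<in>Poly_Mapping.keys f. \<Union>v\<in>Poly_Mapping.keys g. {h u v})"
    by (intro UN_mono subset_refl order_trans[OF keys_frag_extend]) (simp add: keys_frag_of)
  finally show ?thesis by auto
qed

lemma lin_extend_bilinear_extend_mod:
  assumes B: "\<And>f g k. B (\<lambda>i. f i - g i) k = (\<lambda>i. B f k i - B g k i)"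
      "\<And>f g k. B k (\<lambda>i. f i - g i) = (\<lambda>i. B k f i - B k g i)"
      "\<And>k. B (\<lambda>_. 0) k = (\<lambda>_. 0)" "\<And>k. B k (\<lambda>_. 0) = (\<lambda>_. 0)"
    and f: "Poly_Mapping.keys f \<subseteq> S" and g: "Poly_Mapping.keys g \<subseteq> T"
    and h: "\<And>u v. \<lbrakk>u \<in> S; v \<in> T\<rbrakk> \<Longrightarrow> e' (h u v) i mod m = B (e u) (e v) i mod m"
  shows "lin_extend e' (bilinear_extend h f g) i mod m = B (lin_extend e f) (lin_extend e g) i mod m"
  using f
proof (induction f rule: frag_induction)
  case (one u)
  show ?case using g
  proof (induction g rule: frag_induction)
    case (diff a b)
    then show ?case unfolding bilinear_extend_diff lin_extend_diff B by (rule mod_diff_cong)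
  qed (use one in \<open>simp_all add: h B\<close>)
next
  case (diff a b)
  then show ?case unfolding bilinear_extend_diff lin_extend_diff B by (rule mod_diff_cong)
qed (simp add: B)

lemma free_nonassoc_ring_simps [simp]:
  "f \<in> carrier (free_nonassoc_ring X) \<longleftrightarrow> (\<forall>w\<in>Poly_Mapping.keys f. letters w \<subseteq> X)"
  "f \<otimes>\<^bsub>free_nonassoc_ring X\<^esub> g = bilinear_extend Join f g"
  "\<zero>\<^bsub>free_nonassoc_ring X\<^esub> = 0"
  "f \<oplus>\<^bsub>free_nonassoc_ring X\<^esub> g = f + g"
  "r \<odot>\<^bsub>free_nonassoc_ring X\<^esub> f = frag_cmul r f"
  by (simp_all add: free_nonassoc_ring_def)

lemma nonassoc_algebra_free_nonassoc_ring: "nonassoc_algebra \<Z> (free_nonassoc_ring X)"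
proof -
  have "abelian_group (free_nonassoc_ring X)"
  proof (rule abelian_groupI)
    show "\<exists>y\<in>carrier (free_nonassoc_ring X). y \<oplus>\<^bsub>free_nonassoc_ring X\<^esub> f = \<zero>\<^bsub>free_nonassoc_ring X\<^esub>"
      if "f \<in> carrier (free_nonassoc_ring X)" for f
      using that by (intro bexI[of _ "- f"]) auto
  qed (auto simp: ac_simps dest!: keys_add[THEN subsetD])
  then interpret abelian_group "free_nonassoc_ring X" .
  show ?thesis
  proof
    fix f g assume "f \<in> carrier (free_nonassoc_ring X)" "g \<in> carrier (free_nonassoc_ring X)"
    then show "f \<otimes>\<^bsub>free_nonassoc_ring X\<^esub> g \<in> carrier (free_nonassoc_ring X)"
      by (fastforce dest!: keys_bilinear_extend[THEN subsetD])
  qed (auto simp: bilinear_extend_add frag_cmul_distrib2 dest!: keys_cmul[THEN subsetD])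
qed

lemma free_nonassoc_ring_minus [simp]:
  assumes "f \<in> carrier (free_nonassoc_ring X)"
  shows "\<ominus>\<^bsub>free_nonassoc_ring X\<^esub> f = - f"
proof -
  interpret nonassoc_algebra \<Z> "free_nonassoc_ring X" by (rule nonassoc_algebra_free_nonassoc_ring)
  show ?thesis using assms by (intro minus_equality) auto
qed

primrec ev_word :: "nat free_magma \<Rightarrow> nat \<Rightarrow> int" where
  "ev_word (Letter i) = unit_vec i"
| "ev_word (Join u v) = br (ev_word u) (ev_word v)"

definition basis_word :: "nat \<Rightarrow> nat free_magma" where
  "basis_word i =
    (let x = Letter 0; y = Letter 1; z = Join x y; u = Join z x; v = Join z y
     in [x, y, z, u, v, Join u x, Join u y, Join v y] ! i)"

lemma less_8_cases: "(i :: nat) < 8 \<longleftrightarrow> i \<in> {0, 1, 2, 3, 4, 5, 6, 7}"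
  by auto

lemma basis_word_simps:
  "basis_word 0 = Letter 0" "basis_word (Suc 0) = Letter 1"
  "basis_word 2 = Join (basis_word 0) (basis_word 1)"
  "basis_word 3 = Join (basis_word 2) (basis_word 0)"
  "basis_word 4 = Join (basis_word 2) (basis_word 1)"
  "basis_word 5 = Join (basis_word 3) (basis_word 0)"
  "basis_word 6 = Join (basis_word 3) (basis_word 1)"
  "basis_word 7 = Join (basis_word 4) (basis_word 1)"
  by (simp_all add: basis_word_def Let_def)

lemma ev_basis_word:
  assumes "i < 8"
  shows "ev_word (basis_word i) = unit_vec i"
proof -
  have e: "ev_word (basis_word 0) = unit_vec 0" "ev_word (basis_word (Suc 0)) = unit_vec 1"
    by (simp_all add: basis_word_simps)
  have e2: "ev_word (basis_word 2) = unit_vec 2"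
    unfolding basis_word_simps(3) by (auto simp: e fun_eq_iff br_def unit_vec_def)
  have e34: "ev_word (basis_word 3) = unit_vec 3" "ev_word (basis_word 4) = unit_vec 4"
    unfolding basis_word_simps(4,5) by (auto simp: e e2 fun_eq_iff br_def unit_vec_def)
  have "ev_word (basis_word 5) = unit_vec 5" "ev_word (basis_word 6) = unit_vec 6"
    "ev_word (basis_word 7) = unit_vec 7"
    unfolding basis_word_simps(6-8) by (auto simp: e e34 fun_eq_iff br_def unit_vec_def)
  with e e2 e34 show ?thesis using assms unfolding less_8_cases by auto
qed

lemma letters_basis_word: "i < 8 \<Longrightarrow> letters (basis_word i) \<subseteq> {..<2}"
  unfolding less_8_cases by (auto simp: basis_word_simps)

abbreviation "ev \<equiv> lin_extend ev_word"

lemma br_diff: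
  "br (\<lambda>i. f i - g i) h = (\<lambda>i. br f h i - br g h i)"
  "br h (\<lambda>i. f i - g i) = (\<lambda>i. br h f i - br h g i)"
  by (auto simp: br_def fun_eq_iff algebra_simps)

lemma ev_mult: "ev (bilinear_extend Join f g) = br (ev f) (ev g)"
proof
  fix i
  have "ev (bilinear_extend Join f g) i mod 0 = br (ev f) (ev g) i mod 0"
    by (rule lin_extend_bilinear_extend_mod[where S = UNIV and T = UNIV])
      (auto simp: br_diff, auto simp: br_def)
  then show "ev (bilinear_extend Join f g) i = br (ev f) (ev g) i" by simp
qed

lemma alg_epi_ev:
  assumes "n \<le> 8"
  shows "alg_epi \<Z> (free_nonassoc_ring {..<2}) (nilp 0 n) (\<lambda>f. red 0 n (ev f))"
  unfolding alg_epi_def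
proof (intro conjI ballI)
  show "(\<lambda>f. red 0 n (ev f)) ` carrier (free_nonassoc_ring {..<2}) = carrier (nilp 0 n)"
  proof (intro equalityI subsetI)
    fix c assume c: "c \<in> carrier (nilp 0 n)"
    define f where "f = (\<Sum>i<n. frag_cmul (c i) (frag_of (basis_word i)))"
    have "Poly_Mapping.keys f \<subseteq> (\<Union>i<n. Poly_Mapping.keys (frag_cmul (c i) (frag_of (basis_word i))))"
      unfolding f_def by (rule keys_sum)
    then have "\<exists>i<n. w = basis_word i" if "w \<in> Poly_Mapping.keys f" for w
      by (rule subsetD[THEN UN_E, OF _ that]) (auto simp: keys_frag_of)
    then have "letters w \<subseteq> {..<2}" if "w \<in> Poly_Mapping.keys f" for w
      using that assms letters_basis_word by (metis order_less_le_trans)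
    then have f: "f \<in> carrier (free_nonassoc_ring {..<2})"
      unfolding free_nonassoc_ring_simps by blast
    have "ev f = (\<lambda>j. \<Sum>i<n. c i * unit_vec i j)"
      unfolding f_def using assms by (auto simp: lin_extend_sum lin_extend_cmul ev_basis_word fun_eq_iff)
    also have "\<dots> = (\<lambda>j. if j < n then c j else 0)"
      by (auto simp: unit_vec_def fun_eq_iff if_distrib cong: if_cong)
    finally have "red 0 n (ev f) = red 0 n c" by (simp add: red_def fun_eq_iff)
    with c f show "c \<in> (\<lambda>f. red 0 n (ev f)) ` carrier (free_nonassoc_ring {..<2})"
      by (intro image_eqI[of _ _ f]) auto
  qed auto
qed (simp_all add: lin_extend_add lin_extend_cmul ev_mult)

lemma lower_central_submodule:
  assumes F: "nonassoc_algebra R F"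
  shows "submodule (lower_central R F k) R F"
proof (induction k rule: induct_nat_012)
  case (ge2 k)
  interpret nonassoc_algebra R F by fact
  have "lower_central R F (Suc k) \<subseteq> carrier F"
    using ge2(2) by (simp add: submodule_iff[OF abelian_group_axioms])
  then show ?case
    using mult_closed by (auto intro!: submodule_submodule_gen(1)[OF F])
qed (use F in \<open>auto intro: submodule_carrier\<close>)

lemma lower_central_mult:
  assumes F: "nonassoc_algebra R F" and "x \<in> lower_central R F (Suc k)" "y \<in> carrier F"
  shows "x \<otimes>\<^bsub>F\<^esub> y \<in> lower_central R F (Suc (Suc k))"
proof -
  have "x \<otimes>\<^bsub>F\<^esub> y \<in> {x \<otimes>\<^bsub>F\<^esub> y |x y. x \<in> lower_central R F (Suc k) \<and> y \<in> carrier F}"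
    using assms by blast
  then show ?thesis by (auto simp: submodule_gen_def)
qed

lemma lower_central_antimono:
  assumes F: "nonassoc_algebra R F"
  shows "lower_central R F (Suc (Suc k)) \<subseteq> lower_central R F (Suc k)"
proof (induction k)
  case 0
  interpret nonassoc_algebra R F by fact
  show ?case
    using lower_central_submodule[OF F, of "Suc (Suc 0)"]
    by (simp add: submodule_iff[OF abelian_group_axioms])
next
  case (Suc k)
  show ?case
    unfolding lower_central.simps(3)[of R F "Suc k"] lower_central.simps(3)[of R F k]
    using Suc.IH by (intro submodule_gen_mono) auto
qed

lemma lower_central_ideal:
  assumes F: "nonassoc_algebra R F"
    and anti: "\<And>x y. \<lbrakk>x \<in> carrier F; y \<in> carrier F\<rbrakk> \<Longrightarrow> x \<otimes>\<^bsub>F\<^esub> y = \<ominus>\<^bsub>F\<^esub> (y \<otimes>\<^bsub>F\<^esub> x)"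
  shows "alg_ideal R F (lower_central R F (Suc k))"
proof -
  interpret nonassoc_algebra R F by fact
  note sub = lower_central_submodule[OF F, of "Suc k"]
  note sub' = sub[unfolded submodule_iff[OF abelian_group_axioms]]
  have "x \<otimes>\<^bsub>F\<^esub> y \<in> lower_central R F (Suc k) \<and> y \<otimes>\<^bsub>F\<^esub> x \<in> lower_central R F (Suc k)"
    if x: "x \<in> carrier F" and y: "y \<in> lower_central R F (Suc k)" for x y
  proof -
    have "y \<otimes>\<^bsub>F\<^esub> x \<in> lower_central R F (Suc k)"
      using lower_central_mult[OF F y x] lower_central_antimono[OF F] by blast
    moreover have "x \<otimes>\<^bsub>F\<^esub> y = \<ominus>\<^bsub>F\<^esub> (y \<otimes>\<^bsub>F\<^esub> x)" using x y sub' by (intro anti) auto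
    ultimately show ?thesis using sub' by auto
  qed
  then show ?thesis using sub unfolding alg_ideal_def by blast
qed

subsection \<open>The free Lie ring and its lower central series\<close>

definition lie_ideal :: "'x set \<Rightarrow> ('x free_magma \<Rightarrow>\<^sub>0 int) set" where
  "lie_ideal X = alg_ideal_gen \<Z> (free_nonassoc_ring X) (lie_relators (free_nonassoc_ring X))"

definition lie_class :: "'x set \<Rightarrow> ('x free_magma \<Rightarrow>\<^sub>0 int) \<Rightarrow> ('x free_magma \<Rightarrow>\<^sub>0 int) set" where
  "lie_class X f = lie_ideal X +>\<^bsub>free_nonassoc_ring X\<^esub> f"

abbreviation mul :: "('x free_magma \<Rightarrow>\<^sub>0 int) \<Rightarrow> ('x free_magma \<Rightarrow>\<^sub>0 int) \<Rightarrow> ('x free_magma \<Rightarrow>\<^sub>0 int)"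
    (infixl \<open>\<star>\<close> 70) where
  "f \<star> g \<equiv> bilinear_extend Join f g"

lemma submodule_freeD:
  assumes "submodule J \<Z> (free_nonassoc_ring X)"
  shows "J \<subseteq> carrier (free_nonassoc_ring X)" "0 \<in> J"
    "\<And>f g. \<lbrakk>f \<in> J; g \<in> J\<rbrakk> \<Longrightarrow> f + g \<in> J"
    "\<And>f g. \<lbrakk>f \<in> J; g \<in> J\<rbrakk> \<Longrightarrow> f - g \<in> J"
    "\<And>r f. f \<in> J \<Longrightarrow> frag_cmul r f \<in> J"
proof -
  interpret nonassoc_algebra \<Z> "free_nonassoc_ring X" by (rule nonassoc_algebra_free_nonassoc_ring)
  note J = assms(1)[unfolded submodule_iff[OF abelian_group_axioms]]
  show 1: "J \<subseteq> carrier (free_nonassoc_ring X)" "0 \<in> J" using J by auto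
  show add: "f + g \<in> J" if "f \<in> J" "g \<in> J" for f g
    using J that by auto
  have "- f \<in> J" if "f \<in> J" for f
    using J that 1 free_nonassoc_ring_minus[of f X] by (metis subsetD)
  then show "f - g \<in> J" if "f \<in> J" "g \<in> J" for f g
    using add[of f "- g"] that by simp
  show "frag_cmul r f \<in> J" if "f \<in> J" for r f
    using J that by auto
qed

lemma alg_ideal_freeD:
  assumes "alg_ideal \<Z> (free_nonassoc_ring X) J" "g \<in> J" "f \<in> carrier (free_nonassoc_ring X)"
  shows "f \<star> g \<in> J" "g \<star> f \<in> J"
  using assms unfolding alg_ideal_def by auto

lemma free_closed:
  assumes "f \<in> carrier (free_nonassoc_ring X)" "g \<in> carrier (free_nonassoc_ring X)"
  shows "f + g \<in> carrier (free_nonassoc_ring X)" "f - g \<in> carrier (free_nonassoc_ring X)"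
    "f \<star> g \<in> carrier (free_nonassoc_ring X)" "frag_cmul r f \<in> carrier (free_nonassoc_ring X)"
proof -
  note A = nonassoc_algebra_free_nonassoc_ring[of X]
  note sub = submodule_freeD[OF submodule_carrier[OF A]]
  show "f + g \<in> carrier (free_nonassoc_ring X)" using assms by (rule sub(3))
  show "f - g \<in> carrier (free_nonassoc_ring X)" using assms by (rule sub(4))
  show "frag_cmul r f \<in> carrier (free_nonassoc_ring X)" using assms(1) by (rule sub(5))
  show "f \<star> g \<in> carrier (free_nonassoc_ring X)"
    using nonassoc_algebra.mult_closed[OF A assms] by simp
qed

lemma lie_relators_free_nonassoc_ring:
  "lie_relators (free_nonassoc_ring X) \<subseteq> carrier (free_nonassoc_ring X)"
proof -
  interpret nonassoc_algebra \<Z> "free_nonassoc_ring X" by (rule nonassoc_algebra_free_nonassoc_ring)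
  show ?thesis
    unfolding lie_relators_def
    by (intro Un_least subsetI; elim CollectE exE conjE; simp only: mult_closed a_closed)
qed

lemma lie_ideal: "alg_ideal \<Z> (free_nonassoc_ring X) (lie_ideal X)"
    "lie_relators (free_nonassoc_ring X) \<subseteq> lie_ideal X"
  unfolding lie_ideal_def
  by (rule alg_ideal_alg_ideal_gen[OF nonassoc_algebra_free_nonassoc_ring lie_relators_free_nonassoc_ring])+

lemma lie_ideal_relators:
  assumes f: "f \<in> carrier (free_nonassoc_ring X)" and g: "g \<in> carrier (free_nonassoc_ring X)"
  shows "f \<star> f \<in> lie_ideal X"
    and "f \<star> g + g \<star> f \<in> lie_ideal X"
    and "h \<in> carrier (free_nonassoc_ring X) \<Longrightarrow>
      f \<star> (g \<star> h) + g \<star> (h \<star> f) + h \<star> (f \<star> g) \<in> lie_ideal X"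
proof -
  have sq: "f \<star> f \<in> lie_ideal X" if f: "f \<in> carrier (free_nonassoc_ring X)" for f
  proof -
    have "f \<star> f \<in> lie_relators (free_nonassoc_ring X)"
      unfolding lie_relators_def free_nonassoc_ring_simps(2) using f by blast
    then show ?thesis using lie_ideal(2) by blast
  qed
  show "f \<star> f \<in> lie_ideal X" using f by (rule sq)
  note sub = submodule_freeD[OF lie_ideal(1)[unfolded alg_ideal_def, THEN conjunct1]]
  have "(f + g) \<star> (f + g) - f \<star> f - g \<star> g \<in> lie_ideal X"
    using f g by (intro sub sq free_closed)
  then show "f \<star> g + g \<star> f \<in> lie_ideal X"
    by (simp add: bilinear_extend_add algebra_simps)
  show "f \<star> (g \<star> h) + g \<star> (h \<star> f) + h \<star> (f \<star> g) \<in> lie_ideal X"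
    if h: "h \<in> carrier (free_nonassoc_ring X)"
  proof -
    have "f \<star> (g \<star> h) + g \<star> (h \<star> f) + h \<star> (f \<star> g) \<in> lie_relators (free_nonassoc_ring X)"
      unfolding lie_relators_def free_nonassoc_ring_simps(2,4) using f g h by blast
    then show ?thesis using lie_ideal(2) by blast
  qed
qed

lemma lie_class_epi: "alg_epi \<Z> (free_nonassoc_ring X) (free_lie_ring X) (lie_class X)"
  unfolding free_lie_ring_def Let_def lie_class_def[abs_def] lie_ideal_def[symmetric]
  by (rule alg_quot_epi[OF nonassoc_algebra_free_nonassoc_ring lie_ideal(1)])

lemma lie_class_zero_iff:
  assumes "f \<in> carrier (free_nonassoc_ring X)"
  shows "lie_class X f = \<zero>\<^bsub>free_lie_ring X\<^esub> \<longleftrightarrow> f \<in> lie_ideal X"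
proof -
  interpret nonassoc_algebra \<Z> "free_nonassoc_ring X" by (rule nonassoc_algebra_free_nonassoc_ring)
  show ?thesis
    unfolding free_lie_ring_def Let_def lie_class_def lie_ideal_def[symmetric]
    using alg_quot_zero_iff[OF abelian_group_axioms lie_ideal(1)[unfolded alg_ideal_def, THEN conjunct1] assms] .
qed

lemma nonassoc_algebra_free_lie_ring: "nonassoc_algebra \<Z> (free_lie_ring X)"
  by (rule alg_epi_nonassoc_algebra[OF nonassoc_algebra_free_nonassoc_ring lie_class_epi])

lemma free_lie_ring_anticommute:
  assumes "x \<in> carrier (free_lie_ring X)" "y \<in> carrier (free_lie_ring X)"
  shows "x \<otimes>\<^bsub>free_lie_ring X\<^esub> y = \<ominus>\<^bsub>free_lie_ring X\<^esub> (y \<otimes>\<^bsub>free_lie_ring X\<^esub> x)"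
proof -
  interpret F: nonassoc_algebra \<Z> "free_lie_ring X" by (rule nonassoc_algebra_free_lie_ring)
  note e = alg_epiD[OF lie_class_epi[of X]]
  obtain f g where f: "f \<in> carrier (free_nonassoc_ring X)" "g \<in> carrier (free_nonassoc_ring X)"
    "x = lie_class X f" "y = lie_class X g"
    using assms unfolding e(1)[symmetric] by blast
  have c: "f \<star> g \<in> carrier (free_nonassoc_ring X)" "g \<star> f \<in> carrier (free_nonassoc_ring X)"
    using f free_closed by blast+
  have "lie_class X (f \<star> g + g \<star> f) = \<zero>\<^bsub>free_lie_ring X\<^esub>"
    using lie_class_zero_iff[OF free_closed(1)[OF c]] lie_ideal_relators(2)[OF f(1,2)] by simp
  then have "x \<otimes>\<^bsub>free_lie_ring X\<^esub> y \<oplus>\<^bsub>free_lie_ring X\<^esub> y \<otimes>\<^bsub>free_lie_ring X\<^esub> x = \<zero>\<^bsub>free_lie_ring X\<^esub>"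
    using e(4)[OF c] e(5)[OF f(1,2)] e(5)[OF f(2,1)] f(3,4) by simp
  then have "\<ominus>\<^bsub>free_lie_ring X\<^esub> (y \<otimes>\<^bsub>free_lie_ring X\<^esub> x) = x \<otimes>\<^bsub>free_lie_ring X\<^esub> y"
    using assms by (intro F.minus_equality F.mult_closed)
  then show ?thesis by (rule sym)
qed

definition central_ideal :: "'x set \<Rightarrow> nat \<Rightarrow> ('x free_magma \<Rightarrow>\<^sub>0 int) set" where
  "central_ideal X k =
    {f \<in> carrier (free_nonassoc_ring X). lie_class X f \<in> lower_central \<Z> (free_lie_ring X) k}"

lemma alg_ideal_central_ideal: "alg_ideal \<Z> (free_nonassoc_ring X) (central_ideal X (Suc k))"
  unfolding central_ideal_def
  by (intro alg_ideal_preimage[OF nonassoc_algebra_free_nonassoc_ring lie_class_epi] lower_central_ideal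
      nonassoc_algebra_free_lie_ring free_lie_ring_anticommute)

lemma lie_ideal_subset_central_ideal: "lie_ideal X \<subseteq> central_ideal X (Suc k)"
proof
  interpret F: nonassoc_algebra \<Z> "free_lie_ring X" by (rule nonassoc_algebra_free_lie_ring)
  note L = lower_central_submodule[OF nonassoc_algebra_free_lie_ring[of X], of "Suc k",
      unfolded submodule_iff[OF F.abelian_group_axioms]]
  fix f assume f: "f \<in> lie_ideal X"
  then have c: "f \<in> carrier (free_nonassoc_ring X)"
    using submodule_freeD(1)[OF lie_ideal(1)[unfolded alg_ideal_def, THEN conjunct1]] by blast
  then show "f \<in> central_ideal X (Suc k)"
    using L f lie_class_zero_iff[OF c] unfolding central_ideal_def by simp
qed

lemma central_ideal_mult:
  assumes "f \<in> central_ideal X (Suc k)" "g \<in> carrier (free_nonassoc_ring X)"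
  shows "f \<star> g \<in> central_ideal X (Suc (Suc k))"
proof -
  note e = alg_epiD[OF lie_class_epi[of X]]
  have f: "f \<in> carrier (free_nonassoc_ring X)" "lie_class X f \<in> lower_central \<Z> (free_lie_ring X) (Suc k)"
    using assms(1) unfolding central_ideal_def by blast+
  have "lie_class X (f \<star> g) = lie_class X f \<otimes>\<^bsub>free_lie_ring X\<^esub> lie_class X g"
    using e(5)[OF f(1) assms(2)] by simp
  then show ?thesis
    using free_closed(3)[OF f(1) assms(2)]
      lower_central_mult[OF nonassoc_algebra_free_lie_ring f(2) e(3)[OF assms(2)]]
    unfolding central_ideal_def by (simp only: mem_Collect_eq)
qed

lemma central_ideal_antimono: "central_ideal X (Suc (Suc k)) \<subseteq> central_ideal X (Suc k)"
  using lower_central_antimono[OF nonassoc_algebra_free_lie_ring] unfolding central_ideal_def by blast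

lemma central_ideal_1: "central_ideal X (Suc 0) = carrier (free_nonassoc_ring X)"
  using alg_epiD(3)[OF lie_class_epi] unfolding central_ideal_def lower_central.simps by blast

lemma central_ideal_subset:
  assumes D: "submodule D \<Z> (free_nonassoc_ring X)" and E: "submodule E \<Z> (free_nonassoc_ring X)"
    and lie: "lie_ideal X \<subseteq> E"
    and sub: "central_ideal X (Suc k) \<subseteq> D"
    and mult: "\<And>f g. \<lbrakk>f \<in> D; g \<in> carrier (free_nonassoc_ring X)\<rbrakk> \<Longrightarrow> f \<star> g \<in> E"
  shows "central_ideal X (Suc (Suc k)) \<subseteq> E"
proof
  interpret A: nonassoc_algebra \<Z> "free_nonassoc_ring X" by (rule nonassoc_algebra_free_nonassoc_ring)
  note ab = A.abelian_group_axioms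
  note e = alg_epiD[OF lie_class_epi[of X]]
  have "lower_central \<Z> (free_lie_ring X) (Suc (Suc k)) \<subseteq> lie_class X ` E"
    unfolding lower_central.simps(3)
  proof (rule submodule_gen_least[OF submodule_image[OF ab lie_class_epi E]], clarify)
    fix x y
    assume x: "x \<in> lower_central \<Z> (free_lie_ring X) (Suc k)" and y: "y \<in> carrier (free_lie_ring X)"
    interpret F: nonassoc_algebra \<Z> "free_lie_ring X" by (rule nonassoc_algebra_free_lie_ring)
    have "x \<in> carrier (free_lie_ring X)"
      using x lower_central_submodule[OF nonassoc_algebra_free_lie_ring[of X], of "Suc k"]
      unfolding submodule_iff[OF F.abelian_group_axioms] by blast
    with y obtain f g where f: "f \<in> carrier (free_nonassoc_ring X)" "x = lie_class X f"
      and g: "g \<in> carrier (free_nonassoc_ring X)" "y = lie_class X g"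
      unfolding e(1)[symmetric] by blast
    have "f \<in> D" using sub f x unfolding central_ideal_def by blast
    then have "f \<star> g \<in> E" using mult g by blast
    then show "x \<otimes>\<^bsub>free_lie_ring X\<^esub> y \<in> lie_class X ` E"
      unfolding f(2) g(2) using e(5)[OF f(1) g(1)] by (metis free_nonassoc_ring_simps(2) imageI)
  qed
  moreover fix f assume "f \<in> central_ideal X (Suc (Suc k))"
  then have "lie_class X f \<in> lower_central \<Z> (free_lie_ring X) (Suc (Suc k))"
    and f: "f \<in> carrier (free_nonassoc_ring X)"
    unfolding central_ideal_def by blast+
  ultimately have "f \<in> {a \<in> carrier (free_nonassoc_ring X). lie_class X a \<in> lie_class X ` E}"
    by blast
  moreover have "{a \<in> carrier (free_nonassoc_ring X). lie_class X a = \<zero>\<^bsub>free_lie_ring X\<^esub>} \<subseteq> E"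
    using lie lie_class_zero_iff[of _ X] by blast
  ultimately show "f \<in> E"
    using preimage_image_submodule[OF ab lie_class_epi E] by blast
qed

definition ev_vanish :: "nat \<Rightarrow> (nat free_magma \<Rightarrow>\<^sub>0 int) set" where
  "ev_vanish n = {f \<in> carrier (free_nonassoc_ring {..<2}). \<forall>i<n. ev f i = 0}"

lemma submodule_ev_vanish: "submodule (ev_vanish n) \<Z> (free_nonassoc_ring {..<2})"
proof -
  interpret A: nonassoc_algebra \<Z> "free_nonassoc_ring {..<2::nat}"
    by (rule nonassoc_algebra_free_nonassoc_ring)
  have neg: "ev (- f) = (\<lambda>i. - ev f i)" for f
    using lin_extend_cmul[of ev_word "-1" f] by simp
  have "- f \<in> carrier (free_nonassoc_ring {..<2})" if "f \<in> carrier (free_nonassoc_ring {..<2})" for f :: "nat free_magma \<Rightarrow>\<^sub>0 int"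
    using that by simp
  moreover have "0 \<in> carrier (free_nonassoc_ring {..<2::nat})" by simp
  ultimately show ?thesis
    unfolding submodule_iff[OF A.abelian_group_axioms] ev_vanish_def
    using free_closed(1,4)[of _ "{..<2::nat}"]
    by (auto simp: lin_extend_add lin_extend_cmul neg simp del: free_nonassoc_ring_simps(1))
qed

lemma ev_word_eq_0:
  assumes "letters w \<subseteq> {..<2}" "8 \<le> i"
  shows "ev_word w i = 0"
  using assms by (cases w) (auto simp: unit_vec_def br_def)

lemma ev_vanish_8: "ev_vanish 8 = {f \<in> carrier (free_nonassoc_ring {..<2}). ev f = (\<lambda>_. 0)}"
proof -
  have "ev f i = 0" if "f \<in> carrier (free_nonassoc_ring {..<2})" "\<not> i < 8" for f i
    unfolding lin_extend_def using that ev_word_eq_0 by (intro sum.neutral) auto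
  then show ?thesis unfolding ev_vanish_def fun_eq_iff by blast
qed

lemma lie_ideal_subset_ev_vanish: "lie_ideal {..<2} \<subseteq> ev_vanish n"
proof -
  let ?K = "{f \<in> carrier (free_nonassoc_ring {..<2}). ev f = (\<lambda>_. 0)}"
  have br0: "br (\<lambda>_. 0) h = (\<lambda>_. 0)" "br h (\<lambda>_. 0) = (\<lambda>_. 0)" for h by (auto simp: br_def)
  have "alg_ideal \<Z> (free_nonassoc_ring {..<2}) ?K"
    unfolding alg_ideal_def
    using free_closed(3)[of _ "{..<2::nat}"] submodule_ev_vanish[of 8, unfolded ev_vanish_8]
    by (auto simp: ev_mult br0 simp del: free_nonassoc_ring_simps(1))
  moreover have "lie_relators (free_nonassoc_ring {..<2}) \<subseteq> ?K"
  proof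
    fix r assume r: "r \<in> lie_relators (free_nonassoc_ring {..<2::nat})"
    then have "r \<in> carrier (free_nonassoc_ring {..<2})"
      using lie_relators_free_nonassoc_ring by blast
    moreover have "ev r = (\<lambda>_. 0)"
      using r unfolding lie_relators_def by (auto simp: ev_mult lin_extend_add br_jacobi)
    ultimately show "r \<in> ?K" by blast
  qed
  ultimately have "lie_ideal {..<2} \<subseteq> ?K"
    unfolding lie_ideal_def by (rule alg_ideal_gen_least)
  then show ?thesis by (auto simp: ev_vanish_def)
qed

lemma central_ideal_ev_vanish:
  "central_ideal {..<2} 2 \<subseteq> ev_vanish 2" "central_ideal {..<2} 3 \<subseteq> ev_vanish 3"
  "central_ideal {..<2} 4 \<subseteq> ev_vanish 5" "central_ideal {..<2} 5 \<subseteq> ev_vanish 8"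
proof -
  have step: "central_ideal {..<2} (Suc (Suc k)) \<subseteq> ev_vanish n'"
    if "central_ideal {..<2} (Suc k) \<subseteq> ev_vanish n"
      "\<And>f g i. \<lbrakk>\<forall>i<n. f i = 0; i < n'\<rbrakk> \<Longrightarrow> br f g i = 0" for k n n'
    by (rule central_ideal_subset[OF submodule_ev_vanish submodule_ev_vanish lie_ideal_subset_ev_vanish that(1)])
      (use that(2) free_closed(3)[of _ "{..<2::nat}"] in
        \<open>auto simp: ev_vanish_def ev_mult simp del: free_nonassoc_ring_simps(1)\<close>)
  have 0: "central_ideal {..<2} (Suc 0) \<subseteq> ev_vanish 0"
    unfolding central_ideal_1 ev_vanish_def by blast
  have 2: "central_ideal {..<2} (Suc (Suc 0)) \<subseteq> ev_vanish 2"
    by (rule step[OF 0]) (auto simp: br_def)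
  have 3: "central_ideal {..<2} (Suc (Suc (Suc 0))) \<subseteq> ev_vanish 3"
    by (rule step[OF 2]) (auto simp: br_def)
  have 4: "central_ideal {..<2} (Suc (Suc (Suc (Suc 0)))) \<subseteq> ev_vanish 5"
    by (rule step[OF 3]) (auto simp: br_def)
  have 5: "central_ideal {..<2} (Suc (Suc (Suc (Suc (Suc 0))))) \<subseteq> ev_vanish 8"
    by (rule step[OF 4]) (auto simp: br_def)
  show "central_ideal {..<2} 2 \<subseteq> ev_vanish 2" "central_ideal {..<2} 3 \<subseteq> ev_vanish 3"
    "central_ideal {..<2} 4 \<subseteq> ev_vanish 5" "central_ideal {..<2} 5 \<subseteq> ev_vanish 8"
    using 2 3 4 5 by (simp_all add: eval_nat_numeral)
qed

definition basis_sum :: "(nat \<Rightarrow> int) \<Rightarrow> nat free_magma \<Rightarrow>\<^sub>0 int" where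
  "basis_sum c = (\<Sum>i<8. frag_cmul (c i) (frag_of (basis_word i)))"

lemma ev_basis_sum: "ev (basis_sum c) = (\<lambda>i. if i < 8 then c i else 0)"
proof
  fix j
  have "ev (basis_sum c) j = (\<Sum>i<8. c i * unit_vec i j)"
    unfolding basis_sum_def by (simp add: lin_extend_sum lin_extend_cmul ev_basis_word)
  then show "ev (basis_sum c) j = (if j < 8 then c j else 0)"
    by (simp add: unit_vec_def if_distrib cong: if_cong)
qed

lemma basis_word_in_free: "i < 8 \<Longrightarrow> frag_of (basis_word i) \<in> carrier (free_nonassoc_ring {..<2})"
  using letters_basis_word[of i] by (simp add: keys_frag_of)

text \<open>The span of the basis words modulo \<open>J\<close> absorbs right multiplication by the two letters,
  hence, by the Jacobi identity in the form \<open>[a, [u, v]] = [[a, u], v] - [[a, v], u]\<close>, by every word.\<close>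

lemma basis_words_span:
  assumes J: "alg_ideal \<Z> (free_nonassoc_ring {..<2}) J" and lie: "lie_ideal {..<2} \<subseteq> J"
    and top: "\<And>i j. \<lbrakk>i \<in> {5, 6, 7}; j < 2\<rbrakk> \<Longrightarrow> frag_of (basis_word i) \<star> frag_of (basis_word j) \<in> J"
    and f: "f \<in> carrier (free_nonassoc_ring {..<2})"
  shows "\<exists>c. f - basis_sum c \<in> J"
proof -
  let ?A = "carrier (free_nonassoc_ring {..<2::nat})"
  let ?b = "\<lambda>i. frag_of (basis_word i)"
  note Js = submodule_freeD[OF J[unfolded alg_ideal_def, THEN conjunct1]]
  note Jm = alg_ideal_freeD[OF J]
  note closed = free_closed[of _ "{..<2::nat}"]
  define W where "W = {f \<in> ?A. \<exists>c. f - basis_sum c \<in> J}"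
  have W_A: "f \<in> ?A" if "f \<in> W" for f using that unfolding W_def by blast
  have W_diff: "f - g \<in> W" if f: "f \<in> W" and g: "g \<in> W" for f g
  proof -
    obtain c d where c: "f - basis_sum c \<in> J" "g - basis_sum d \<in> J" using f g unfolding W_def by blast
    have "basis_sum (\<lambda>i. c i - d i) = basis_sum c - basis_sum d"
      by (simp add: basis_sum_def frag_cmul_diff_distrib sum_subtractf)
    then have "f - g - basis_sum (\<lambda>i. c i - d i) = (f - basis_sum c) - (g - basis_sum d)" by simp
    also have "\<dots> \<in> J" using c by (rule Js(4))
    finally show ?thesis using closed(2) W_A[OF f] W_A[OF g] unfolding W_def by blast
  qed
  have W_J: "f \<in> W" if "f \<in> J" for f
  proof -
    have "f - basis_sum (\<lambda>_. 0) = f" by (simp add: basis_sum_def)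
    then have "\<exists>c. f - basis_sum c \<in> J" using that by metis
    then show ?thesis using that Js(1) unfolding W_def by blast
  qed
  have W_0: "0 \<in> W" using W_J Js(2) by blast
  have W_add: "f + g \<in> W" if "f \<in> W" "g \<in> W" for f g
    using W_diff[OF that(1) W_diff[OF W_0 that(2)]] by simp
  have W_cong: "f \<in> W" if "f - g \<in> J" "g \<in> W" for f g
    using W_add[OF W_J[OF that(1)] that(2)] by simp
  have W_cmul: "frag_cmul r f \<in> W" if "f \<in> W" for r f
    by (rule frag_closure_minus_cmul[of "\<lambda>f. f \<in> W"]) (use W_0 W_diff that in auto)
  have W_sum: "sum F S \<in> W" if "\<And>s. s \<in> S \<Longrightarrow> F s \<in> W" for F and S :: "nat set"
    using that by (induction S rule: infinite_finite_induct) (auto intro: W_0 W_add)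
  have W_b: "?b i \<in> W" if "i < 8" for i
  proof -
    have "basis_sum (unit_vec i) = (\<Sum>j<8. if j = i then ?b i else 0)"
      unfolding basis_sum_def by (rule sum.cong) (auto simp: unit_vec_def)
    also have "\<dots> = ?b i" using that by simp
    finally have "?b i - basis_sum (unit_vec i) \<in> J" using Js(2) by simp
    then show ?thesis using basis_word_in_free[OF that] unfolding W_def by blast
  qed
  have b: "?b 0 \<star> ?b 1 = ?b 2" "?b 2 \<star> ?b 0 = ?b 3" "?b 2 \<star> ?b 1 = ?b 4" "?b 3 \<star> ?b 0 = ?b 5"
    "?b 3 \<star> ?b 1 = ?b 6" "?b 4 \<star> ?b 1 = ?b 7"
    by (simp_all add: basis_word_simps)
  have bA: "?b 0 \<in> ?A" "?b 1 \<in> ?A" "?b 2 \<in> ?A" by (rule basis_word_in_free; simp)+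
  have anti: "f \<star> g + g \<star> f \<in> J" if "f \<in> ?A" "g \<in> ?A" for f g
    using lie_ideal_relators(2)[OF that] lie by blast
  have sq: "f \<star> f \<in> J" if "f \<in> ?A" for f
    using lie_ideal_relators(1)[OF that that] lie by blast
  have jacobi: "f \<star> (u \<star> v) - ((f \<star> u) \<star> v - (f \<star> v) \<star> u) \<in> J"
    if f: "f \<in> ?A" and u: "u \<in> ?A" and v: "v \<in> ?A" for f u v
  proof -
    have 1: "f \<star> (u \<star> v) + u \<star> (v \<star> f) + v \<star> (f \<star> u) \<in> J"
      using lie_ideal_relators(3)[OF f u v] lie by blast
    have 2: "u \<star> (v \<star> f) + (v \<star> f) \<star> u \<in> J" "v \<star> (f \<star> u) + (f \<star> u) \<star> v \<in> J"
      by (intro anti closed(3) f u v)+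
    have 3: "(v \<star> f + f \<star> v) \<star> u \<in> J"
      using Jm(2)[OF anti[OF v f] u] .
    have "(f \<star> (u \<star> v) + u \<star> (v \<star> f) + v \<star> (f \<star> u)) - (u \<star> (v \<star> f) + (v \<star> f) \<star> u)
        + (v \<star> f + f \<star> v) \<star> u - (v \<star> (f \<star> u) + (f \<star> u) \<star> v) \<in> J"
      by (rule Js(4)[OF Js(3)[OF Js(4)[OF 1 2(1)] 3] 2(2)])
    then have "f \<star> (u \<star> v) + (f \<star> v) \<star> u - (f \<star> u) \<star> v \<in> J"
      by (simp add: bilinear_extend_add)
    then show ?thesis by (simp add: algebra_simps)
  qed
  have W_gen: "?b i \<star> ?b j \<in> W" if i: "i < 8" and j: "j < 2" for i j
  proof -
    have 10: "?b 1 \<star> ?b 0 \<in> W"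
    proof -
      have "?b 1 \<star> ?b 0 - (0 - ?b 2) \<in> J" using anti[OF bA(2,1)] b(1) by simp
      then show ?thesis by (rule W_cong) (intro W_diff W_0 W_b, simp)
    qed
    have 40: "?b 4 \<star> ?b 0 \<in> W"
    proof -
      have 1: "?b 2 \<star> (?b 1 \<star> ?b 0) - (?b 4 \<star> ?b 0 - ?b 6) \<in> J"
        using jacobi[OF bA(3,2,1)] by (simp only: b)
      have "?b 2 \<star> (?b 1 \<star> ?b 0 + ?b 0 \<star> ?b 1) - ?b 2 \<star> ?b 2 \<in> J"
        by (intro Js(4) Jm(1) anti sq bA)
      then have "?b 2 \<star> (?b 1 \<star> ?b 0) \<in> J" by (simp only: bilinear_extend_add b add_diff_cancel_right')
      from Js(4)[OF this 1]
      have "?b 4 \<star> ?b 0 - ?b 6 \<in> J" by (simp add: algebra_simps)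
      then show ?thesis by (rule W_cong) (rule W_b, simp)
    qed
    have top': "?b 5 \<star> ?b j \<in> W" "?b 6 \<star> ?b j \<in> W" "?b 7 \<star> ?b j \<in> W"
      using top[of 5 j] top[of 6 j] top[of 7 j] j W_J by simp_all
    have low: "?b 0 \<star> ?b 0 \<in> W" "?b 1 \<star> ?b 1 \<in> W" "?b 0 \<star> ?b 1 \<in> W" "?b 2 \<star> ?b 0 \<in> W" "?b 2 \<star> ?b 1 \<in> W"
      "?b 3 \<star> ?b 0 \<in> W" "?b 3 \<star> ?b 1 \<in> W" "?b 4 \<star> ?b 1 \<in> W"
      unfolding b by (rule W_J[OF sq[OF bA(1)]], rule W_J[OF sq[OF bA(2)]], (rule W_b, simp)+)
    have "j = 0 \<or> j = 1" using j by auto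
    moreover have "i = 0 \<or> i = 1 \<or> i = 2 \<or> i = 3 \<or> i = 4 \<or> i = 5 \<or> i = 6 \<or> i = 7"
      using i by auto
    ultimately show ?thesis using 10 40 top' low by (elim disjE) (simp_all only:)
  qed
  have W_letter: "f \<star> ?b j \<in> W" if f: "f \<in> W" and j: "j < 2" for f j
  proof -
    obtain c where c: "f - basis_sum c \<in> J" using f unfolding W_def by blast
    have "(f - basis_sum c) \<star> ?b j \<in> J"
      using Jm(2)[OF c basis_word_in_free] j by simp
    then have "f \<star> ?b j - basis_sum c \<star> ?b j \<in> J" by (simp only: bilinear_extend_diff)
    moreover have "basis_sum c \<star> ?b j \<in> W"
      unfolding basis_sum_def bilinear_extend_sum bilinear_extend_cmul
      using j by (intro W_sum W_cmul W_gen) auto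
    ultimately show ?thesis by (rule W_cong)
  qed
  have letter: "Letter j = basis_word j" if "j < 2" for j
    using that by (auto simp: less_2_cases_iff basis_word_simps)
  have word_A: "frag_of w \<in> ?A" if "letters w \<subseteq> {..<2}" for w :: "nat free_magma"
    using that by (simp add: keys_frag_of)
  have W_word: "f \<star> frag_of w \<in> W" if "letters w \<subseteq> {..<2}" "f \<in> W" for f w
    using that
  proof (induction w arbitrary: f)
    case (Letter j)
    then show ?case using W_letter[of f j] letter[of j] by simp
  next
    case (Join u v)
    then have uv: "letters u \<subseteq> {..<2}" "letters v \<subseteq> {..<2}" by auto
    have "f \<star> (frag_of u \<star> frag_of v) \<in> W"
      by (rule W_cong[OF jacobi[OF W_A[OF Join.prems(2)] word_A[OF uv(1)] word_A[OF uv(2)]]])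
        (intro W_diff Join.IH uv Join.prems)
    then show ?case by simp
  qed
  have words: "frag_of w \<in> W" if "letters w \<subseteq> {..<2}" for w
    using that
  proof (induction w)
    case (Letter j)
    then show ?case using W_b[of j] letter[of j] by simp
  next
    case (Join u v)
    then show ?case using W_word[of v "frag_of u"] by simp
  qed
  have "Poly_Mapping.keys f \<subseteq> {w. letters w \<subseteq> {..<2}}" using f by auto
  then have "f \<in> W"
    by (induction f rule: frag_induction) (use W_0 words W_diff in auto)
  then show ?thesis unfolding W_def by blast
qed

lemma basis_word_central:
  "frag_of (basis_word 2) \<in> central_ideal {..<2} 2"
  "frag_of (basis_word 3) \<in> central_ideal {..<2} 3" "frag_of (basis_word 4) \<in> central_ideal {..<2} 3"
  "i \<in> {5, 6, 7} \<Longrightarrow> frag_of (basis_word i) \<in> central_ideal {..<2} 4"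
proof -
  let ?J = "central_ideal {..<2::nat}"
  let ?b = "\<lambda>i. frag_of (basis_word i)"
  have bA: "?b 0 \<in> carrier (free_nonassoc_ring {..<2})"
    by (rule basis_word_in_free) simp
  have mult: "?b i \<star> ?b j \<in> ?J (Suc (Suc k))" if "?b i \<in> ?J (Suc k)" "j < 2" for i j k
    using central_ideal_mult[OF that(1) basis_word_in_free[of j]] that(2) by simp
  have b2: "?b 2 \<in> ?J (Suc (Suc 0))"
    using mult[of 0 0 1] bA by (simp add: basis_word_simps central_ideal_1)
  have b34: "?b 3 \<in> ?J (Suc (Suc (Suc 0)))" "?b 4 \<in> ?J (Suc (Suc (Suc 0)))"
    using mult[OF b2, of 0] mult[OF b2, of 1] by (simp_all add: basis_word_simps)
  have "?b 5 \<in> ?J (Suc (Suc (Suc (Suc 0))))" "?b 6 \<in> ?J (Suc (Suc (Suc (Suc 0))))"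
    "?b 7 \<in> ?J (Suc (Suc (Suc (Suc 0))))"
    using mult[OF b34(1), of 0] mult[OF b34(1), of 1] mult[OF b34(2), of 1]
    by (simp_all add: basis_word_simps)
  with b2 b34 show "?b 2 \<in> ?J 2" "?b 3 \<in> ?J 3" "?b 4 \<in> ?J 3" "i \<in> {5, 6, 7} \<Longrightarrow> ?b i \<in> ?J 4"
    by (auto simp: eval_nat_numeral)
qed

lemma central_ideal_eq:
  assumes n: "n \<le> 8" and c: "c \<le> 4"
    and vanish: "central_ideal {..<2} (Suc c) \<subseteq> ev_vanish n"
    and basis: "\<And>i. \<lbrakk>n \<le> i; i < 8\<rbrakk> \<Longrightarrow> frag_of (basis_word i) \<in> central_ideal {..<2} (Suc c)"
  shows "central_ideal {..<2} (Suc c) = ev_vanish n"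
proof
  let ?J = "central_ideal {..<2::nat}"
  have mono: "?J (Suc l) \<subseteq> ?J (Suc k)" if "k \<le> l" for k l
    using that by (induction rule: dec_induct) (use central_ideal_antimono in blast)+
  show "ev_vanish n \<subseteq> ?J (Suc c)"
  proof
    fix f assume f: "f \<in> ev_vanish n"
    then have fA: "f \<in> carrier (free_nonassoc_ring {..<2})" unfolding ev_vanish_def by blast
    let ?b = "\<lambda>i. frag_of (basis_word i)"
    have "\<exists>a. f - basis_sum a \<in> ?J (Suc 4)"
      using fA
    proof (rule basis_words_span[OF alg_ideal_central_ideal lie_ideal_subset_central_ideal, rotated])
      fix i j :: nat assume "i \<in> {5, 6, 7}" "j < 2"
      then show "?b i \<star> ?b j \<in> ?J (Suc 4)"
        using central_ideal_mult[of "?b i" "{..<2}" 3 "?b j"] basis_word_central(4)[of i] basis_word_in_free[of j]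
        by (simp add: eval_nat_numeral)
    qed
    then obtain a where a: "f - basis_sum a \<in> ?J (Suc 4)" by blast
    then have "f - basis_sum a \<in> ev_vanish 8" using central_ideal_ev_vanish(4) by auto
    then have "ev f i = a i" if "i < 8" for i
      using that by (auto simp: ev_vanish_def lin_extend_diff ev_basis_sum)
    then have a0: "a i = 0" if "i < n" for i
      using f that n by (auto simp: ev_vanish_def)
    note Js = submodule_freeD[OF alg_ideal_central_ideal[of "{..<2::nat}" c, unfolded alg_ideal_def, THEN conjunct1]]
    have "frag_cmul (a i) (?b i) \<in> ?J (Suc c)" if "i < 8" for i
      using a0[of i] Js(2) Js(5)[OF basis] that by (cases "i < n") auto
    moreover have sum: "sum F S \<in> ?J (Suc c)" if "\<And>s. s \<in> S \<Longrightarrow> F s \<in> ?J (Suc c)" for F and S :: "nat set"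
      using that by (induction S rule: infinite_finite_induct) (auto intro: Js(2,3))
    ultimately have "basis_sum a \<in> ?J (Suc c)" unfolding basis_sum_def by (intro sum) auto
    moreover have "f - basis_sum a \<in> ?J (Suc c)" using a mono[OF c] by auto
    ultimately have "(f - basis_sum a) + basis_sum a \<in> ?J (Suc c)" by (intro Js(3))
    then show "f \<in> ?J (Suc c)" by simp
  qed
qed (fact vanish)

lemma free_nilpotent_kernel:
  "central_ideal {..<2} (Suc 2) = ev_vanish 3" "central_ideal {..<2} (Suc 3) = ev_vanish 5"
  "central_ideal {..<2} (Suc 4) = ev_vanish 8"
proof -
  let ?J = "central_ideal {..<2::nat}"
  let ?b = "\<lambda>i. frag_of (basis_word i)"
  have top: "?b i \<in> ?J (Suc 2)" "?b i \<in> ?J (Suc 3)" if "i \<in> {5, 6, 7}" for i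
    using basis_word_central(4)[OF that] central_ideal_antimono[of "{..<2::nat}" 2]
    by (auto simp: eval_nat_numeral)
  show "?J (Suc 2) = ev_vanish 3"
  proof (rule central_ideal_eq)
    fix i :: nat assume "3 \<le> i" "i < 8"
    then have "i \<in> {3, 4} \<or> i \<in> {5, 6, 7}" by auto
    then show "?b i \<in> ?J (Suc 2)" using basis_word_central(2,3) top(1)[of i] by (auto simp: eval_nat_numeral)
  qed (use central_ideal_ev_vanish(2) in simp_all)
  show "?J (Suc 3) = ev_vanish 5"
  proof (rule central_ideal_eq)
    fix i :: nat assume "5 \<le> i" "i < 8"
    then have "i \<in> {5, 6, 7}" by auto
    then show "?b i \<in> ?J (Suc 3)" by (rule top(2))
  qed (use central_ideal_ev_vanish(3) in simp_all)
  show "?J (Suc 4) = ev_vanish 8"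
    by (rule central_ideal_eq) (use central_ideal_ev_vanish(4) in simp_all)
qed

lemma free_nilpotent_lie_ring_iso:
  assumes ker: "central_ideal {..<2} (Suc c) = ev_vanish n" and n: "n \<le> 8"
  obtains h where "alg_epi \<Z> (nilp 0 n) (free_nilpotent_lie_ring c 2) h"
    "\<And>x. \<lbrakk>x \<in> carrier (nilp 0 n); h x = \<zero>\<^bsub>free_nilpotent_lie_ring c 2\<^esub>\<rbrakk> \<Longrightarrow> x = \<zero>\<^bsub>nilp 0 n\<^esub>"
proof -
  let ?A = "free_nonassoc_ring {..<2::nat}" and ?F = "free_lie_ring {..<2::nat}" and ?L = "free_nilpotent_lie_ring c 2"
  let ?N = "lower_central \<Z> ?F (Suc c)"
  interpret A: nonassoc_algebra \<Z> ?A by (rule nonassoc_algebra_free_nonassoc_ring)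
  have F: "nonassoc_algebra \<Z> ?F" by (rule nonassoc_algebra_free_lie_ring)
  interpret F: nonassoc_algebra \<Z> ?F by (rule F)
  have N: "alg_ideal \<Z> ?F ?N"
    by (rule lower_central_ideal[OF F free_lie_ring_anticommute])
  have L: "?L = ?F aQuot ?N" by (simp add: free_nilpotent_lie_ring_def Let_def)
  define \<pi> where "\<pi> = (\<lambda>x. ?N +>\<^bsub>?F\<^esub> x) \<circ> lie_class {..<2}"
  have epi: "alg_epi \<Z> ?A ?L \<pi>"
    unfolding \<pi>_def L by (rule alg_epi_comp[OF lie_class_epi alg_quot_epi[OF F N]])
  have zero: "\<pi> f = \<zero>\<^bsub>?L\<^esub> \<longleftrightarrow> f \<in> ev_vanish n" if f: "f \<in> carrier ?A" for f
    using alg_quot_zero_iff[OF F.abelian_group_axioms N[unfolded alg_ideal_def, THEN conjunct1]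
        alg_epiD(3)[OF lie_class_epi f]] f
    unfolding \<pi>_def L ker[symmetric] central_ideal_def comp_def by blast
  have zero': "red 0 n (ev f) = \<zero>\<^bsub>nilp 0 n\<^esub> \<longleftrightarrow> f \<in> ev_vanish n" if f: "f \<in> carrier ?A" for f
  proof -
    have "red 0 n (ev f) = (\<lambda>_. 0) \<longleftrightarrow> (\<forall>i<n. ev f i = 0)" by (auto simp: red_def fun_eq_iff)
    then show ?thesis using f unfolding ev_vanish_def nilp_simps(3) by blast
  qed
  note E = alg_epi_ev[OF n]
  obtain h where h: "alg_epi \<Z> (nilp 0 n) ?L h" "\<And>f. f \<in> carrier ?A \<Longrightarrow> h (red 0 n (ev f)) = \<pi> f"
    using alg_epi_factor[OF A.abelian_group_axioms E epi A.mult_closed A.scale_closed] zero zero' by blast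
  moreover have "x = \<zero>\<^bsub>nilp 0 n\<^esub>" if x: "x \<in> carrier (nilp 0 n)" "h x = \<zero>\<^bsub>?L\<^esub>" for x
  proof -
    obtain f where f: "f \<in> carrier ?A" "x = red 0 n (ev f)"
      using x(1) unfolding alg_epiD(1)[OF E, symmetric] by blast
    then show ?thesis using h(2) zero zero' x(2) by simp
  qed
  ultimately show ?thesis using that by blast
qed

subsection \<open>Extension of scalars\<close>

lemma pre_extend_scalars_simps [simp]:
  "f \<in> carrier (pre_extend_scalars L K) \<longleftrightarrow> Poly_Mapping.keys f \<subseteq> carrier L \<times> carrier K"
  "f \<otimes>\<^bsub>pre_extend_scalars L K\<^esub> g = bilinear_extend (\<lambda>(x, a) (y, b). (x \<otimes>\<^bsub>L\<^esub> y, a \<otimes>\<^bsub>K\<^esub> b)) f g"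
  "\<zero>\<^bsub>pre_extend_scalars L K\<^esub> = 0"
  "f \<oplus>\<^bsub>pre_extend_scalars L K\<^esub> g = f + g"
  "k \<odot>\<^bsub>pre_extend_scalars L K\<^esub> f = frag_extend (\<lambda>(x, a). frag_of (x, k \<otimes>\<^bsub>K\<^esub> a)) f"
  by (simp_all add: pre_extend_scalars_def)

lemma nonassoc_algebra_pre_extend_scalars:
  assumes L: "nonassoc_algebra \<Z> L"
    and K: "\<And>a b. \<lbrakk>a \<in> carrier K; b \<in> carrier K\<rbrakk> \<Longrightarrow> a \<otimes>\<^bsub>K\<^esub> b \<in> carrier K"
  shows "nonassoc_algebra K (pre_extend_scalars L K)"
proof -
  let ?P = "pre_extend_scalars L K"
  interpret L: nonassoc_algebra \<Z> L by fact
  have "abelian_group ?P"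
  proof (rule abelian_groupI)
    show "\<exists>y\<in>carrier ?P. y \<oplus>\<^bsub>?P\<^esub> f = \<zero>\<^bsub>?P\<^esub>" if "f \<in> carrier ?P" for f
      using that by (intro bexI[of _ "- f"]) auto
    show "f \<oplus>\<^bsub>?P\<^esub> g \<in> carrier ?P" if "f \<in> carrier ?P" "g \<in> carrier ?P" for f g
      using that keys_add[of f g] by simp blast
  qed (auto simp: ac_simps)
  then interpret abelian_group ?P .
  show ?thesis
  proof
    fix f g assume "f \<in> carrier ?P" "g \<in> carrier ?P"
    then have fg: "Poly_Mapping.keys f \<subseteq> carrier L \<times> carrier K" "Poly_Mapping.keys g \<subseteq> carrier L \<times> carrier K"
      by simp_all
    let ?h = "\<lambda>(x, a) (y, b). (x \<otimes>\<^bsub>L\<^esub> y, a \<otimes>\<^bsub>K\<^esub> b)"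
    have "Poly_Mapping.keys (bilinear_extend ?h f g) \<subseteq>
        (\<lambda>(u, v). ?h u v) ` (Poly_Mapping.keys f \<times> Poly_Mapping.keys g)"
      by (rule keys_bilinear_extend)
    also have "\<dots> \<subseteq> (\<lambda>(u, v). ?h u v) ` ((carrier L \<times> carrier K) \<times> (carrier L \<times> carrier K))"
      using fg by (intro image_mono Sigma_mono) auto
    also have "\<dots> \<subseteq> carrier L \<times> carrier K" using K L.mult_closed by auto
    finally show "f \<otimes>\<^bsub>?P\<^esub> g \<in> carrier ?P" by simp
  next
    fix r f assume r: "r \<in> carrier K" and "f \<in> carrier ?P"
    then have f: "Poly_Mapping.keys f \<subseteq> carrier L \<times> carrier K" by simp
    have "Poly_Mapping.keys (frag_extend (\<lambda>(x, a). frag_of (x, r \<otimes>\<^bsub>K\<^esub> a)) f) \<subseteq>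
        (\<Union>u\<in>Poly_Mapping.keys f. Poly_Mapping.keys ((\<lambda>(x, a). frag_of (x, r \<otimes>\<^bsub>K\<^esub> a)) u))"
      by (rule keys_frag_extend)
    also have "\<dots> \<subseteq> (\<Union>u\<in>carrier L \<times> carrier K. Poly_Mapping.keys ((\<lambda>(x, a). frag_of (x, r \<otimes>\<^bsub>K\<^esub> a)) u))"
      using f by (intro UN_mono) auto
    also have "\<dots> \<subseteq> carrier L \<times> carrier K" using r K by (auto simp: keys_frag_of)
    finally show "r \<odot>\<^bsub>?P\<^esub> f \<in> carrier ?P" by simp
  qed (simp_all add: bilinear_extend_add frag_extend_add)
qed

lemma alg_ideal_zero:
  assumes A: "nonassoc_algebra R A"
  shows "alg_ideal R A {\<zero>\<^bsub>A\<^esub>}"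
proof -
  interpret nonassoc_algebra R A by fact
  show ?thesis
    unfolding alg_ideal_def submodule_iff[OF abelian_group_axioms]
    by (simp add: mult_zero scale_zero)
qed

locale scalar_extension = residues m K for m :: int and K (structure) +
  fixes L :: "(int, 'a, 'l) module_scheme" and n :: nat
    and h :: "(nat \<Rightarrow> int) \<Rightarrow> 'a" and \<phi> :: "'a \<Rightarrow> nat \<Rightarrow> int"
  assumes h: "alg_epi \<Z> (nilp 0 n) L h" and \<phi>: "alg_epi \<Z> L (nilp 0 n) \<phi>"
    and \<phi>_h: "\<And>c. c \<in> carrier (nilp 0 n) \<Longrightarrow> \<phi> (h c) = c"
begin

abbreviation "P \<equiv> pre_extend_scalars L K"

definition T :: "('a \<times> int \<Rightarrow>\<^sub>0 int) set" where
  "T = generate (add_monoid P) (tensor_relators L K)"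

definition coord :: "'a \<times> int \<Rightarrow> nat \<Rightarrow> int" where
  "coord = (\<lambda>(x, a) i. a * \<phi> x i)"

definition \<psi> :: "('a \<times> int \<Rightarrow>\<^sub>0 int) \<Rightarrow> nat \<Rightarrow> int" where
  "\<psi> f = red m n (lin_extend coord f)"

lemma L: "nonassoc_algebra \<Z> L"
  by (rule alg_epi_nonassoc_algebra[OF nonassoc_algebra_nilp h])

lemma P: "nonassoc_algebra K P"
  by (rule nonassoc_algebra_pre_extend_scalars[OF L]) simp

lemma h_\<phi>:
  assumes "x \<in> carrier L"
  shows "h (\<phi> x) = x"
proof -
  obtain c where "c \<in> carrier (nilp 0 n)" "x = h c"
    using assms unfolding alg_epiD(1)[OF h, symmetric] by blast
  then show ?thesis using \<phi>_h by simp
qed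

lemma \<psi>_epi: "alg_epi K P (nilp m n) \<psi>"
  unfolding alg_epi_def
proof (intro conjI ballI)
  show "\<psi> ` carrier P = carrier (nilp m n)"
  proof (intro equalityI subsetI)
    fix c assume c: "c \<in> carrier (nilp m n)"
    have "c i = 0" if "\<not> i < n" for i
      using c that by (auto simp: red_def dest!: fun_cong[of _ c i])
    then have c0: "c \<in> carrier (nilp 0 n)" by (auto simp: red_def fun_eq_iff)
    then have "\<psi> (frag_of (h c, 1)) = c"
      using c \<phi>_h[OF c0] by (simp add: \<psi>_def coord_def)
    moreover have "frag_of (h c, 1) \<in> carrier P"
      using alg_epiD(3)[OF h c0] one_closed by (simp add: keys_frag_of res_one_eq)
    ultimately show "c \<in> \<psi> ` carrier P" by (metis imageI)
  qed (auto simp: \<psi>_def)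
next
  fix f g assume "f \<in> carrier P" "g \<in> carrier P"
  then have fg: "Poly_Mapping.keys f \<subseteq> carrier L \<times> carrier K" "Poly_Mapping.keys g \<subseteq> carrier L \<times> carrier K"
    by simp_all
  show "\<psi> (f \<oplus>\<^bsub>P\<^esub> g) = \<psi> f \<oplus>\<^bsub>nilp m n\<^esub> \<psi> g" by (simp add: \<psi>_def lin_extend_add)
  have "lin_extend coord (bilinear_extend (\<lambda>(x, a) (y, b). (x \<otimes>\<^bsub>L\<^esub> y, a \<otimes> b)) f g) i mod m
      = br (lin_extend coord f) (lin_extend coord g) i mod m" if i: "i < n" for i
  proof (rule lin_extend_bilinear_extend_mod[OF _ _ _ _ fg])
    fix u v assume "u \<in> carrier L \<times> carrier K" "v \<in> carrier L \<times> carrier K"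
    then obtain x a y b where u: "u = (x, a)" "v = (y, b)" "x \<in> carrier L" "y \<in> carrier L" by auto
    have "coord (x \<otimes>\<^bsub>L\<^esub> y, a \<otimes> b) i = ((a * b) mod m) * br (\<phi> x) (\<phi> y) i"
      using alg_epiD(5)[OF \<phi> u(3,4)] i by (simp add: coord_def res_mult_eq red_def)
    also have "\<dots> mod m = (a * b) * br (\<phi> x) (\<phi> y) i mod m" by (simp add: mod_mult_left_eq)
    also have "(a * b) * br (\<phi> x) (\<phi> y) i = br (coord u) (coord v) i"
      by (simp add: coord_def u br_scale mult.assoc)
    finally show "coord ((\<lambda>(x, a) (y, b). (x \<otimes>\<^bsub>L\<^esub> y, a \<otimes> b)) u v) i mod m = br (coord u) (coord v) i mod m"
      by (simp add: u)
  qed (simp_all add: br_diff, simp_all add: br_def fun_eq_iff)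
  then have "\<psi> (f \<otimes>\<^bsub>P\<^esub> g) = red m n (br (lin_extend coord f) (lin_extend coord g))"
    unfolding \<psi>_def pre_extend_scalars_simps by (intro red_eqI)
  then show "\<psi> (f \<otimes>\<^bsub>P\<^esub> g) = \<psi> f \<otimes>\<^bsub>nilp m n\<^esub> \<psi> g" by (simp add: \<psi>_def)
next
  fix r f assume "r \<in> carrier K" "f \<in> carrier P"
  then have f: "Poly_Mapping.keys f \<subseteq> carrier L \<times> carrier K" by simp
  have "lin_extend coord (frag_extend (\<lambda>(x, a). frag_of (x, r \<otimes> a)) f) i mod m = r * lin_extend coord f i mod m" for i
    using f
  proof (induction f rule: frag_induction)
    case (one u)
    obtain x a where u: "u = (x, a)" by fastforce
    have "coord (x, r \<otimes> a) i mod m = (r * a) mod m * \<phi> x i mod m" by (simp add: coord_def res_mult_eq)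
    also have "\<dots> = r * a * \<phi> x i mod m" by (rule mod_mult_left_eq)
    finally show ?case by (simp add: u coord_def mult.assoc)
  next
    case (diff f g)
    then show ?case unfolding frag_extend_diff lin_extend_diff right_diff_distrib by (rule mod_diff_cong)
  qed simp
  then have "\<psi> (r \<odot>\<^bsub>P\<^esub> f) = red m n (\<lambda>i. r * lin_extend coord f i)"
    unfolding \<psi>_def pre_extend_scalars_simps by (intro red_eqI)
  then show "\<psi> (r \<odot>\<^bsub>P\<^esub> f) = r \<odot>\<^bsub>nilp m n\<^esub> \<psi> f" by (simp add: \<psi>_def)
qed (simp add: \<psi>_def)

lemma relators_P: "tensor_relators L K \<subseteq> carrier P"
proof -
  interpret L: nonassoc_algebra \<Z> L by (rule L)
  have d: "f - g \<in> carrier P" if "f \<in> carrier P" "g \<in> carrier P" for f g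
    using that keys_diff[of f g] by simp blast
  have o: "frag_of (x, a) \<in> carrier P" if "x \<in> carrier L" "a \<in> carrier K" for x a
    using that by (simp add: keys_frag_of)
  show ?thesis
  proof
    fix r assume "r \<in> tensor_relators L K"
    then show "r \<in> carrier P"
      unfolding tensor_relators_def
    proof (elim UnE CollectE exE conjE)
      fix x y a assume r: "r = frag_of (x \<oplus>\<^bsub>L\<^esub> y, a) - frag_of (x, a) - frag_of (y, a)"
        and xy: "x \<in> carrier L" "y \<in> carrier L" "a \<in> carrier K"
      show ?thesis unfolding r by (rule d[OF d[OF o o] o]) (use xy in auto)
    next
      fix x a b assume r: "r = frag_of (x, a \<oplus> b) - frag_of (x, a) - frag_of (x, b)"
        and xy: "x \<in> carrier L" "a \<in> carrier K" "b \<in> carrier K"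
      show ?thesis unfolding r by (rule d[OF d[OF o o] o]) (use xy in auto)
    qed
  qed
qed

lemma T_subgroup: "subgroup T (add_monoid P)"
proof -
  interpret P: nonassoc_algebra K P by (rule P)
  show ?thesis using P.add.generate_is_subgroup relators_P by (simp add: T_def)
qed

lemma T_closed:
  shows "0 \<in> T" "\<lbrakk>f \<in> T; g \<in> T\<rbrakk> \<Longrightarrow> f - g \<in> T" "\<lbrakk>f \<in> T; g \<in> T\<rbrakk> \<Longrightarrow> f + g \<in> T"
    "f \<in> T \<Longrightarrow> frag_cmul k f \<in> T" "tensor_relators L K \<subseteq> T"
proof -
  interpret P: nonassoc_algebra K P by (rule P)
  note sub = subgroup.one_closed[OF T_subgroup] subgroup.m_closed[OF T_subgroup]
    subgroup.m_inv_closed[OF T_subgroup] subgroup.subset[OF T_subgroup]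
  show 0: "0 \<in> T" using sub(1) by simp
  have neg: "- g \<in> T" if "g \<in> T" for g
  proof -
    have "T \<subseteq> carrier P" using sub(4) unfolding partial_object.select_convs .
    then have gP: "g \<in> carrier P" using that by blast
    have "inv\<^bsub>add_monoid P\<^esub> g = - g"
      unfolding a_inv_def[symmetric] using gP by (intro P.minus_equality) auto
    then show ?thesis using sub(3)[OF that] by (simp only:)
  qed
  show add: "f + g \<in> T" if "f \<in> T" "g \<in> T" for f g using sub(2)[OF that] by simp
  show diff: "f - g \<in> T" if "f \<in> T" "g \<in> T" for f g using add[OF that(1) neg[OF that(2)]] by simp
  show "frag_cmul k f \<in> T" if "f \<in> T" for f
    by (rule frag_closure_minus_cmul[of "\<lambda>f. f \<in> T"]) (use 0 diff that in auto)
  show "tensor_relators L K \<subseteq> T" unfolding T_def by (intro subsetI generate.incl)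
qed

lemma T_relator:
  assumes "x \<in> carrier L" "a \<in> carrier K"
  shows "y \<in> carrier L \<Longrightarrow> frag_of (x \<oplus>\<^bsub>L\<^esub> y, a) - frag_of (x, a) - frag_of (y, a) \<in> T"
    and "b \<in> carrier K \<Longrightarrow> frag_of (x, (a + b) mod m) - frag_of (x, a) - frag_of (x, b) \<in> T"
proof -
  show "frag_of (x \<oplus>\<^bsub>L\<^esub> y, a) - frag_of (x, a) - frag_of (y, a) \<in> T" if "y \<in> carrier L"
    by (rule subsetD[OF T_closed(5)], unfold tensor_relators_def, rule UnI1, rule CollectI)
      (rule exI[of _ x], rule exI[of _ y], rule exI[of _ a], simp only: assms that)
  show "frag_of (x, (a + b) mod m) - frag_of (x, a) - frag_of (x, b) \<in> T" if "b \<in> carrier K"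
    by (rule subsetD[OF T_closed(5)], unfold tensor_relators_def res_add_eq[symmetric], rule UnI2, rule CollectI)
      (rule exI[of _ x], rule exI[of _ a], rule exI[of _ b], simp only: assms that)
qed

lemma T_subset_kernel: "T \<subseteq> {f \<in> carrier P. \<psi> f = \<zero>\<^bsub>nilp m n\<^esub>}"
proof -
  interpret P: nonassoc_algebra K P by (rule P)
  let ?K = "{f \<in> carrier P. \<psi> f \<in> {\<zero>\<^bsub>nilp m n\<^esub>}}"
  have "alg_ideal K P ?K"
    by (rule alg_ideal_preimage[OF P \<psi>_epi alg_ideal_zero[OF nonassoc_algebra_nilp]])
  then have "subgroup ?K (add_monoid P)" by (simp add: alg_ideal_def submodule_def)
  moreover have "tensor_relators L K \<subseteq> ?K"
  proof
    fix r assume r: "r \<in> tensor_relators L K"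
    have "red m n (lin_extend coord r) = red m n (\<lambda>_. 0)"
    proof (rule red_eqI)
      fix i assume i: "i < n"
      show "lin_extend coord r i mod m = 0 mod m"
        using r unfolding tensor_relators_def
      proof (elim UnE CollectE exE conjE)
        fix x y a assume r: "r = frag_of (x \<oplus>\<^bsub>L\<^esub> y, a) - frag_of (x, a) - frag_of (y, a)"
          and xy: "x \<in> carrier L" "y \<in> carrier L"
        have "\<phi> (x \<oplus>\<^bsub>L\<^esub> y) i = \<phi> x i + \<phi> y i"
          using alg_epiD(4)[OF \<phi> xy] i by (simp add: red_def)
        then show ?thesis by (simp add: r lin_extend_diff lin_extend_add coord_def algebra_simps)
      next
        fix x a b assume r: "r = frag_of (x, a \<oplus> b) - frag_of (x, a) - frag_of (x, b)"
        have "lin_extend coord r i = ((a + b) mod m - (a + b)) * \<phi> x i"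
          by (simp add: r lin_extend_diff lin_extend_add coord_def res_add_eq algebra_simps)
        also have "\<dots> mod m = ((a + b) mod m - (a + b)) mod m * \<phi> x i mod m"
          by (simp only: mod_mult_left_eq)
        also have "((a + b) mod m - (a + b)) mod m = 0" by (simp add: mod_diff_left_eq)
        finally show ?thesis by simp
      qed
    qed
    then show "r \<in> ?K" using r relators_P by (auto simp: \<psi>_def simp del: pre_extend_scalars_simps(1))
  qed
  ultimately have "T \<subseteq> ?K" unfolding T_def by (intro P.add.generate_subgroup_incl)
  then show ?thesis by simp
qed

definition gen :: "nat \<Rightarrow> 'a \<times> int \<Rightarrow>\<^sub>0 int" where
  "gen i = frag_of (h (unit_vec i), 1)"

lemma T_scale:
  assumes x: "x \<in> carrier L" and a: "int a < m"
  shows "frag_of (x, int a) - frag_cmul (int a) (frag_of (x, 1)) \<in> T"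
  using a
proof (induction a)
  case 0
  have "frag_of (x, (0 + 0) mod m) - frag_of (x, 0) - frag_of (x, 0) \<in> T"
    using T_relator(2)[OF x zero_closed zero_closed] by (simp add: res_zero_eq)
  then have "frag_cmul (-1) (- frag_of (x, 0)) \<in> T" by (intro T_closed(4)) simp
  then show ?case by simp
next
  case (Suc a)
  have K: "int a \<in> carrier K" "1 \<in> carrier K"
    using Suc.prems one_closed by (simp_all add: res_carrier_eq res_one_eq)
  have "frag_of (x, (int a + 1) mod m) - frag_of (x, int a) - frag_of (x, 1) \<in> T"
    by (rule T_relator(2)[OF x K])
  moreover have "frag_of (x, int a) - frag_cmul (int a) (frag_of (x, 1)) \<in> T"
    using Suc by simp
  ultimately have "(frag_of (x, (int a + 1) mod m) - frag_of (x, int a) - frag_of (x, 1)) +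
      (frag_of (x, int a) - frag_cmul (int a) (frag_of (x, 1))) \<in> T"
    by (rule T_closed(3))
  moreover have "(int a + 1) mod m = int (Suc a)" using Suc.prems by simp
  ultimately show ?case by (simp add: frag_cmul_distrib algebra_simps)
qed

lemma T_multiple:
  assumes x: "x \<in> carrier L"
  shows "frag_cmul m (frag_of (x, 1)) \<in> T"
proof -
  have m: "int (nat (m - 1)) = m - 1" using m_gt_one by simp
  have K: "m - 1 \<in> carrier K" "1 \<in> carrier K"
    using m_gt_one by (simp_all add: res_carrier_eq)
  have "frag_of (x, (m - 1 + 1) mod m) - frag_of (x, m - 1) - frag_of (x, 1) \<in> T"
    by (rule T_relator(2)[OF x K])
  then have 1: "frag_of (x, 0) - frag_of (x, m - 1) - frag_of (x, 1) \<in> T" by simp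
  have 2: "frag_of (x, m - 1) - frag_cmul (m - 1) (frag_of (x, 1)) \<in> T"
    using T_scale[OF x, of "nat (m - 1)"] m by simp
  have 3: "frag_of (x, 0) \<in> T" using T_scale[OF x, of 0] m_gt_one by simp
  have "frag_of (x, 0) - ((frag_of (x, 0) - frag_of (x, m - 1) - frag_of (x, 1)) +
      (frag_of (x, m - 1) - frag_cmul (m - 1) (frag_of (x, 1)))) \<in> T"
    by (rule T_closed(2)[OF 3 T_closed(3)[OF 1 2]])
  then show ?thesis by (simp add: frag_cmul_diff_distrib algebra_simps)
qed

lemma T_additive:
  assumes c: "c \<in> carrier (nilp 0 n)" and d: "d \<in> carrier (nilp 0 n)"
  shows "frag_of (h (\<lambda>i. c i + d i), 1) - frag_of (h c, 1) - frag_of (h d, 1) \<in> T"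
proof -
  have "red 0 n (\<lambda>i. c i + d i) = (\<lambda>i. red 0 n c i + red 0 n d i)" by (auto simp: red_def)
  then have "h (\<lambda>i. c i + d i) = h c \<oplus>\<^bsub>L\<^esub> h d"
    using alg_epiD(4)[OF h c d] c d by simp
  then show ?thesis
    using T_relator(1)[OF alg_epiD(3)[OF h c] _ alg_epiD(3)[OF h d], of 1] one_closed by (simp add: res_one_eq)
qed

lemma nilp_0_carrier: "c \<in> carrier (nilp 0 n) \<longleftrightarrow> (\<forall>i\<ge>n. c i = 0)"
  by (auto simp: red_def fun_eq_iff)

lemma T_unit:
  assumes "i < n"
  shows "frag_of (h (\<lambda>j. k * unit_vec i j), 1) - frag_cmul k (gen i) \<in> T"
proof -
  let ?g = "\<lambda>k. frag_of (h (\<lambda>j. k * unit_vec i j), 1 :: int)"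
  have c: "(\<lambda>j. k * unit_vec i j) \<in> carrier (nilp 0 n)" for k
    using assms by (simp add: nilp_0_carrier unit_vec_def del: nilp_simps(1))
  have add: "?g (k + l) - ?g k - ?g l \<in> T" for k l
    using T_additive[OF c[of k] c[of l]] by (simp add: distrib_right)
  show ?thesis
  proof (induction k rule: int_induct[of _ 0])
    case base
    have "frag_cmul (-1) (?g (0 + 0) - ?g 0 - ?g 0) \<in> T" by (rule T_closed(4)[OF add])
    then show ?case by simp
  next
    case (step1 k)
    have "(?g (k + 1) - ?g k - ?g 1) + (?g k - frag_cmul k (gen i)) \<in> T"
      by (rule T_closed(3)[OF add step1(2)])
    then show ?case by (simp add: gen_def frag_cmul_distrib algebra_simps)
  next
    case (step2 k)
    have "(?g k - frag_cmul k (gen i)) - (?g (k - 1 + 1) - ?g (k - 1) - ?g 1) \<in> T"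
      by (rule T_closed(2)[OF step2(2) add])
    then show ?case by (simp add: gen_def frag_cmul_diff_distrib algebra_simps)
  qed
qed

lemma T_coordinates:
  assumes "c \<in> carrier (nilp 0 n)"
  shows "frag_of (h c, 1) - (\<Sum>i<n. frag_cmul (c i) (gen i)) \<in> T"
proof -
  have "frag_of (h (\<lambda>i. if i < j then c i else 0), 1) - (\<Sum>i<j. frag_cmul (c i) (gen i)) \<in> T" if "j \<le> n" for j
    using that
  proof (induction j)
    case 0
    have z: "(\<lambda>_. 0) \<in> carrier (nilp 0 n)" by simp
    have "frag_cmul (-1) (frag_of (h (\<lambda>i. 0 + 0), 1) - frag_of (h (\<lambda>_. 0), 1) - frag_of (h (\<lambda>_. 0), 1)) \<in> T"
      by (rule T_closed(4)[OF T_additive[OF z z]])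
    then show ?case by simp
  next
    case (Suc j)
    let ?c = "\<lambda>j i. if i < j then c i else 0"
    let ?d = "\<lambda>i. c j * unit_vec j i"
    have "?c j \<in> carrier (nilp 0 n)" "?d \<in> carrier (nilp 0 n)"
      using Suc.prems by (auto simp: nilp_0_carrier unit_vec_def simp del: nilp_simps(1))
    note 1 = T_additive[OF this]
    have 2: "(\<lambda>i. ?c j i + ?d i) = ?c (Suc j)" by (auto simp: fun_eq_iff unit_vec_def less_Suc_eq)
    have 3: "frag_of (h (?c j), 1) - (\<Sum>i<j. frag_cmul (c i) (gen i)) \<in> T" using Suc by simp
    have 4: "frag_of (h ?d, 1) - frag_cmul (c j) (gen j) \<in> T" using T_unit Suc.prems by simp
    have "(frag_of (h (?c (Suc j)), 1) - frag_of (h (?c j), 1) - frag_of (h ?d, 1)) +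
        (frag_of (h (?c j), 1) - (\<Sum>i<j. frag_cmul (c i) (gen i))) +
        (frag_of (h ?d, 1) - frag_cmul (c j) (gen j)) \<in> T"
      by (rule T_closed(3)[OF T_closed(3)[OF 1[unfolded 2] 3] 4])
    then show ?case by (simp add: algebra_simps)
  qed
  from this[of n] have "frag_of (h (\<lambda>i. if i < n then c i else 0), 1) - (\<Sum>i<n. frag_cmul (c i) (gen i)) \<in> T"
    by simp
  moreover have "(\<lambda>i. if i < n then c i else 0) = c"
    using assms unfolding nilp_0_carrier by (auto simp: fun_eq_iff)
  ultimately show ?thesis by simp
qed

lemma T_span:
  assumes f: "f \<in> carrier P"
  shows "\<exists>k. f - (\<Sum>i<n. frag_cmul (k i) (gen i)) \<in> T"
proof -
  have "Poly_Mapping.keys f \<subseteq> carrier L \<times> carrier K" using f by simp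
  then show ?thesis
  proof (induction f rule: frag_induction)
    case zero
    show ?case using T_closed(1) by (intro exI[of _ "\<lambda>_. 0"]) simp
  next
    case (one u)
    then obtain x a where u: "u = (x, a)" "x \<in> carrier L" "a \<in> carrier K" by auto
    then have a: "0 \<le> a" "a < m" by (auto simp: res_carrier_eq)
    have "frag_of (x, a) - frag_cmul a (frag_of (x, 1)) \<in> T"
      using T_scale[OF u(2), of "nat a"] a by simp
    moreover have "frag_cmul a (frag_of (h (\<phi> x), 1) - (\<Sum>i<n. frag_cmul (\<phi> x i) (gen i))) \<in> T"
      by (rule T_closed(4)[OF T_coordinates[OF alg_epiD(3)[OF \<phi> u(2)]]])
    ultimately have "(frag_of (x, a) - frag_cmul a (frag_of (x, 1))) +
        frag_cmul a (frag_of (x, 1) - (\<Sum>i<n. frag_cmul (\<phi> x i) (gen i))) \<in> T"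
      unfolding h_\<phi>[OF u(2)] by (rule T_closed(3))
    moreover have "frag_cmul a (frag_of (x, 1) - F) = frag_cmul a (frag_of (x, 1)) - frag_cmul a F"
      for F :: "'a \<times> int \<Rightarrow>\<^sub>0 int"
      using frag_cmul_distrib2[of a "frag_of (x, 1) - F" F] by (simp add: algebra_simps)
    ultimately have "frag_of u - (\<Sum>i<n. frag_cmul (a * \<phi> x i) (gen i)) \<in> T"
      by (simp add: u frag_cmul_sum)
    then show ?case by (rule exI[of _ "\<lambda>i. a * \<phi> x i"])
  next
    case (diff f g)
    then obtain k l where kl: "f - (\<Sum>i<n. frag_cmul (k i) (gen i)) \<in> T" "g - (\<Sum>i<n. frag_cmul (l i) (gen i)) \<in> T"
      by blast
    have "f - g - (\<Sum>i<n. frag_cmul (k i - l i) (gen i)) =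
        (f - (\<Sum>i<n. frag_cmul (k i) (gen i))) - (g - (\<Sum>i<n. frag_cmul (l i) (gen i)))"
      by (simp add: frag_cmul_diff_distrib sum_subtractf)
    then show ?case using T_closed(2)[OF kl] by (intro exI[of _ "\<lambda>i. k i - l i"]) (simp only:)
  qed
qed

lemma T_eq_kernel: "T = {f \<in> carrier P. \<psi> f = \<zero>\<^bsub>nilp m n\<^esub>}"
proof (rule equalityI[OF T_subset_kernel], clarify)
  fix f assume f: "f \<in> carrier P" "\<psi> f = \<zero>\<^bsub>nilp m n\<^esub>"
  obtain k where k: "f - (\<Sum>i<n. frag_cmul (k i) (gen i)) \<in> T" using T_span[OF f(1)] by blast
  have unit: "unit_vec i \<in> carrier (nilp 0 n)" if "i < n" for i
    using that by (simp add: nilp_0_carrier unit_vec_def del: nilp_simps(1))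
  have "lin_extend coord (\<Sum>i<n. frag_cmul (k i) (gen i)) j = (\<Sum>i<n. k i * unit_vec i j)" for j
    unfolding gen_def using \<phi>_h[OF unit] by (simp add: lin_extend_sum lin_extend_cmul coord_def)
  also have "(\<Sum>i<n. k i * unit_vec i j) = (if j < n then k j else 0)" for j
    by (simp add: unit_vec_def if_distrib cong: if_cong)
  finally have sum: "lin_extend coord (\<Sum>i<n. frag_cmul (k i) (gen i)) j = (if j < n then k j else 0)" for j .
  have "\<psi> (f - (\<Sum>i<n. frag_cmul (k i) (gen i))) = (\<lambda>_. 0)"
    using k T_subset_kernel by auto
  then have "(lin_extend coord f j - k j) mod m = 0" if "j < n" for j
    using that by (auto simp: \<psi>_def lin_extend_diff sum red_def dest!: fun_cong[of _ _ j])
  moreover have "lin_extend coord f j mod m = 0" if "j < n" for j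
    using f(2) that by (auto simp: \<psi>_def red_def dest!: fun_cong[of _ _ j])
  ultimately have dvd: "m dvd k j" if "j < n" for j
    using that by (metis dvd_diff_right_iff mod_0_imp_dvd)
  have "frag_cmul (k i) (gen i) \<in> T" if i: "i < n" for i
  proof -
    obtain l where l: "k i = l * m" using dvd[OF i] by (metis dvd_def mult.commute)
    have "frag_cmul l (frag_cmul m (gen i)) \<in> T"
      unfolding gen_def by (intro T_closed(4) T_multiple alg_epiD(3)[OF h unit[OF i]])
    then show ?thesis by (simp add: l)
  qed
  moreover have sumT: "sum F S \<in> T" if "\<And>s. s \<in> S \<Longrightarrow> F s \<in> T" for F and S :: "nat set"
    using that by (induction S rule: infinite_finite_induct) (auto intro: T_closed(1,3))
  ultimately have "(\<Sum>i<n. frag_cmul (k i) (gen i)) \<in> T" by (intro sumT) simp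
  from T_closed(3)[OF k this] show "f \<in> T" by simp
qed

lemma extend_scalars_iso:
  obtains g where "alg_epi K (nilp m n) (extend_scalars L K) g"
    "\<And>c. \<lbrakk>c \<in> carrier (nilp m n); g c = \<zero>\<^bsub>extend_scalars L K\<^esub>\<rbrakk> \<Longrightarrow> c = \<zero>\<^bsub>nilp m n\<^esub>"
proof -
  interpret P: nonassoc_algebra K P by (rule P)
  have "alg_ideal K P {f \<in> carrier P. \<psi> f \<in> {\<zero>\<^bsub>nilp m n\<^esub>}}"
    by (rule alg_ideal_preimage[OF P \<psi>_epi alg_ideal_zero[OF nonassoc_algebra_nilp]])
  then have T: "alg_ideal K P T" unfolding T_eq_kernel by simp
  have E: "extend_scalars L K = P aQuot T" by (simp add: extend_scalars_def Let_def T_def)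
  note epi = alg_quot_epi[OF P T, folded E]
  have zero: "T +>\<^bsub>P\<^esub> f = \<zero>\<^bsub>extend_scalars L K\<^esub> \<longleftrightarrow> \<psi> f = \<zero>\<^bsub>nilp m n\<^esub>" if f: "f \<in> carrier P" for f
    using alg_quot_zero_iff[OF P.abelian_group_axioms T[unfolded alg_ideal_def, THEN conjunct1] f, folded E] f
    unfolding T_eq_kernel by blast
  obtain g where g: "alg_epi K (nilp m n) (extend_scalars L K) g" "\<And>f. f \<in> carrier P \<Longrightarrow> g (\<psi> f) = T +>\<^bsub>P\<^esub> f"
    using alg_epi_factor[OF P.abelian_group_axioms \<psi>_epi epi P.mult_closed P.scale_closed] zero by blast
  moreover have "c = \<zero>\<^bsub>nilp m n\<^esub>" if c: "c \<in> carrier (nilp m n)" "g c = \<zero>\<^bsub>extend_scalars L K\<^esub>" for c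
  proof -
    obtain f where f: "f \<in> carrier P" "c = \<psi> f"
      using c(1) unfolding alg_epiD(1)[OF \<psi>_epi, symmetric] by blast
    then show ?thesis using g(2) zero c(2) by simp
  qed
  ultimately show ?thesis using that by blast
qed

end

subsection \<open>Subspaces over a prime field\<close>

locale nilp_mod =
  fixes p :: int and n :: nat
  assumes prime_p: "Factorial_Ring.prime p"
begin

abbreviation "K \<equiv> residue_ring p"
abbreviation "N \<equiv> nilp p n"

definition subsp :: "(nat \<Rightarrow> int) set \<Rightarrow> bool" where
  "subsp W \<longleftrightarrow> submodule W K N"

definition tail :: "nat \<Rightarrow> (nat \<Rightarrow> int) set" where
  "tail k = {f \<in> carrier N. \<forall>i<k. f i = 0}"

lemma p_gt_1: "1 < p"
  using prime_p by (rule prime_gt_1_int)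

lemma p_pos: "0 < p"
  using p_gt_1 by simp

sublocale residues p K
  by unfold_locales (simp_all add: p_gt_1)

lemma inverse_mod:
  assumes "\<not> p dvd a"
  obtains b where "(b * a) mod p = 1"
proof -
  have "coprime a p" using prime_imp_coprime[OF prime_p assms] by (simp add: coprime_commute)
  then obtain b where "[a * b = 1] (mod p)" using cong_solve_coprime_int by blast
  then have "(b * a) mod p = 1" using p_gt_1 by (simp add: cong_def mult.commute)
  then show ?thesis using that by blast
qed

lemma scale_mod: "red p n (\<lambda>i. (k mod p) * f i) = red p n (\<lambda>i. k * f i)"
  by (rule red_eqI) (rule mod_mult_left_eq)

lemma subsp_iff:
  "subsp W \<longleftrightarrow> (\<forall>f\<in>W. red p n f = f) \<and> (\<lambda>_. 0) \<in> W \<and>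
    (\<forall>f\<in>W. \<forall>g\<in>W. red p n (\<lambda>i. f i + g i) \<in> W) \<and> (\<forall>k. \<forall>f\<in>W. red p n (\<lambda>i. k * f i) \<in> W)"
    (is "_ \<longleftrightarrow> ?R")
proof -
  interpret N: nonassoc_algebra K N by (rule nonassoc_algebra_nilp)
  have minus: "\<ominus>\<^bsub>N\<^esub> f = red p n (\<lambda>i. - 1 * f i)" if "red p n f = f" for f
    using that by (intro N.minus_equality) auto
  show ?thesis
  proof
    assume "subsp W"
    note W = this[unfolded subsp_def submodule_iff[OF N.abelian_group_axioms]]
    have "red p n (\<lambda>i. k * f i) \<in> W" if "f \<in> W" for k f
    proof -
      have "k mod p \<in> carrier K" using p_pos by (simp add: residue_ring_def)
      then have "(k mod p) \<odot>\<^bsub>N\<^esub> f \<in> W" using W that by blast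
      then show ?thesis by (simp add: scale_mod)
    qed
    then show ?R using W by auto
  next
    assume R: ?R
    then have "\<ominus>\<^bsub>N\<^esub> f \<in> W" if "f \<in> W" for f
      using that minus[of f] by metis
    then show "subsp W"
      using R unfolding subsp_def submodule_iff[OF N.abelian_group_axioms] by auto
  qed
qed

lemma
  assumes "subsp W"
  shows subsp_carrier: "f \<in> W \<Longrightarrow> red p n f = f"
    and subsp_0: "red p n (\<lambda>_. 0) \<in> W"
    and subsp_add: "\<lbrakk>red p n f \<in> W; red p n g \<in> W\<rbrakk> \<Longrightarrow> red p n (\<lambda>i. f i + g i) \<in> W"
    and subsp_scale: "red p n f \<in> W \<Longrightarrow> red p n (\<lambda>i. k * f i) \<in> W"
    and subsp_diff: "\<lbrakk>red p n f \<in> W; red p n g \<in> W\<rbrakk> \<Longrightarrow> red p n (\<lambda>i. f i - g i) \<in> W"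
proof -
  note W = assms[unfolded subsp_iff]
  show "f \<in> W \<Longrightarrow> red p n f = f" "red p n (\<lambda>_. 0) \<in> W" using W by auto
  show add: "red p n (\<lambda>i. f i + g i) \<in> W" if "red p n f \<in> W" "red p n g \<in> W" for f g
    using W that by (metis red_simps(2,3))
  show scale: "red p n (\<lambda>i. k * f i) \<in> W" if "red p n f \<in> W" for k f
    using W that by (metis red_simps(4))
  show "red p n (\<lambda>i. f i - g i) \<in> W" if "red p n f \<in> W" "red p n g \<in> W"
    using add[OF that(1) scale[OF that(2), of "-1"]] by simp
qed

lemma subspI:
  assumes "\<And>f. f \<in> W \<Longrightarrow> red p n f = f" "(\<lambda>_. 0) \<in> W"
    and "\<And>f g. \<lbrakk>f \<in> W; g \<in> W\<rbrakk> \<Longrightarrow> red p n (\<lambda>i. f i + g i) \<in> W"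
    and "\<And>k f. f \<in> W \<Longrightarrow> red p n (\<lambda>i. k * f i) \<in> W"
  shows "subsp W"
  using assms by (simp add: subsp_iff)

lemma subsp_cong:
  assumes "red p n f \<in> W" "\<And>i. i < n \<Longrightarrow> g i mod p = f i mod p"
  shows "red p n g \<in> W"
proof -
  have "red p n g = red p n f" using assms(2) by (rule red_eqI)
  then show ?thesis using assms(1) by (simp only:)
qed

lemma finite_carrier_N: "finite (carrier N)"
  using p_pos by (rule finite_nilp)

lemma tail_subset: "tail k \<subseteq> carrier N" "j \<le> k \<Longrightarrow> tail k \<subseteq> tail j"
  by (auto simp: tail_def)

lemma finite_tail: "finite (tail k)"
  using tail_subset(1) finite_carrier_N by (rule finite_subset)

lemma card_tail: "card (tail k) = nat p ^ (n - k)"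
  unfolding tail_def by (rule card_nilp_tail[OF p_pos])

lemma tail_iff: "f \<in> tail k \<longleftrightarrow> red p n f = f \<and> (\<forall>i<k. f i = 0)"
  by (simp add: tail_def)

lemma tail_red: "red p n f \<in> tail k \<longleftrightarrow> (\<forall>i<k. i < n \<longrightarrow> p dvd f i)"
  by (auto simp: tail_def red_def dvd_eq_mod_eq_0)

lemma subsp_tail: "subsp (tail k)"
  by (rule subspI) (auto simp: tail_def red_def)

lemma carrier_bounds: "red p n f = f \<Longrightarrow> 0 \<le> f i \<and> f i < p"
  using nilp_carrier_iff[OF p_pos, of f n] p_pos by (cases "i < n") auto

lemma carrier_mod: "red p n f = f \<Longrightarrow> f i mod p = f i"
  using carrier_bounds[of f i] by simp

lemma carrier_eqI:
  assumes "red p n f = f" "red p n g = g" "\<And>i. i < n \<Longrightarrow> f i mod p = g i mod p"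
  shows "f = g"
proof -
  have "red p n f = red p n g" using assms(3) by (rule red_eqI)
  then show ?thesis unfolding assms(1,2) .
qed

definition extend_subsp :: "nat \<Rightarrow> (nat \<Rightarrow> int) set \<Rightarrow> (nat \<Rightarrow> int) \<Rightarrow> (nat \<Rightarrow> int) set" where
  "extend_subsp k W v = {f \<in> tail k. red p n (\<lambda>i. f i - f k * v i) \<in> W}"

lemma subsp_extend:
  assumes W: "subsp W"
  shows "subsp (extend_subsp k W v)"
proof (rule subspI)
  fix f g assume "f \<in> extend_subsp k W v" "g \<in> extend_subsp k W v"
  then have fg: "f \<in> tail k" "red p n (\<lambda>i. f i - f k * v i) \<in> W"
      "g \<in> tail k" "red p n (\<lambda>i. g i - g k * v i) \<in> W"
    by (auto simp: extend_subsp_def)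
  have t: "red p n (\<lambda>i. f i + g i) \<in> tail k" using fg(1,3) by (auto simp: tail_def red_def)
  have k: "red p n (\<lambda>i. f i + g i) k mod p = (f k + g k) mod p"
    using fg(1,3) by (auto simp: tail_iff red_def dest!: fun_cong[of _ _ k])
  have "red p n (\<lambda>i. (f i - f k * v i) + (g i - g k * v i)) \<in> W"
    using fg(2,4) by (rule subsp_add[OF W])
  then have "red p n (\<lambda>i. red p n (\<lambda>i. f i + g i) i - red p n (\<lambda>i. f i + g i) k * v i) \<in> W"
  proof (rule subsp_cong)
    fix i assume i: "i < n"
    have "(red p n (\<lambda>i. f i + g i) i - red p n (\<lambda>i. f i + g i) k * v i) mod p =
        (f i + g i - (f k + g k) * v i) mod p"
      using i k by (intro mod_diff_cong mod_mult_cong) (auto simp: red_def)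
    then show "(red p n (\<lambda>i. f i + g i) i - red p n (\<lambda>i. f i + g i) k * v i) mod p =
        (f i - f k * v i + (g i - g k * v i)) mod p"
      by (simp add: algebra_simps)
  qed
  with t show "red p n (\<lambda>i. f i + g i) \<in> extend_subsp k W v" by (simp add: extend_subsp_def)
next
  fix c f assume "f \<in> extend_subsp k W v"
  then have f: "f \<in> tail k" "red p n (\<lambda>i. f i - f k * v i) \<in> W" by (auto simp: extend_subsp_def)
  have t: "red p n (\<lambda>i. c * f i) \<in> tail k" using f(1) by (auto simp: tail_def red_def)
  have k: "red p n (\<lambda>i. c * f i) k mod p = (c * f k) mod p"
    using f(1) by (auto simp: tail_iff red_def dest!: fun_cong[of _ _ k])
  have "red p n (\<lambda>i. c * (f i - f k * v i)) \<in> W"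
    using f(2) by (rule subsp_scale[OF W])
  then have "red p n (\<lambda>i. red p n (\<lambda>i. c * f i) i - red p n (\<lambda>i. c * f i) k * v i) \<in> W"
  proof (rule subsp_cong)
    fix i assume i: "i < n"
    have "(red p n (\<lambda>i. c * f i) i - red p n (\<lambda>i. c * f i) k * v i) mod p = (c * f i - c * f k * v i) mod p"
      using i k by (intro mod_diff_cong mod_mult_cong) (auto simp: red_def)
    then show "(red p n (\<lambda>i. c * f i) i - red p n (\<lambda>i. c * f i) k * v i) mod p = c * (f i - f k * v i) mod p"
      by (simp add: algebra_simps)
  qed
  with t show "red p n (\<lambda>i. c * f i) \<in> extend_subsp k W v" by (simp add: extend_subsp_def)
qed (use subsp_0[OF W] in \<open>auto simp: extend_subsp_def tail_def\<close>)

lemma extend_subsp_props: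
  assumes W: "subsp W" "W \<subseteq> tail (Suc k)" and k: "k < n" and v: "v \<in> tail k" "v k = 1"
  shows "extend_subsp k W v \<subseteq> tail k" "v \<in> extend_subsp k W v"
    "extend_subsp k W v \<inter> tail (Suc k) = W" "card (extend_subsp k W v) = nat p * card W"
proof -
  show "extend_subsp k W v \<subseteq> tail k" by (auto simp: extend_subsp_def)
  show "v \<in> extend_subsp k W v" using v subsp_0[OF W(1)] by (simp add: extend_subsp_def)
  have Wc: "red p n w = w" if "w \<in> W" for w using that subsp_carrier[OF W(1)] by blast
  have Wk: "w \<in> tail k" "w k = 0" if "w \<in> W" for w using that W(2) by (auto simp: tail_def)
  show "extend_subsp k W v \<inter> tail (Suc k) = W"
  proof (intro equalityI subsetI)
    fix f assume "f \<in> extend_subsp k W v \<inter> tail (Suc k)"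
    then have "red p n (\<lambda>i. f i - f k * v i) \<in> W" "f k = 0" "red p n f = f"
      by (auto simp: extend_subsp_def tail_iff)
    then show "f \<in> W" by simp
  next
    fix w assume w: "w \<in> W"
    then show "w \<in> extend_subsp k W v \<inter> tail (Suc k)"
      using W(2) Wc[OF w] Wk[OF w] by (auto simp: extend_subsp_def)
  qed
  have "bij_betw (\<lambda>(c, w). red p n (\<lambda>i. c * v i + w i)) ({0..<p} \<times> W) (extend_subsp k W v)"
  proof (rule bij_betwI[where g = "\<lambda>f. (f k, red p n (\<lambda>i. f i - f k * v i))"])
    have ck: "red p n (\<lambda>i. c * v i + w i) k = c" if "0 \<le> c" "c < p" "w \<in> W" for c w
      using that k v Wk(2)[OF that(3)] by (simp add: red_def)
    have inv: "red p n (\<lambda>i. red p n (\<lambda>i. c * v i + w i) i - c * v i) = w" if "w \<in> W" for c w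
    proof -
      have "red p n (\<lambda>i. red p n (\<lambda>i. c * v i + w i) i - c * v i) = red p n w"
      proof (rule red_eqI)
        fix i assume "i < n"
        then have "(red p n (\<lambda>i. c * v i + w i) i - c * v i) mod p = (c * v i + w i - c * v i) mod p"
          by (simp add: red_def mod_diff_left_eq)
        then show "(red p n (\<lambda>i. c * v i + w i) i - c * v i) mod p = w i mod p" by simp
      qed
      then show ?thesis using Wc[OF that] by simp
    qed
    show "(\<lambda>(c, w). red p n (\<lambda>i. c * v i + w i)) \<in> {0..<p} \<times> W \<rightarrow> extend_subsp k W v"
    proof clarsimp
      fix c w assume c: "0 \<le> c" "c < p" and w: "w \<in> W"
      have "red p n (\<lambda>i. c * v i + w i) \<in> tail k"
        using v Wk[OF w] by (auto simp: tail_def red_def)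
      then show "red p n (\<lambda>i. c * v i + w i) \<in> extend_subsp k W v"
        using w by (simp add: extend_subsp_def ck[OF c w] inv[OF w])
    qed
    show "(\<lambda>f. (f k, red p n (\<lambda>i. f i - f k * v i))) \<in> extend_subsp k W v \<rightarrow> {0..<p} \<times> W"
      using carrier_bounds by (auto simp: extend_subsp_def tail_iff)
    show "(\<lambda>f. (f k, red p n (\<lambda>i. f i - f k * v i))) ((\<lambda>(c, w). red p n (\<lambda>i. c * v i + w i)) x) = x"
      if "x \<in> {0..<p} \<times> W" for x
      using that ck inv by auto
    show "(\<lambda>(c, w). red p n (\<lambda>i. c * v i + w i)) (f k, red p n (\<lambda>i. f i - f k * v i)) = f"
      if "f \<in> extend_subsp k W v" for f
      using that by (auto simp: extend_subsp_def tail_iff)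
  qed
  from bij_betw_same_card[OF this] show "card (extend_subsp k W v) = nat p * card W"
    by (simp add: card_cartesian_product)
qed

lemma extend_subsp_eq:
  assumes W: "subsp W" "W \<subseteq> tail k" and k: "k < n" and v: "v \<in> W" "v k = 1"
  shows "extend_subsp k (W \<inter> tail (Suc k)) v = W"
proof (intro equalityI subsetI)
  have vt: "red p n v \<in> W" using v(1) subsp_carrier[OF W(1)] by simp
  fix f
  {
    assume "f \<in> extend_subsp k (W \<inter> tail (Suc k)) v"
    then have f: "red p n f = f" "red p n (\<lambda>i. f i - f k * v i) \<in> W"
      by (auto simp: extend_subsp_def tail_iff)
    have "red p n (\<lambda>i. (f i - f k * v i) + f k * v i) \<in> W"
      by (rule subsp_add[OF W(1) f(2) subsp_scale[OF W(1) vt]])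
    then show "f \<in> W" using f(1) by simp
  }
  assume f: "f \<in> W"
  then have ft: "f \<in> tail k" "red p n f \<in> W" using W(2) subsp_carrier[OF W(1)] by auto
  have "red p n (\<lambda>i. f i - f k * v i) \<in> W"
    by (rule subsp_diff[OF W(1) ft(2) subsp_scale[OF W(1) vt]])
  moreover have "red p n (\<lambda>i. f i - f k * v i) \<in> tail (Suc k)"
    using ft(1) v W(2) unfolding tail_red by (auto simp: tail_iff less_Suc_eq)
  ultimately show "f \<in> extend_subsp k (W \<inter> tail (Suc k)) v" using ft(1) by (simp add: extend_subsp_def)
qed

lemma subsp_normalize:
  assumes W: "subsp W" and f: "red p n f \<in> W" "\<not> p dvd f k" and k: "k < n"
  obtains c where "red p n (\<lambda>i. c * f i) \<in> W" "red p n (\<lambda>i. c * f i) k = 1"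
proof -
  obtain c where c: "(c * f k) mod p = 1" using inverse_mod[OF f(2)] by blast
  show ?thesis using that[of c] subsp_scale[OF W f(1)] c k by (simp add: red_def)
qed

lemma card_normalized:
  assumes W: "subsp W" "W \<subseteq> tail k" and k: "k < n" and v: "v \<in> W" "v k = 1"
  shows "card {u \<in> W. u k = 1} = card (W \<inter> tail (Suc k))"
proof -
  have vt: "v \<in> tail k" using v(1) W(2) by blast
  have vr: "red p n v \<in> W" using v(1) subsp_carrier[OF W(1)] by simp
  have "bij_betw (\<lambda>w. red p n (\<lambda>i. w i + v i)) (W \<inter> tail (Suc k)) {u \<in> W. u k = 1}"
  proof (rule bij_betwI[where g = "\<lambda>u. red p n (\<lambda>i. u i - v i)"])
    show "(\<lambda>w. red p n (\<lambda>i. w i + v i)) \<in> W \<inter> tail (Suc k) \<rightarrow> {u \<in> W. u k = 1}"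
    proof clarsimp
      fix w assume w: "w \<in> W" "w \<in> tail (Suc k)"
      then have "red p n w \<in> W" using subsp_carrier[OF W(1)] by simp
      then have "red p n (\<lambda>i. w i + v i) \<in> W" using vr by (rule subsp_add[OF W(1)])
      then show "red p n (\<lambda>i. w i + v i) \<in> W \<and> red p n (\<lambda>i. w i + v i) k = 1"
        using w(2) v(2) k p_gt_1 by (simp add: tail_def red_def)
    qed
    show "(\<lambda>u. red p n (\<lambda>i. u i - v i)) \<in> {u \<in> W. u k = 1} \<rightarrow> W \<inter> tail (Suc k)"
    proof clarsimp
      fix u assume u: "u \<in> W" "u k = 1"
      then have "red p n u \<in> W" "u \<in> tail k" using subsp_carrier[OF W(1)] W(2) by auto
      then show "red p n (\<lambda>i. u i - v i) \<in> W \<and> red p n (\<lambda>i. u i - v i) \<in> tail (Suc k)"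
        using subsp_diff[OF W(1) _ vr] u(2) v(2) vt unfolding tail_red by (auto simp: tail_def less_Suc_eq)
    qed
    show "red p n (\<lambda>i. red p n (\<lambda>i. w i + v i) i - v i) = w" if "w \<in> W \<inter> tail (Suc k)" for w
    proof -
      have "red p n w = w" using that subsp_carrier[OF W(1)] by blast
      then show ?thesis using red_simps(2)[of p n "\<lambda>i. w i + v i" "\<lambda>i. - v i"] by simp
    qed
    show "red p n (\<lambda>i. red p n (\<lambda>i. u i - v i) i + v i) = u" if "u \<in> {u \<in> W. u k = 1}" for u
      using that subsp_carrier[OF W(1)] by auto
  qed
  from bij_betw_same_card[OF this] show ?thesis by simp
qed

definition subsp_count :: "nat \<Rightarrow> nat \<Rightarrow> nat" where
  "subsp_count k d = card {W. subsp W \<and> W \<subseteq> tail k \<and> card W = nat p ^ d}"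

text \<open>Double counting of pairs \<open>(W, v)\<close> with \<open>v \<in> W\<close> normalised at position \<open>k\<close>; this is the
  Pascal rule for Gaussian binomial coefficients.\<close>

lemma subsp_count_step:
  assumes k: "k < n"
  shows "subsp_count k (Suc d) = subsp_count (Suc k) (Suc d) + nat p ^ (n - Suc k - d) * subsp_count (Suc k) d"
proof -
  let ?q = "nat p"
  have q: "1 < ?q" using p_gt_1 by simp
  define X where "X = {W. subsp W \<and> W \<subseteq> tail k \<and> \<not> W \<subseteq> tail (Suc k) \<and> card W = ?q ^ Suc d}"
  define Y where "Y = {W. subsp W \<and> W \<subseteq> tail (Suc k) \<and> card W = ?q ^ d}"
  define V where "V = {v \<in> tail k. v k = 1}"
  define Z where "Z = (SIGMA W:X. {v \<in> W. v k = 1})"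
  have fin: "finite {W. W \<subseteq> tail k}" using finite_tail by simp
  have finX: "finite X" "finite Y"
    using fin finite_subset[of Y "{W. W \<subseteq> tail k}"] tail_subset(2)[of k "Suc k"]
    by (auto simp: X_def Y_def intro: finite_subset[OF _ fin])
  have e: "unit_vec k \<in> tail k" "unit_vec k k = 1"
    using k p_gt_1 by (auto simp: tail_def red_def unit_vec_def)
  have "card V = card (tail k \<inter> tail (Suc k))"
    unfolding V_def by (rule card_normalized[OF subsp_tail subset_refl k e])
  also have "tail k \<inter> tail (Suc k) = tail (Suc k)" using tail_subset(2)[of k "Suc k"] by auto
  finally have cardV: "card V = ?q ^ (n - Suc k)" by (simp add: card_tail)
  have bij: "bij_betw (\<lambda>(W, v). (extend_subsp k W v, v)) (Y \<times> V) Z"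
  proof (rule bij_betwI[where g = "\<lambda>(W, v). (W \<inter> tail (Suc k), v)"])
    show "(\<lambda>(W, v). (extend_subsp k W v, v)) \<in> Y \<times> V \<rightarrow> Z"
    proof clarsimp
      fix W v assume W: "W \<in> Y" and v: "v \<in> V"
      then have W': "subsp W" "W \<subseteq> tail (Suc k)" and v': "v \<in> tail k" "v k = 1"
        by (auto simp: Y_def V_def)
      note e = extend_subsp_props[OF W' k v']
      have "\<not> extend_subsp k W v \<subseteq> tail (Suc k)" using e(2) v'(2) by (auto simp: tail_def)
      moreover have "card (extend_subsp k W v) = ?q ^ Suc d" using e(4) W by (simp add: Y_def)
      ultimately show "(extend_subsp k W v, v) \<in> Z"
        using e(1,2) subsp_extend[OF W'(1)] v'(2) by (simp add: Z_def X_def)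
    qed
    show "(\<lambda>(W, v). (W \<inter> tail (Suc k), v)) \<in> Z \<rightarrow> Y \<times> V"
    proof clarsimp
      fix W v assume "(W, v) \<in> Z"
      then have W: "subsp W" "W \<subseteq> tail k" "card W = ?q ^ Suc d" and v: "v \<in> W" "v k = 1"
        by (auto simp: Z_def X_def)
      have vt: "v \<in> tail k" using v W by auto
      have s: "subsp (W \<inter> tail (Suc k))"
        using W(1) subsp_tail[of "Suc k"] by (auto simp: subsp_iff)
      have "card W = ?q * card (W \<inter> tail (Suc k))"
        using extend_subsp_props(4)[OF s _ k vt v(2)] extend_subsp_eq[OF W(1,2) k v] by simp
      then show "W \<inter> tail (Suc k) \<in> Y \<and> v \<in> V"
        using s W(3) vt v q by (simp add: Y_def V_def)
    qed
    show "(\<lambda>(W, v). (W \<inter> tail (Suc k), v)) ((\<lambda>(W, v). (extend_subsp k W v, v)) x) = x"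
      if "x \<in> Y \<times> V" for x
      using that extend_subsp_props(3)[OF _ _ k] by (auto simp: Y_def V_def)
    show "(\<lambda>(W, v). (extend_subsp k W v, v)) ((\<lambda>(W, v). (W \<inter> tail (Suc k), v)) x) = x"
      if "x \<in> Z" for x
      using that extend_subsp_eq[OF _ _ k] by (auto simp: Z_def X_def)
  qed
  have fibre: "card {v \<in> W. v k = 1} = ?q ^ d" if W: "W \<in> X" for W
  proof -
    have W': "subsp W" "W \<subseteq> tail k" "card W = ?q ^ Suc d" and "\<not> W \<subseteq> tail (Suc k)"
      using W by (auto simp: X_def)
    then obtain f where f: "f \<in> W" "f k \<noteq> 0" by (auto simp: tail_def less_Suc_eq subset_iff)
    have fc: "red p n f = f" using f W' subsp_carrier by blast
    then have "\<not> p dvd f k" using f(2) carrier_mod[OF fc, of k] by (auto simp: dvd_eq_mod_eq_0)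
    then obtain c where c: "red p n (\<lambda>i. c * f i) \<in> W" "red p n (\<lambda>i. c * f i) k = 1"
      using subsp_normalize[OF W'(1) _ _ k, of f] f(1) fc by auto
    define v where "v = red p n (\<lambda>i. c * f i)"
    have v: "v \<in> W" "v k = 1" "v \<in> tail k" using c W'(2) by (auto simp: v_def)
    have s: "subsp (W \<inter> tail (Suc k))"
      using W'(1) subsp_tail[of "Suc k"] by (auto simp: subsp_iff)
    have "card W = ?q * card (W \<inter> tail (Suc k))"
      using extend_subsp_props(4)[OF s _ k v(3,2)] extend_subsp_eq[OF W'(1,2) k v(1,2)] by simp
    then have 1: "card (W \<inter> tail (Suc k)) = ?q ^ d" using W'(3) q by simp
    show ?thesis using card_normalized[OF W'(1,2) k v(1,2)] 1 by simp
  qed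
  have "card Z = (\<Sum>W\<in>X. card {v \<in> W. v k = 1})"
    unfolding Z_def using finX(1) by (intro card_SigmaI) (auto simp: X_def intro: finite_subset[OF _ finite_tail[of k]])
  also have "\<dots> = card X * ?q ^ d" using fibre by simp
  finally have "card X * ?q ^ d = card Y * ?q ^ (n - Suc k)"
    using bij_betw_same_card[OF bij] cardV by (simp add: card_cartesian_product)
  moreover have "card X = ?q ^ (n - Suc k - d) * card Y"
  proof (cases "d \<le> n - Suc k")
    case True
    then have "?q ^ (n - Suc k) = ?q ^ (n - Suc k - d) * ?q ^ d"
      by (simp only: power_add[symmetric] le_add_diff_inverse2)
    then have "card X * ?q ^ d = (?q ^ (n - Suc k - d) * card Y) * ?q ^ d"
      using calculation by (simp add: mult.commute mult.left_commute)
    moreover have "?q ^ d > 0" using q by simp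
    ultimately show ?thesis by (metis mult_right_cancel nat_less_le)
  next
    case False
    have "Y = {}"
    proof (rule ccontr)
      assume "Y \<noteq> {}"
      then obtain W where "W \<subseteq> tail (Suc k)" "card W = ?q ^ d" by (auto simp: Y_def)
      then have "?q ^ d \<le> ?q ^ (n - Suc k)"
        using card_mono[OF finite_tail, of W "Suc k"] by (simp add: card_tail)
      then show False using False q by simp
    qed
    then show ?thesis using calculation q by simp
  qed
  moreover have "{W. subsp W \<and> W \<subseteq> tail k \<and> card W = ?q ^ Suc d} =
      {W. subsp W \<and> W \<subseteq> tail (Suc k) \<and> card W = ?q ^ Suc d} \<union> X"
    using tail_subset(2)[of k "Suc k"] by (auto simp: X_def)
  then have "subsp_count k (Suc d) = subsp_count (Suc k) (Suc d) + card X"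
    unfolding subsp_count_def using finX(1)
    by (simp, intro card_Un_disjoint) (auto simp: X_def intro: finite_subset[OF _ finite_Pow_iff[THEN iffD2, OF finite_tail[of "Suc k"]]])
  ultimately show ?thesis by (simp add: Y_def subsp_count_def)
qed

lemma subsp_count_0: "subsp_count k 0 = 1"
proof -
  have "{W. subsp W \<and> W \<subseteq> tail k \<and> card W = 1} = {{\<lambda>_. 0}}"
  proof (intro equalityI subsetI)
    fix W assume "W \<in> {W. subsp W \<and> W \<subseteq> tail k \<and> card W = 1}"
    then have "subsp W" "card W = 1" by auto
    moreover have "(\<lambda>_. 0) \<in> W" using subsp_0[OF \<open>subsp W\<close>] by simp
    ultimately show "W \<in> {{\<lambda>_. 0}}" by (auto simp: card_1_singleton_iff)
  next
    fix W assume "W \<in> {{\<lambda>_. 0 :: int} :: (nat \<Rightarrow> int) set}"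
    moreover have "subsp {\<lambda>_. 0}" by (rule subspI) auto
    ultimately show "W \<in> {W. subsp W \<and> W \<subseteq> tail k \<and> card W = 1}" by (auto simp: tail_def)
  qed
  then show ?thesis by (simp add: subsp_count_def)
qed

lemma subsp_count_end: "subsp_count n (Suc d) = 0"
proof -
  have "card W \<noteq> nat p ^ Suc d" if "W \<subseteq> tail n" for W
  proof -
    have "card W \<le> 1" using card_mono[OF finite_tail that] by (simp add: card_tail)
    moreover have "1 < nat p ^ Suc d" using p_gt_1 by (intro one_less_power) auto
    ultimately show ?thesis by linarith
  qed
  then have "{W. subsp W \<and> W \<subseteq> tail n \<and> card W = nat p ^ Suc d} = {}" by blast
  then show ?thesis unfolding subsp_count_def by (simp only: card.empty)
qed

end

subsection \<open>Ideals not containing the last term of the lower central series\<close>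

context nilp_mod
begin

definition idl :: "(nat \<Rightarrow> int) set \<Rightarrow> bool" where
  "idl I \<longleftrightarrow> alg_ideal K N I"

lemma idl_iff: "idl I \<longleftrightarrow> subsp I \<and> (\<forall>f\<in>I. \<forall>g. red p n (br f g) \<in> I)"
proof
  assume I: "idl I"
  have "red p n (br f g) \<in> I" if "f \<in> I" for f g
  proof -
    have "f \<otimes>\<^bsub>N\<^esub> red p n g \<in> I"
      using I that unfolding idl_def alg_ideal_def by (metis nilp_simps(1) red_simps(1))
    then show ?thesis by simp
  qed
  then show "subsp I \<and> (\<forall>f\<in>I. \<forall>g. red p n (br f g) \<in> I)"
    using I by (simp add: idl_def alg_ideal_def subsp_def)
next
  assume I: "subsp I \<and> (\<forall>f\<in>I. \<forall>g. red p n (br f g) \<in> I)"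
  have "red p n (br g f) \<in> I" if "f \<in> I" for f g
  proof -
    have "br g f = (\<lambda>i. - 1 * br f g i)" by (auto simp: br_def fun_eq_iff)
    then show ?thesis using I that subsp_scale[of I "br f g" "-1"] by simp
  qed
  then show "idl I" using I by (simp add: idl_def alg_ideal_def subsp_def)
qed

lemma idl_subsp: "idl I \<Longrightarrow> subsp I"
  by (simp add: idl_iff)

lemma idl_br: "idl I \<Longrightarrow> red p n f \<in> I \<Longrightarrow> red p n (br f g) \<in> I"
  unfolding idl_iff by (metis red_br(1))

lemma tail_subset_unit_vec:
  assumes I: "subsp I" and e: "\<And>i. \<lbrakk>k \<le> i; i < n\<rbrakk> \<Longrightarrow> red p n (unit_vec i) \<in> I"
  shows "tail k \<subseteq> I"
proof
  fix f assume f: "f \<in> tail k"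
  have "red p n (\<lambda>i. if i < j then f i else 0) \<in> I" if "j \<le> n" for j
    using that
  proof (induction j)
    case 0
    then show ?case using subsp_0[OF I] by simp
  next
    case (Suc j)
    have "red p n (\<lambda>i. f j * unit_vec j i) \<in> I"
    proof (cases "k \<le> j")
      case True
      then show ?thesis using e[of j] Suc.prems subsp_scale[OF I] by simp
    next
      case False
      then show ?thesis using f subsp_0[OF I] by (simp add: tail_def)
    qed
    then have "red p n (\<lambda>i. (if i < j then f i else 0) + f j * unit_vec j i) \<in> I"
      using subsp_add[OF I Suc.IH] Suc.prems by simp
    moreover have "(\<lambda>i. (if i < j then f i else 0) + f j * unit_vec j i) = (\<lambda>i. if i < Suc j then f i else 0)"
      by (auto simp: fun_eq_iff unit_vec_def less_Suc_eq)
    ultimately show ?case by simp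
  qed
  from this[of n] have "red p n (\<lambda>i. if i < n then f i else 0) \<in> I" by simp
  moreover have "red p n (\<lambda>i. if i < n then f i else 0) = red p n f" by (rule red_eqI) simp
  ultimately show "f \<in> I" using f by (simp add: tail_iff)
qed

lemma ideals_not_above_tail:
  assumes k: "k \<le> n"
    and abel: "\<And>f g i. \<lbrakk>f \<in> tail k; i < n\<rbrakk> \<Longrightarrow> br f g i = 0"
    and dich: "\<And>I. \<lbrakk>idl I; \<not> tail k \<subseteq> I\<rbrakk> \<Longrightarrow> I \<subseteq> tail k \<or> I \<in> X"
    and X: "\<And>I. I \<in> X \<Longrightarrow> idl I \<and> \<not> tail k \<subseteq> I \<and> card I = nat p ^ (n - k)"
  shows "card {I. idl I \<and> \<not> tail k \<subseteq> I \<and> card (carrier N) = nat p ^ i * card I} =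
    (if i = k then card X else if k < i \<and> i \<le> n then subsp_count k (n - i) else 0)"
    (is "card ?S = _")
proof -
  let ?q = "nat p"
  have q: "1 < ?q" using p_gt_1 by simp
  have idl_tail: "idl W" if "subsp W" "W \<subseteq> tail k" for W
  proof -
    have "red p n (br f g) = red p n (\<lambda>_. 0)" if "f \<in> W" for f g
      using abel[of f] that \<open>W \<subseteq> tail k\<close> by (intro red_eqI) auto
    then show ?thesis using that(1) subsp_0[OF that(1)] by (simp add: idl_iff)
  qed
  have card_tail_less: "card W < ?q ^ (n - k)" if "W \<subseteq> tail k" "\<not> tail k \<subseteq> W" for W
    using psubset_card_mono[OF finite_tail, of W k] that by (auto simp: card_tail)
  have cardN: "card (carrier N) = ?q ^ n" by (rule card_nilp[OF p_pos])
  have index: "?q ^ n = ?q ^ i * c \<longleftrightarrow> i \<le> n \<and> c = ?q ^ (n - i)" for c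
  proof
    assume eq: "?q ^ n = ?q ^ i * c"
    have "i \<le> n"
    proof -
      have "?q ^ i dvd ?q ^ n" using eq by simp
      then show ?thesis using dvd_imp_le[of "?q ^ i" "?q ^ n"] q by simp
    qed
    then have "?q ^ n = ?q ^ i * ?q ^ (n - i)" by (simp only: power_add[symmetric] le_add_diff_inverse)
    then show "i \<le> n \<and> c = ?q ^ (n - i)" using eq q \<open>i \<le> n\<close> by simp
  next
    assume "i \<le> n \<and> c = ?q ^ (n - i)"
    then show "?q ^ n = ?q ^ i * c" by (simp only: power_add[symmetric] le_add_diff_inverse)
  qed
  consider "i = k" | "k < i" "i \<le> n" | "i < k" | "n < i" by linarith
  then show ?thesis
  proof cases
    case 1
    have "?S = X"
    proof (intro equalityI subsetI)
      fix I assume "I \<in> ?S"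
      then have I: "idl I" "\<not> tail k \<subseteq> I" "card I = ?q ^ (n - k)" unfolding cardN index by (auto simp: 1)
      from dich[OF I(1,2)] show "I \<in> X" using card_tail_less[OF _ I(2)] I(3) by auto
    next
      fix I assume "I \<in> X"
      then show "I \<in> ?S" using X[of I] k unfolding cardN index by (simp add: 1)
    qed
    then show ?thesis using 1 by simp
  next
    case 2
    have lt: "?q ^ (n - i) < ?q ^ (n - k)" using 2 q by simp
    have "?S = {W. subsp W \<and> W \<subseteq> tail k \<and> card W = ?q ^ (n - i)}"
    proof (intro equalityI subsetI)
      fix I assume "I \<in> ?S"
      then have I: "idl I" "\<not> tail k \<subseteq> I" "card I = ?q ^ (n - i)" unfolding cardN index by auto
      then have "I \<notin> X" using X[of I] lt by auto
      then show "I \<in> {W. subsp W \<and> W \<subseteq> tail k \<and> card W = ?q ^ (n - i)}"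
        using I dich idl_subsp by blast
    next
      fix W assume "W \<in> {W. subsp W \<and> W \<subseteq> tail k \<and> card W = ?q ^ (n - i)}"
      then have W: "subsp W" "W \<subseteq> tail k" "card W = ?q ^ (n - i)" by auto
      have "\<not> tail k \<subseteq> W"
      proof
        assume "tail k \<subseteq> W"
        then have "W = tail k" using W(2) by blast
        then show False using W(3) lt by (simp add: card_tail)
      qed
      then show "W \<in> ?S" using W idl_tail 2 unfolding cardN index by blast
    qed
    then show ?thesis using 2 by (simp add: subsp_count_def)
  next
    case 3
    have lt: "?q ^ (n - k) < ?q ^ (n - i)" using 3 k q by simp
    have "I \<notin> ?S" for I
    proof
      assume "I \<in> ?S"
      then have I: "idl I" "\<not> tail k \<subseteq> I" "card I = ?q ^ (n - i)" unfolding cardN index by auto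
      from dich[OF I(1,2)] show False
        using card_tail_less[OF _ I(2)] X[of I] I(3) lt by auto
    qed
    then have "?S = {}" by blast
    then have "card ?S = 0" by (simp only: card.empty)
    then show ?thesis using 3 by simp
  next
    case 4
    then have "?S = {}" unfolding cardN index by auto
    then have "card ?S = 0" by (simp only: card.empty)
    then show ?thesis using 4 k by simp
  qed
qed

lemma commutator_generator:
  assumes I: "idl I" and f: "red p n f \<in> I" and n: "3 \<le> n"
    and nz: "\<not> p dvd f 0 \<or> \<not> p dvd f 1 \<or> \<not> p dvd f 2"
  obtains g where "red p n g \<in> I" "p dvd g 0" "p dvd g 1" "g 2 mod p = 1"
proof -
  note result = that
  have *: thesis if h: "red p n h \<in> I" "p dvd h 0" "p dvd h 1" "\<not> p dvd h 2" for h
  proof -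
    obtain c where c: "(c * h 2) mod p = 1" using inverse_mod[OF h(4)] by blast
    show thesis
      by (rule result[of "\<lambda>i. c * h i"]) (use h c subsp_scale[OF idl_subsp[OF I]] in auto)
  qed
  have br0: "br f (unit_vec 0) 0 = 0" "br f (unit_vec 0) 1 = 0" "br f (unit_vec 0) 2 = - f 1"
    "br f (unit_vec 1) 0 = 0" "br f (unit_vec 1) 1 = 0" "br f (unit_vec 1) 2 = f 0"
    by (simp_all add: br_def unit_vec_def)
  show thesis
  proof (cases "p dvd f 1")
    case False
    then show thesis using *[OF idl_br[OF I f, of "unit_vec 0"]] br0 by simp
  next
    case f1: True
    show thesis
    proof (cases "p dvd f 0")
      case False
      then show thesis using *[OF idl_br[OF I f, of "unit_vec 1"]] br0 by simp
    next
      case True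
      then show thesis using *[OF f] f1 nz by simp
    qed
  qed
qed

end

lemma less_5_cases: "(i :: nat) < 5 \<longleftrightarrow> i \<in> {0, 1, 2, 3, 4}"
  by auto

context
  fixes p :: int
  assumes prime_p: "Factorial_Ring.prime p"
begin

lemma ideals_class_2:
  shows "card {I. nilp_mod.idl p 3 I \<and> \<not> nilp_mod.tail p 3 2 \<subseteq> I \<and>
      card (carrier (nilp p 3)) = nat p ^ i * card I} =
    (if i = 3 then 1 else 0)"
proof -
  interpret nilp_mod p 3 by unfold_locales (rule prime_p)
  have "I \<subseteq> tail 2" if I: "idl I" and t: "\<not> tail 2 \<subseteq> I" for I
  proof (rule ccontr)
    note sub = idl_subsp[OF I]
    assume "\<not> I \<subseteq> tail 2"
    then obtain f where f: "f \<in> I" "f \<notin> tail 2" by blast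
    have fc: "red p 3 f = f" using subsp_carrier[OF sub f(1)] .
    then have fI: "red p 3 f \<in> I" using f by simp
    have "\<not> (p dvd f 0 \<and> p dvd f 1)"
      using f(2) fc tail_red[of f 2] by (auto simp: less_2_cases_iff)
    then obtain g where g: "red p 3 g \<in> I" "p dvd g 0" "p dvd g 1" "g 2 mod p = 1"
      using commutator_generator[OF I fI] by (metis order_refl)
    have "tail 2 \<subseteq> I"
    proof (rule tail_subset_unit_vec[OF sub])
      fix i :: nat assume "2 \<le> i" "i < 3"
      then have i: "i = 2" by simp
      show "red p 3 (unit_vec i) \<in> I"
      proof (rule subsp_cong[OF g(1)])
        fix j :: nat assume "j < 3"
        then have "j = 0 \<or> j = 1 \<or> j = 2" by auto
        then show "unit_vec i j mod p = g j mod p"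
          using g p_gt_1 by (auto simp: i unit_vec_def)
      qed
    qed
    then show False using t by blast
  qed
  then have "card {I. idl I \<and> \<not> tail 2 \<subseteq> I \<and> card (carrier N) = nat p ^ i * card I} =
      (if i = 2 then card ({} :: (nat \<Rightarrow> int) set set) else if 2 < i \<and> i \<le> 3 then subsp_count 2 (3 - i) else 0)"
    by (intro ideals_not_above_tail) (auto simp: tail_def br_def)
  moreover have "2 < i \<and> i \<le> 3 \<longleftrightarrow> i = 3" by auto
  ultimately show ?thesis by (simp add: subsp_count_0)
qed

lemma ideals_class_3:
  shows "card {I. nilp_mod.idl p 5 I \<and> \<not> nilp_mod.tail p 5 3 \<subseteq> I \<and>
      card (carrier (nilp p 5)) = nat p ^ i * card I} =
    (if i = 4 then 1 + nat p else if i = 5 then 1 else 0)"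
proof -
  interpret nilp_mod p 5 by unfold_locales (rule prime_p)
  have "I \<subseteq> tail 3" if I: "idl I" and t: "\<not> tail 3 \<subseteq> I" for I
  proof (rule ccontr)
    note sub = idl_subsp[OF I]
    assume "\<not> I \<subseteq> tail 3"
    then obtain f where f: "f \<in> I" "f \<notin> tail 3" by blast
    have fc: "red p 5 f = f" using subsp_carrier[OF sub f(1)] .
    then have fI: "red p 5 f \<in> I" using f by simp
    have "j < 3 \<longleftrightarrow> j = 0 \<or> j = 1 \<or> j = 2" for j :: nat by auto
    then have "\<not> (p dvd f 0 \<and> p dvd f 1 \<and> p dvd f 2)"
      using f(2) fc tail_red[of f 3] by auto
    then obtain g where g: "red p 5 g \<in> I" "p dvd g 0" "p dvd g 1" "g 2 mod p = 1"
      using commutator_generator[OF I fI] by auto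
    have g1: "(- g 1) mod p = 0" using g(3) by simp
    have e3: "red p 5 (unit_vec 3) \<in> I"
    proof (rule subsp_cong[OF idl_br[OF I g(1)]])
      fix j :: nat assume "j < 5"
      then show "unit_vec 3 j mod p = br g (unit_vec 0) j mod p"
        using g g1 p_gt_1 unfolding less_5_cases by (auto simp: unit_vec_def br_def)
    qed
    have e4: "red p 5 (unit_vec 4) \<in> I"
    proof (rule subsp_cong[OF idl_br[OF I g(1)]])
      fix j :: nat assume "j < 5"
      then show "unit_vec 4 j mod p = br g (unit_vec 1) j mod p"
        using g g1 p_gt_1 unfolding less_5_cases by (auto simp: unit_vec_def br_def)
    qed
    have "tail 3 \<subseteq> I"
    proof (rule tail_subset_unit_vec[OF sub])
      fix i :: nat assume "3 \<le> i" "i < 5"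
      then have "i = 3 \<or> i = 4" by auto
      then show "red p 5 (unit_vec i) \<in> I" using e3 e4 by auto
    qed
    then show False using t by blast
  qed
  then have "card {I. idl I \<and> \<not> tail 3 \<subseteq> I \<and> card (carrier N) = nat p ^ i * card I} =
      (if i = 3 then card ({} :: (nat \<Rightarrow> int) set set) else if 3 < i \<and> i \<le> 5 then subsp_count 3 (5 - i) else 0)"
    by (intro ideals_not_above_tail) (auto simp: tail_def br_def)
  moreover have "subsp_count 3 1 = 1 + nat p"
    using subsp_count_step[of 3 0] subsp_count_step[of 4 0] subsp_count_end[of 0]
    by (simp add: subsp_count_0)
  moreover have "3 < i \<and> i \<le> 5 \<longleftrightarrow> i = 4 \<or> i = 5" by auto
  ultimately show ?thesis by (auto simp: subsp_count_0)
qed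

end

locale nilp_class_4 = nilp_mod p 8 for p :: int
begin

definition quad :: "int \<Rightarrow> (nat \<Rightarrow> int) \<Rightarrow> int" where
  "quad b f = b * b * f 5 - b * f 6 + f 7"

text \<open>The exceptional ideals are generated by an element \<open>u + b v + \<dots>\<close> or \<open>v + \<dots>\<close> of \<open>\<gamma>\<^sub>3\<close>. In the
  first case the ideal meets \<open>\<gamma>\<^sub>4\<close> in the kernel of \<open>quad b\<close>, which is spanned by the two brackets
  of the generator with \<open>x\<close> and \<open>y\<close>.\<close>

definition ideal_u :: "int \<Rightarrow> int \<Rightarrow> (nat \<Rightarrow> int) set" where
  "ideal_u b c = {f \<in> tail 3. p dvd f 4 - b * f 3 \<and> p dvd quad b f - c * f 3}"

definition ideal_v :: "int \<Rightarrow> (nat \<Rightarrow> int) set" where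
  "ideal_v c = {f \<in> tail 4. p dvd f 5 - c * f 4}"

definition exceptional :: "(nat \<Rightarrow> int) set set" where
  "exceptional = (\<lambda>(b, c). ideal_u b c) ` ({0..<p} \<times> {0..<p}) \<union> ideal_v ` {0..<p}"

lemma less_3_cases: "(i :: nat) < 3 \<longleftrightarrow> i = 0 \<or> i = 1 \<or> i = 2"
  by auto

lemma less_4_cases: "(i :: nat) < 4 \<longleftrightarrow> i = 0 \<or> i = 1 \<or> i = 2 \<or> i = 3"
  by auto

lemma dvd_cong_mod: "a mod p = b mod p \<Longrightarrow> p dvd a \<longleftrightarrow> p dvd b" for a b :: int
  by (simp add: dvd_eq_mod_eq_0)

lemma red_ideal_u:
  "red p 8 f \<in> ideal_u b c \<longleftrightarrow>
    p dvd f 0 \<and> p dvd f 1 \<and> p dvd f 2 \<and> p dvd f 4 - b * f 3 \<and> p dvd quad b f - c * f 3"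
proof -
  have r: "red p 8 f 3 = f 3 mod p" "red p 8 f 4 = f 4 mod p" by (simp_all add: red_def)
  have t: "red p 8 f \<in> tail 3 \<longleftrightarrow> p dvd f 0 \<and> p dvd f 1 \<and> p dvd f 2"
    unfolding tail_red less_3_cases by auto
  have 1: "p dvd f 4 mod p - b * (f 3 mod p) \<longleftrightarrow> p dvd f 4 - b * f 3"
    by (intro dvd_cong_mod mod_diff_cong mod_mult_cong) simp_all
  have 2: "p dvd quad b (red p 8 f) - c * (f 3 mod p) \<longleftrightarrow> p dvd quad b f - c * f 3"
    unfolding quad_def
    by (intro dvd_cong_mod mod_diff_cong mod_add_cong mod_mult_cong) (simp_all add: red_def)
  show ?thesis unfolding ideal_u_def mem_Collect_eq t r 1 2 by blast
qed

lemma red_ideal_v: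
  "red p 8 f \<in> ideal_v c \<longleftrightarrow>
    p dvd f 0 \<and> p dvd f 1 \<and> p dvd f 2 \<and> p dvd f 3 \<and> p dvd f 5 - c * f 4"
proof -
  have r: "red p 8 f 4 = f 4 mod p" "red p 8 f 5 = f 5 mod p" by (simp_all add: red_def)
  have t: "red p 8 f \<in> tail 4 \<longleftrightarrow> p dvd f 0 \<and> p dvd f 1 \<and> p dvd f 2 \<and> p dvd f 3"
    unfolding tail_red less_4_cases by auto
  have 1: "p dvd f 5 mod p - c * (f 4 mod p) \<longleftrightarrow> p dvd f 5 - c * f 4"
    by (intro dvd_cong_mod mod_diff_cong mod_mult_cong) simp_all
  show ?thesis unfolding ideal_v_def mem_Collect_eq t r 1 by blast
qed

lemma idl_ideal_u: "idl (ideal_u b c)"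
proof -
  have c: "red p 8 f = f" if "f \<in> ideal_u b c" for f using that by (simp add: ideal_u_def tail_iff)
  have eqs: "p dvd f 0 \<and> p dvd f 1 \<and> p dvd f 2 \<and> p dvd f 4 - b * f 3 \<and> p dvd quad b f - c * f 3"
    if "f \<in> ideal_u b c" for f
    using that c[OF that] red_ideal_u[of f b c] by simp
  have "subsp (ideal_u b c)"
  proof (rule subspI)
    show "(\<lambda>_. 0) \<in> ideal_u b c" by (simp add: ideal_u_def tail_def quad_def)
    fix f g assume f: "f \<in> ideal_u b c" and g: "g \<in> ideal_u b c"
    have 1: "f 4 + g 4 - b * (f 3 + g 3) = (f 4 - b * f 3) + (g 4 - b * g 3)" by (simp add: algebra_simps)
    have 2: "quad b (\<lambda>i. f i + g i) - c * (f 3 + g 3) = (quad b f - c * f 3) + (quad b g - c * g 3)"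
      by (simp add: quad_def algebra_simps)
    show "red p 8 (\<lambda>i. f i + g i) \<in> ideal_u b c"
      unfolding red_ideal_u 1 2 using eqs[OF f] eqs[OF g] by (intro conjI dvd_add) auto
  next
    fix k f assume f: "f \<in> ideal_u b c"
    have 1: "k * f 4 - b * (k * f 3) = k * (f 4 - b * f 3)" by (simp add: algebra_simps)
    have 2: "quad b (\<lambda>i. k * f i) - c * (k * f 3) = k * (quad b f - c * f 3)"
      by (simp add: quad_def algebra_simps)
    show "red p 8 (\<lambda>i. k * f i) \<in> ideal_u b c"
      unfolding red_ideal_u 1 2 using eqs[OF f] by (intro conjI dvd_mult) auto
  qed (rule c)
  moreover have "red p 8 (br f g) \<in> ideal_u b c" if f: "f \<in> ideal_u b c" for f g
  proof -
    have f0: "f 0 = 0" "f 1 = 0" "f 2 = 0" using f by (auto simp: ideal_u_def tail_def)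
    have 2: "quad b (br f g) - c * br f g 3 = (g 1 - b * g 0) * (f 4 - b * f 3)"
      using f0 by (simp add: quad_def br_def algebra_simps)
    have "p dvd (g 1 - b * g 0) * (f 4 - b * f 3)" using eqs[OF f] by (intro dvd_mult) auto
    then show ?thesis unfolding red_ideal_u 2 using f0 by (simp add: br_def)
  qed
  ultimately show ?thesis by (simp add: idl_iff)
qed

lemma idl_ideal_v: "idl (ideal_v c)"
proof -
  have c: "red p 8 f = f" if "f \<in> ideal_v c" for f using that by (simp add: ideal_v_def tail_iff)
  have eqs: "p dvd f 0 \<and> p dvd f 1 \<and> p dvd f 2 \<and> p dvd f 3 \<and> p dvd f 5 - c * f 4"
    if "f \<in> ideal_v c" for f
    using that c[OF that] red_ideal_v[of f c] by simp
  have "subsp (ideal_v c)"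
  proof (rule subspI)
    show "(\<lambda>_. 0) \<in> ideal_v c" by (simp add: ideal_v_def tail_def)
    fix f g assume f: "f \<in> ideal_v c" and g: "g \<in> ideal_v c"
    have 1: "f 5 + g 5 - c * (f 4 + g 4) = (f 5 - c * f 4) + (g 5 - c * g 4)" by (simp add: algebra_simps)
    show "red p 8 (\<lambda>i. f i + g i) \<in> ideal_v c"
      unfolding red_ideal_v 1 using eqs[OF f] eqs[OF g] by (intro conjI dvd_add) auto
  next
    fix k f assume f: "f \<in> ideal_v c"
    have 1: "k * f 5 - c * (k * f 4) = k * (f 5 - c * f 4)" by (simp add: algebra_simps)
    show "red p 8 (\<lambda>i. k * f i) \<in> ideal_v c"
      unfolding red_ideal_v 1 using eqs[OF f] by (intro conjI dvd_mult) auto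
  qed (rule c)
  moreover have "red p 8 (br f g) \<in> ideal_v c" if f: "f \<in> ideal_v c" for f g
  proof -
    have "f 0 = 0" "f 1 = 0" "f 2 = 0" "f 3 = 0" using f by (auto simp: ideal_v_def tail_def)
    then show ?thesis unfolding red_ideal_v by (simp add: br_def)
  qed
  ultimately show ?thesis by (simp add: idl_iff)
qed

lemma card_graph_subset:
  assumes J: "J \<subseteq> {..<8}"
    and I: "\<And>f. red p 8 f = f \<Longrightarrow> f \<in> I \<longleftrightarrow> (\<forall>i<8. i \<notin> J \<longrightarrow> f i = h (\<lambda>j. if j \<in> J then f j else 0) i mod p)"
    and car: "\<And>f. f \<in> I \<Longrightarrow> red p 8 f = f"
  shows "card I = nat p ^ card J"
proof -
  let ?S = "{f :: nat \<Rightarrow> int. (\<forall>i\<in>J. f i \<in> {0..<p}) \<and> (\<forall>i. i \<notin> J \<longrightarrow> f i = 0)}"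
  let ?r = "\<lambda>f j. if j \<in> J then f j else 0 :: int"
  have "bij_betw ?r I ?S"
  proof (rule bij_betwI[where g = "\<lambda>f. red p 8 (\<lambda>i. if i \<in> J then f i else h f i)"])
    show "?r \<in> I \<rightarrow> ?S" using carrier_bounds[OF car] by auto
    have eq: "?r (red p 8 (\<lambda>i. if i \<in> J then f i else h f i)) = f" if "f \<in> ?S" for f
      using that J by (auto simp: red_def fun_eq_iff)
    show "(\<lambda>f. red p 8 (\<lambda>i. if i \<in> J then f i else h f i)) \<in> ?S \<rightarrow> I"
    proof
      fix f assume f: "f \<in> ?S"
      have "red p 8 (\<lambda>i. if i \<in> J then f i else h f i) i = h f i mod p" if "i < 8" "i \<notin> J" for i
        using that by (simp add: red_def)
      then show "red p 8 (\<lambda>i. if i \<in> J then f i else h f i) \<in> I"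
        unfolding I[OF red_simps(1)] eq[OF f] by blast
    qed
    show "?r (red p 8 (\<lambda>i. if i \<in> J then f i else h f i)) = f" if "f \<in> ?S" for f
      using eq[OF that] .
    show "red p 8 (\<lambda>i. if i \<in> J then ?r f i else h (?r f) i) = f" if f: "f \<in> I" for f
    proof (rule carrier_eqI[OF red_simps(1) car[OF f]])
      fix i :: nat assume i: "i < 8"
      show "red p 8 (\<lambda>i. if i \<in> J then ?r f i else h (?r f) i) i mod p = f i mod p"
      proof (cases "i \<in> J")
        case False
        then have "f i = h (?r f) i mod p" using I[OF car[OF f]] f i by blast
        then show ?thesis using i False by (simp add: red_def)
      qed (use i in \<open>simp add: red_def\<close>)
    qed
  qed
  then have "card I = card ?S" by (rule bij_betw_same_card)
  also have "\<dots> = card {0..<p} ^ card J"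
    using J by (intro card_supported_functions finite_subset[OF J]) simp
  finally show ?thesis by simp
qed

lemma dvd_diff_carrier: "red p 8 f = f \<Longrightarrow> p dvd f i - a \<longleftrightarrow> f i = a mod p"
  using carrier_mod[of f i] by (simp flip: mod_eq_dvd_iff)

lemma card_ideal_u: "card (ideal_u b c) = nat p ^ 3"
proof -
  let ?h = "\<lambda>f i. if i = 4 then b * f 3 else if i = 7 then c * f 3 - b * b * f 5 + b * f 6 else (0 :: int)"
  have "card (ideal_u b c) = nat p ^ card {3, 5, 6 :: nat}"
  proof (rule card_graph_subset[where h = ?h])
    fix f assume f: "red p 8 f = f"
    have q: "quad b f - c * f 3 = f 7 - (c * f 3 - b * b * f 5 + b * f 6)" by (simp add: quad_def)
    have "f \<in> ideal_u b c \<longleftrightarrow> f 0 = 0 \<and> f 1 = 0 \<and> f 2 = 0 \<and> f 4 = b * f 3 mod p \<and>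
        f 7 = (c * f 3 - b * b * f 5 + b * f 6) mod p"
      unfolding ideal_u_def mem_Collect_eq tail_iff less_3_cases q dvd_diff_carrier[OF f] using f by auto
    also have "\<dots> \<longleftrightarrow> (\<forall>i<8. i \<notin> {3, 5, 6} \<longrightarrow>
        f i = ?h (\<lambda>j. if j \<in> {3, 5, 6} then f j else 0) i mod p)"
      unfolding less_8_cases by auto
    finally show "f \<in> ideal_u b c \<longleftrightarrow> (\<forall>i<8. i \<notin> {3, 5, 6} \<longrightarrow>
        f i = ?h (\<lambda>j. if j \<in> {3, 5, 6} then f j else 0) i mod p)" .
  qed (auto simp: ideal_u_def tail_iff)
  then show ?thesis by (simp add: power3_eq_cube)
qed

lemma card_ideal_v: "card (ideal_v c) = nat p ^ 3"
proof -
  let ?h = "\<lambda>f i. if i = 5 then c * f 4 else (0 :: int)"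
  have "card (ideal_v c) = nat p ^ card {4, 6, 7 :: nat}"
  proof (rule card_graph_subset[where h = ?h])
    fix f assume f: "red p 8 f = f"
    have "f \<in> ideal_v c \<longleftrightarrow> f 0 = 0 \<and> f 1 = 0 \<and> f 2 = 0 \<and> f 3 = 0 \<and> f 5 = c * f 4 mod p"
      unfolding ideal_v_def mem_Collect_eq tail_iff less_4_cases dvd_diff_carrier[OF f] using f by auto
    also have "\<dots> \<longleftrightarrow> (\<forall>i<8. i \<notin> {4, 6, 7} \<longrightarrow>
        f i = ?h (\<lambda>j. if j \<in> {4, 6, 7} then f j else 0) i mod p)"
      unfolding less_8_cases by auto
    finally show "f \<in> ideal_v c \<longleftrightarrow> (\<forall>i<8. i \<notin> {4, 6, 7} \<longrightarrow>
        f i = ?h (\<lambda>j. if j \<in> {4, 6, 7} then f j else 0) i mod p)" .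
  qed (auto simp: ideal_v_def tail_iff)
  then show ?thesis by (simp add: power3_eq_cube)
qed

lemma card_exceptional: "card exceptional = nat p ^ 2 + nat p"
proof -
  have range_eq: "a = b" if "p dvd a - b" "a \<in> {0..<p}" "b \<in> {0..<p}" for a b :: int
    using that by (auto simp flip: mod_eq_dvd_iff)
  have u: "red p 8 (\<lambda>i. if i = 3 then 1 else if i = 4 then b else if i = 7 then c else 0) \<in> ideal_u b' c'
      \<longleftrightarrow> p dvd b - b' \<and> p dvd c - c'" for b c b' c'
    unfolding red_ideal_u by (simp add: quad_def)
  have v: "red p 8 (\<lambda>i. if i = 4 then 1 else if i = 5 then c else 0) \<in> ideal_v c' \<longleftrightarrow> p dvd c - c'" for c c'
    unfolding red_ideal_v by simp
  have "inj_on (\<lambda>(b, c). ideal_u b c) ({0..<p} \<times> {0..<p})"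
  proof (rule inj_onI, clarsimp)
    fix b c b' c' assume eq: "ideal_u b c = ideal_u b' c'" and r: "0 \<le> b" "b < p" "0 \<le> b'" "b' < p"
      "0 \<le> c" "c < p" "0 \<le> c'" "c' < p"
    have "p dvd b - b' \<and> p dvd c - c'" using u[of b c b c] u[of b c b' c'] eq by simp
    then show "b = b' \<and> c = c'" using range_eq[of b b'] range_eq[of c c'] r by auto
  qed
  then have 1: "card ((\<lambda>(b, c). ideal_u b c) ` ({0..<p} \<times> {0..<p})) = nat p ^ 2"
    by (simp add: card_image card_cartesian_product power2_eq_square)
  have "inj_on ideal_v {0..<p}"
  proof (rule inj_onI)
    fix c c' assume eq: "ideal_v c = ideal_v c'" and r: "c \<in> {0..<p}" "c' \<in> {0..<p}"
    have "p dvd c - c'" using v[of c c] v[of c c'] eq by simp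
    then show "c = c'" using range_eq r by blast
  qed
  then have 2: "card (ideal_v ` {0..<p}) = nat p" by (simp add: card_image)
  have 3: "ideal_u b c \<noteq> ideal_v c'" for b c c'
  proof
    assume "ideal_u b c = ideal_v c'"
    then have "red p 8 (\<lambda>i. if i = 3 then 1 else if i = 4 then b else if i = 7 then c else 0) \<in> ideal_v c'"
      using u[of b c b c] by simp
    then show False unfolding red_ideal_v using p_gt_1 by simp
  qed
  show ?thesis
    unfolding exceptional_def
    by (subst card_Un_disjoint) (use 1 2 3 in auto)
qed

lemma exceptional_props:
  assumes "I \<in> exceptional"
  shows "idl I \<and> \<not> tail 5 \<subseteq> I \<and> card I = nat p ^ (8 - 5)"
proof -
  have np: "\<not> p dvd 1" using p_gt_1 by simp
  have "red p 8 (unit_vec 7) \<notin> ideal_u b c" for b c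
    unfolding red_ideal_u using np by (simp add: quad_def unit_vec_def)
  moreover have "red p 8 (unit_vec 5) \<notin> ideal_v c" for c
    unfolding red_ideal_v using np by (simp add: unit_vec_def)
  moreover have "red p 8 (unit_vec 7) \<in> tail 5" "red p 8 (unit_vec 5) \<in> tail 5"
    unfolding tail_red by (auto simp: unit_vec_def)
  ultimately have "\<not> tail 5 \<subseteq> ideal_u b c" "\<not> tail 5 \<subseteq> ideal_v c" for b c by blast+
  then show ?thesis
    using assms idl_ideal_u idl_ideal_v card_ideal_u card_ideal_v by (auto simp: exceptional_def)
qed

context
  fixes I
  assumes I: "idl I" and below: "\<not> tail 5 \<subseteq> I"
begin

lemma I_subsp: "subsp I"
  by (rule idl_subsp[OF I])

lemma top_not_subset:
  "\<not> (red p 8 (unit_vec 5) \<in> I \<and> red p 8 (unit_vec 6) \<in> I \<and> red p 8 (unit_vec 7) \<in> I)"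
proof
  assume a: "red p 8 (unit_vec 5) \<in> I \<and> red p 8 (unit_vec 6) \<in> I \<and> red p 8 (unit_vec 7) \<in> I"
  have "tail 5 \<subseteq> I"
  proof (rule tail_subset_unit_vec[OF I_subsp])
    fix i :: nat assume "5 \<le> i" "i < 8"
    then have "i = 5 \<or> i = 6 \<or> i = 7" by auto
    then show "red p 8 (unit_vec i) \<in> I" using a by auto
  qed
  then show False using below by blast
qed

lemma I_low:
  assumes f: "red p 8 f \<in> I"
  shows "p dvd f 0" "p dvd f 1" "p dvd f 2"
proof -
  have "p dvd f 0 \<and> p dvd f 1 \<and> p dvd f 2"
  proof (rule ccontr)
    assume "\<not> (p dvd f 0 \<and> p dvd f 1 \<and> p dvd f 2)"
    then obtain g where g: "red p 8 g \<in> I" "p dvd g 0" "p dvd g 1" "g 2 mod p = 1"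
      using commutator_generator[OF I f] by auto
    have g01: "g 0 mod p = 0" "g 1 mod p = 0" "(- g 1) mod p = 0" "(- g 0) mod p = 0" using g by auto
    have "red p 8 (unit_vec 5) \<in> I"
    proof (rule subsp_cong[OF idl_br[OF I idl_br[OF I g(1)]]])
      fix j :: nat assume "j < 8"
      then show "unit_vec 5 j mod p = br (br g (unit_vec 0)) (unit_vec 0) j mod p"
        using g g01 p_gt_1 unfolding less_8_cases by (auto simp: unit_vec_def br_def)
    qed
    moreover have "red p 8 (unit_vec 6) \<in> I"
    proof (rule subsp_cong[OF idl_br[OF I idl_br[OF I g(1)]]])
      fix j :: nat assume "j < 8"
      then show "unit_vec 6 j mod p = br (br g (unit_vec 0)) (unit_vec 1) j mod p"
        using g g01 p_gt_1 unfolding less_8_cases by (auto simp: unit_vec_def br_def)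
    qed
    moreover have "red p 8 (unit_vec 7) \<in> I"
    proof (rule subsp_cong[OF idl_br[OF I idl_br[OF I g(1)]]])
      fix j :: nat assume "j < 8"
      then show "unit_vec 7 j mod p = br (br g (unit_vec 1)) (unit_vec 1) j mod p"
        using g g01 p_gt_1 unfolding less_8_cases by (auto simp: unit_vec_def br_def)
    qed
    ultimately show False using top_not_subset by blast
  qed
  then show "p dvd f 0" "p dvd f 1" "p dvd f 2" by auto
qed

lemma I_scaled:
  assumes f: "red p 8 f \<in> I" and a: "\<not> p dvd a"
    and eq: "\<And>j. j < 8 \<Longrightarrow> p dvd f j - a * e j"
  shows "red p 8 e \<in> I"
proof -
  obtain c where c: "(c * a) mod p = 1" using inverse_mod[OF a] by blast
  show ?thesis
  proof (rule subsp_cong[OF subsp_scale[OF I_subsp f, of c]])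
    fix j :: nat assume "j < 8"
    then have "f j mod p = (a * e j) mod p" using eq by (simp add: mod_eq_dvd_iff)
    then have "(c * f j) mod p = (c * (a * e j)) mod p" by (rule mod_mult_cong[OF refl])
    also have "\<dots> = (c * a) mod p * e j mod p" by (simp add: mod_mult_left_eq mult.assoc)
    finally show "e j mod p = c * f j mod p" by (simp add: c)
  qed
qed

lemma I_exceptional_u:
  assumes v: "red p 8 v \<in> I" "v \<in> tail 3" "v 3 = 1"
  shows "I \<in> exceptional"
proof -
  note sub = I_subsp
  define b where "b = v 4"
  define c where "c = quad b v mod p"
  have v0: "v 0 = 0" "v 1 = 0" "v 2 = 0" using v(2) by (auto simp: tail_def)
  let ?a = "\<lambda>i. unit_vec 5 i + b * unit_vec 6 i" and ?a' = "\<lambda>i. unit_vec 6 i + b * unit_vec 7 i"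
  have "br v (unit_vec 0) = ?a" "br v (unit_vec 1) = ?a'"
    using v0 v(3) by (auto simp: fun_eq_iff br_def unit_vec_def b_def)
  then have a: "red p 8 ?a \<in> I" "red p 8 ?a' \<in> I"
    using idl_br[OF I v(1), of "unit_vec 0"] idl_br[OF I v(1), of "unit_vec 1"] by simp_all
  have n7: "red p 8 (unit_vec 7) \<notin> I"
  proof
    assume 7: "red p 8 (unit_vec 7) \<in> I"
    have 6: "red p 8 (unit_vec 6) \<in> I"
      using subsp_diff[OF sub a(2) subsp_scale[OF sub 7, of b]] by simp
    have "red p 8 (unit_vec 5) \<in> I"
      using subsp_diff[OF sub a(1) subsp_scale[OF sub 6, of b]] by simp
    then show False using 6 7 top_not_subset by blast
  qed
  have S: "p dvd w 4" if w: "red p 8 w \<in> I" "p dvd w 3" for w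
  proof (rule ccontr)
    assume w4: "\<not> p dvd w 4"
    have "red p 8 (unit_vec 7) \<in> I"
    proof (rule I_scaled[OF idl_br[OF I w(1), of "unit_vec 1"] w4])
      fix j :: nat assume "j < 8"
      then show "p dvd br w (unit_vec 1) j - w 4 * unit_vec 7 j"
        using I_low[OF w(1)] w(2) unfolding less_8_cases by (auto simp: br_def unit_vec_def)
    qed
    then show False using n7 by blast
  qed
  have S2: "p dvd quad b w" if w: "red p 8 w \<in> I" "p dvd w 3" for w
  proof (rule ccontr)
    assume q: "\<not> p dvd quad b w"
    let ?w = "\<lambda>i. (w i - w 5 * ?a i) - (w 6 - b * w 5) * ?a' i"
    have wI: "red p 8 ?w \<in> I"
      by (intro subsp_diff[OF sub] subsp_scale[OF sub] w(1) a)
    have "red p 8 (unit_vec 7) \<in> I"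
    proof (rule I_scaled[OF wI q])
      fix j :: nat assume "j < 8"
      then show "p dvd ?w j - quad b w * unit_vec 7 j"
        using I_low[OF w(1)] w(2) S[OF w] unfolding less_8_cases
        by (auto simp: unit_vec_def quad_def algebra_simps)
    qed
    then show False using n7 by blast
  qed
  have "I = ideal_u (b mod p) c"
  proof -
    have vc: "red p 8 v = v" using v(2) by (simp add: tail_iff)
    have bb: "b mod p = b" unfolding b_def by (rule carrier_mod[OF vc])
    have cq: "p dvd quad b v - c" by (simp add: c_def flip: mod_eq_dvd_iff)
    show ?thesis
      unfolding bb
    proof (intro equalityI subsetI)
      fix f assume f: "f \<in> I"
      have fc: "red p 8 f = f" using subsp_carrier[OF sub f] .
      then have fI: "red p 8 f \<in> I" using f by simp
      let ?w = "\<lambda>i. f i - f 3 * v i"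
      have w: "red p 8 ?w \<in> I" "p dvd ?w 3"
        using subsp_diff[OF sub fI subsp_scale[OF sub v(1), of "f 3"]] v(3) by simp_all
      have "p dvd f 4 - b * f 3" using S[OF w] by (simp add: b_def mult.commute)
      moreover have "p dvd quad b ?w + f 3 * (quad b v - c)"
        using S2[OF w] cq by (intro dvd_add dvd_mult)
      then have "p dvd quad b f - c * f 3" by (simp add: quad_def algebra_simps)
      ultimately have "red p 8 f \<in> ideal_u b c"
        unfolding red_ideal_u using I_low[OF fI] by blast
      then show "f \<in> ideal_u b c" using fc by simp
    next
      fix f assume f: "f \<in> ideal_u b c"
      then have fc: "red p 8 f = f" by (simp add: ideal_u_def tail_iff)
      have e: "p dvd f 0" "p dvd f 1" "p dvd f 2" "p dvd f 4 - b * f 3" "p dvd quad b f - c * f 3"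
        using f red_ideal_u[of f b c] fc by auto
      have q: "p dvd (quad b f - c * f 3) - f 3 * (quad b v - c)"
        by (rule dvd_diff[OF e(5) dvd_mult[OF cq]])
      let ?w = "\<lambda>i. f i - f 3 * v i"
      let ?g = "\<lambda>i. (f 3 * v i + ?w 5 * ?a i) + (?w 6 - b * ?w 5) * ?a' i"
      have "red p 8 ?g \<in> I"
        by (intro subsp_add[OF sub] subsp_scale[OF sub] v(1) a)
      then have "red p 8 f \<in> I"
      proof (rule subsp_cong)
        fix j :: nat assume "j < 8"
        then have "p dvd f j - ?g j"
          unfolding less_8_cases using e(1-4) q v0 v(3)
          by (auto simp: unit_vec_def quad_def b_def algebra_simps)
        then show "f j mod p = ?g j mod p" by (simp add: mod_eq_dvd_iff)
      qed
      then show "f \<in> I" using fc by simp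
    qed
  qed
  then show ?thesis using p_pos by (auto simp: exceptional_def c_def)
qed

lemma I_exceptional_v:
  assumes v: "red p 8 v \<in> I" "v \<in> tail 4" "v 4 = 1" and I4: "I \<subseteq> tail 4"
  shows "I \<in> exceptional"
proof -
  note sub = I_subsp
  have v0: "v 0 = 0" "v 1 = 0" "v 2 = 0" "v 3 = 0" using v(2) by (auto simp: tail_def)
  have "br v (unit_vec 0) = unit_vec 6" "br v (unit_vec 1) = unit_vec 7"
    using v0 v(3) by (auto simp: fun_eq_iff br_def unit_vec_def)
  then have a: "red p 8 (unit_vec 6) \<in> I" "red p 8 (unit_vec 7) \<in> I"
    using idl_br[OF I v(1), of "unit_vec 0"] idl_br[OF I v(1), of "unit_vec 1"] by simp_all
  have S: "p dvd w 5" if w: "red p 8 w \<in> I" "p dvd w 4" for w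
  proof (rule ccontr)
    assume w5: "\<not> p dvd w 5"
    have w3: "p dvd w 3" using I4 w(1) tail_red[of w 4] by (auto simp: less_4_cases)
    let ?w = "\<lambda>i. (w i - w 6 * unit_vec 6 i) - w 7 * unit_vec 7 i"
    have wI: "red p 8 ?w \<in> I"
      by (intro subsp_diff[OF sub] subsp_scale[OF sub] w(1) a)
    have "red p 8 (unit_vec 5) \<in> I"
    proof (rule I_scaled[OF wI w5])
      fix j :: nat assume "j < 8"
      then show "p dvd ?w j - w 5 * unit_vec 5 j"
        using I_low[OF w(1)] w(2) w3 unfolding less_8_cases by (auto simp: unit_vec_def)
    qed
    then show False using a top_not_subset by blast
  qed
  have vc: "red p 8 v = v" using v(2) by (simp add: tail_iff)
  have "I = ideal_v (v 5)"
  proof (intro equalityI subsetI)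
    fix f assume f: "f \<in> I"
    have fc: "red p 8 f = f" using subsp_carrier[OF sub f] .
    then have fI: "red p 8 f \<in> I" using f by simp
    let ?w = "\<lambda>i. f i - f 4 * v i"
    have w: "red p 8 ?w \<in> I" "p dvd ?w 4"
      using subsp_diff[OF sub fI subsp_scale[OF sub v(1), of "f 4"]] v(3) by simp_all
    have "p dvd f 5 - v 5 * f 4" using S[OF w] by (simp add: mult.commute)
    then show "f \<in> ideal_v (v 5)" using I4 f by (auto simp: ideal_v_def)
  next
    fix f assume f: "f \<in> ideal_v (v 5)"
    then have fc: "red p 8 f = f" by (simp add: ideal_v_def tail_iff)
    have e: "p dvd f 0" "p dvd f 1" "p dvd f 2" "p dvd f 3" "p dvd f 5 - v 5 * f 4"
      using f red_ideal_v[of f "v 5"] fc by auto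
    let ?g = "\<lambda>i. (f 4 * v i + (f 6 - f 4 * v 6) * unit_vec 6 i) + (f 7 - f 4 * v 7) * unit_vec 7 i"
    have "red p 8 ?g \<in> I"
      by (intro subsp_add[OF sub] subsp_scale[OF sub] v(1) a)
    then have "red p 8 f \<in> I"
    proof (rule subsp_cong)
      fix j :: nat assume "j < 8"
      then have "p dvd f j - ?g j"
        unfolding less_8_cases using e v0 v(3) by (auto simp: unit_vec_def algebra_simps)
      then show "f j mod p = ?g j mod p" by (simp add: mod_eq_dvd_iff)
    qed
    then show "f \<in> I" using fc by simp
  qed
  then show ?thesis using carrier_bounds[OF vc, of 5] by (auto simp: exceptional_def)
qed

lemma I_dichotomy: "I \<subseteq> tail 5 \<or> I \<in> exceptional"
proof -
  note sub = I_subsp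
  have car: "red p 8 f = f" if "f \<in> I" for f using subsp_carrier[OF sub that] .
  have zero: "f i = 0" if "f \<in> I" "p dvd f i" for f i
    using carrier_mod[OF car[OF that(1)], of i] that(2) by simp
  have I3: "f \<in> tail 3" if f: "f \<in> I" for f
    using I_low[of f] f car[OF f] zero[OF f] by (auto simp: tail_iff less_3_cases)
  show ?thesis
  proof (cases "\<forall>f\<in>I. f 3 = 0")
    case False
    then obtain f where f: "f \<in> I" "f 3 \<noteq> 0" by blast
    then have "red p 8 f \<in> I" "\<not> p dvd f 3" using car zero by auto
    then obtain c where c: "red p 8 (\<lambda>i. c * f i) \<in> I" "red p 8 (\<lambda>i. c * f i) 3 = 1"
      using subsp_normalize[OF sub, of f 3] by auto
    have "I \<in> exceptional"
      by (rule I_exceptional_u[of "red p 8 (\<lambda>i. c * f i)"]) (use c I3 in auto)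
    then show ?thesis by blast
  next
    case True
    then have I4: "I \<subseteq> tail 4" using I3 by (auto simp: tail_iff less_4_cases)
    show ?thesis
    proof (cases "\<forall>f\<in>I. f 4 = 0")
      case False
      then obtain f where f: "f \<in> I" "f 4 \<noteq> 0" by blast
      then have "red p 8 f \<in> I" "\<not> p dvd f 4" using car zero by auto
      then obtain c where c: "red p 8 (\<lambda>i. c * f i) \<in> I" "red p 8 (\<lambda>i. c * f i) 4 = 1"
        using subsp_normalize[OF sub, of f 4] by auto
      have "I \<in> exceptional"
        by (rule I_exceptional_v[of "red p 8 (\<lambda>i. c * f i)"]) (use c I4 in auto)
      then show ?thesis by blast
    next
      case True
      then have "I \<subseteq> tail 5" using I4 by (auto simp: tail_iff less_5_cases less_4_cases)
      then show ?thesis by blast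
    qed
  qed
qed

end

lemma ideals_class_4:
  "card {I. idl I \<and> \<not> tail 5 \<subseteq> I \<and> card (carrier N) = nat p ^ i * card I} =
    (if i = 5 then nat p + nat p ^ 2 else if i = 6 \<or> i = 7 then 1 + nat p + nat p ^ 2
     else if i = 8 then 1 else 0)"
proof -
  have "card {I. idl I \<and> \<not> tail 5 \<subseteq> I \<and> card (carrier N) = nat p ^ i * card I} =
      (if i = 5 then card exceptional else if 5 < i \<and> i \<le> 8 then subsp_count 5 (8 - i) else 0)"
    by (rule ideals_not_above_tail[OF _ _ I_dichotomy exceptional_props])
      (auto simp: tail_def br_def)
  moreover have 1: "subsp_count 5 1 = 1 + nat p + nat p ^ 2" "subsp_count 5 2 = 1 + nat p + nat p ^ 2"
    using subsp_count_step[of 5 0] subsp_count_step[of 6 0] subsp_count_step[of 7 0]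
      subsp_count_step[of 5 1] subsp_count_step[of 6 1] subsp_count_step[of 7 1]
      subsp_count_end[of 0] subsp_count_end[of 1]
    by (simp_all add: subsp_count_0 numeral_2_eq_2 algebra_simps)
  moreover have "5 < i \<and> i \<le> 8 \<longleftrightarrow> i = 6 \<or> i = 7 \<or> i = 8" by auto
  ultimately show ?thesis by (auto simp: subsp_count_0 card_exceptional)
qed

end

subsection \<open>The ideal zeta functions\<close>

definition ideal_num :: "nat \<Rightarrow> nat \<Rightarrow> nat \<Rightarrow> nat" where
  "ideal_num p n i =
    card {I. alg_ideal (residue_ring (int p)) (nilp (int p) n) I \<and>
      card (carrier (nilp (int p) n)) = p ^ i * card I}"

lemma alg_epi_red:
  assumes "k \<le> n"
  shows "alg_epi R (nilp m n) (nilp m k) (red m k)"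
proof -
  have rr: "red m k (red m n f) = red m k f" for f
    using assms by (auto simp: red_def fun_eq_iff)
  have rr': "red m n (red m k f) = red m k f" for f
    using assms by (auto simp: red_def fun_eq_iff)
  show ?thesis
    unfolding alg_epi_def
  proof (intro conjI ballI)
    show "red m k ` carrier (nilp m n) = carrier (nilp m k)"
    proof (intro equalityI subsetI)
      fix f assume "f \<in> carrier (nilp m k)"
      then have "red m k f = f" by simp
      then show "f \<in> red m k ` carrier (nilp m n)"
        using rr'[of f] by (intro image_eqI[of _ _ f]) simp_all
    qed auto
  qed (simp_all add: rr)
qed

lemma ideal_num_split:
  assumes p: "Factorial_Ring.prime p" and k: "k \<le> n"
  shows "ideal_num p n i = ideal_num p k i +
    card {I. nilp_mod.idl (int p) n I \<and> \<not> nilp_mod.tail (int p) n k \<subseteq> I \<and>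
      card (carrier (nilp (int p) n)) = p ^ i * card I}"
proof -
  interpret nilp_mod "int p" n by unfold_locales (simp add: p)
  have ker: "{f \<in> carrier N. red (int p) k f = \<zero>\<^bsub>nilp (int p) k\<^esub>} = tail k"
  proof -
    have "red (int p) k f = (\<lambda>_. 0) \<longleftrightarrow> (\<forall>i<k. f i = 0)" if "red (int p) n f = f" for f
    proof -
      have "f i mod int p = f i" for i by (rule carrier_mod[OF that])
      then show ?thesis by (simp add: red_def fun_eq_iff)
    qed
    then show ?thesis by (auto simp: tail_iff)
  qed
  let ?Q = "\<lambda>I. card (carrier N) = p ^ i * card I"
  have 1: "ideal_num p k i = card {I. idl I \<and> tail k \<subseteq> I \<and> ?Q I}"
    unfolding ideal_num_def idl_def ker[symmetric]
    by (rule card_ideals_epi[OF nonassoc_algebra_nilp alg_epi_red[OF k] finite_carrier_N])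
  have "{I. idl I \<and> ?Q I} = {I. idl I \<and> tail k \<subseteq> I \<and> ?Q I} \<union> {I. idl I \<and> \<not> tail k \<subseteq> I \<and> ?Q I}"
    by blast
  moreover have "finite {I. idl I \<and> ?Q I}"
  proof (rule finite_subset)
    show "{I. idl I \<and> ?Q I} \<subseteq> Pow (carrier N)"
      using subsp_carrier[OF idl_subsp] by auto
  qed (simp add: finite_carrier_N del: nilp_simps)
  ultimately have "card {I. idl I \<and> ?Q I} =
      card {I. idl I \<and> tail k \<subseteq> I \<and> ?Q I} + card {I. idl I \<and> \<not> tail k \<subseteq> I \<and> ?Q I}"
    by (metis (no_types, lifting) card_Un_disjoint disjoint_iff finite_Un mem_Collect_eq)
  then show ?thesis
    unfolding 1 by (simp add: ideal_num_def idl_def)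
qed

lemma ideal_num_0:
  assumes p: "Factorial_Ring.prime p"
  shows "ideal_num p 0 i = (if i = 0 then 1 else 0)"
proof -
  interpret nilp_mod "int p" 0 by unfold_locales (simp add: p)
  have carr: "carrier N = {\<lambda>_. 0}" by (auto simp: red_def)
  have "idl I \<longleftrightarrow> I = {\<lambda>_. 0}" for I
  proof
    assume I: "idl I"
    have "I \<subseteq> carrier N" using subsp_carrier[OF idl_subsp[OF I]] by auto
    then show "I = {\<lambda>_. 0}" using subsp_0[OF idl_subsp[OF I]] unfolding carr by auto
  next
    assume "I = {\<lambda>_. 0}"
    moreover have "alg_ideal K N {\<zero>\<^bsub>N\<^esub>}" by (rule alg_ideal_zero[OF nonassoc_algebra_nilp])
    ultimately show "idl I" by (simp add: idl_def)
  qed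
  then have "{I. idl I \<and> card (carrier N) = p ^ i * card I} = (if p ^ i = 1 then {{\<lambda>_. 0}} else {})"
    unfolding carr by auto
  moreover have "p ^ i = 1 \<longleftrightarrow> i = 0" using prime_gt_1_nat[OF p] by auto
  ultimately show ?thesis unfolding ideal_num_def idl_def by (auto split: if_splits)
qed

lemma ideal_num_2:
  assumes p: "Factorial_Ring.prime p"
  shows "ideal_num p 2 i = (if i = 1 then 1 + p else if i = 0 \<or> i = 2 then 1 else 0)"
proof -
  interpret nilp_mod "int p" 2 by unfold_locales (simp add: p)
  have "card {I. idl I \<and> \<not> tail 0 \<subseteq> I \<and> card (carrier N) = nat (int p) ^ i * card I} =
      (if i = 0 then card ({} :: (nat \<Rightarrow> int) set set) else if 0 < i \<and> i \<le> 2 then subsp_count 0 (2 - i) else 0)"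
  proof (rule ideals_not_above_tail)
    fix I assume "idl I"
    then show "I \<subseteq> tail 0 \<or> I \<in> {}" using subsp_carrier[OF idl_subsp] by (auto simp: tail_iff)
  qed (auto simp: br_def)
  moreover have "subsp_count 0 1 = 1 + p"
    using subsp_count_step[of 0 0] subsp_count_step[of 1 0] subsp_count_end[of 0]
      subsp_count_0[of 1] subsp_count_0[of 2]
    by (simp add: numeral_2_eq_2)
  moreover have "0 < i \<and> i \<le> 2 \<longleftrightarrow> i = 1 \<or> i = 2" by auto
  ultimately show ?thesis
    using ideal_num_split[OF p, of 0 2 i] ideal_num_0[OF p, of i] by (auto simp: subsp_count_0)
qed

lemma ideal_num_3:
  assumes p: "Factorial_Ring.prime p"
  shows "ideal_num p 3 i = ideal_num p 2 i + (if i = 3 then 1 else 0)"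
  using ideal_num_split[OF p, of 2 3 i] ideals_class_2[of "int p" i] p by simp

lemma ideal_num_5:
  assumes p: "Factorial_Ring.prime p"
  shows "ideal_num p 5 i = ideal_num p 3 i + (if i = 4 then 1 + p else if i = 5 then 1 else 0)"
  using ideal_num_split[OF p, of 3 5 i] ideals_class_3[of "int p" i] p by simp

lemma ideal_num_8:
  assumes p: "Factorial_Ring.prime p"
  shows "ideal_num p 8 i = ideal_num p 5 i +
    (if i = 5 then p + p ^ 2 else if i = 6 \<or> i = 7 then 1 + p + p ^ 2 else if i = 8 then 1 else 0)"
proof -
  interpret nilp_class_4 "int p" by unfold_locales (simp add: p)
  show ?thesis using ideal_num_split[OF p, of 5 8 i] ideals_class_4[of i] by simp
qed

lemma ideal_zeta_mod_eq:
  assumes p: "Factorial_Ring.prime p"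
    and ker: "central_ideal {..<2} (Suc c) = ev_vanish n" and n: "n \<le> 8"
  shows "ideal_zeta_mod (free_nilpotent_lie_ring c 2) p s =
    (\<Sum>i=0..n. of_nat (ideal_num p n i) * (of_nat p powr (- s)) ^ i)"
proof -
  let ?L = "free_nilpotent_lie_ring c 2"
  interpret residues_prime p "residue_ring (int p)" by unfold_locales (rule p)
  obtain h where h: "alg_epi \<Z> (nilp 0 n) ?L h"
    and h0: "\<And>x. \<lbrakk>x \<in> carrier (nilp 0 n); h x = \<zero>\<^bsub>?L\<^esub>\<rbrakk> \<Longrightarrow> x = \<zero>\<^bsub>nilp 0 n\<^esub>"
    using free_nilpotent_lie_ring_iso[OF ker n] by blast
  interpret Z: nonassoc_algebra \<Z> "nilp 0 n" by (rule nonassoc_algebra_nilp)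
  have id: "alg_epi \<Z> (nilp 0 n) (nilp 0 n) (\<lambda>x. x)"
    by (simp add: alg_epi_def del: nilp_simps)
  obtain \<phi> where \<phi>: "alg_epi \<Z> ?L (nilp 0 n) \<phi>" "\<And>x. x \<in> carrier (nilp 0 n) \<Longrightarrow> \<phi> (h x) = x"
    using alg_epi_factor[OF Z.abelian_group_axioms h id Z.mult_closed Z.scale_closed h0] by blast
  interpret S: scalar_extension "int p" "residue_ring (int p)" ?L n h \<phi>
    by unfold_locales (use h \<phi> m_gt_one in auto)
  obtain g where g: "alg_epi (residue_ring (int p)) (nilp (int p) n) (extend_scalars ?L (residue_ring (int p))) g"
    and g0: "\<And>c. \<lbrakk>c \<in> carrier (nilp (int p) n); g c = \<zero>\<^bsub>extend_scalars ?L (residue_ring (int p))\<^esub>\<rbrakk>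
      \<Longrightarrow> c = \<zero>\<^bsub>nilp (int p) n\<^esub>"
    using S.extend_scalars_iso by blast
  have cardK: "card (carrier (residue_ring (int p))) = p"
    by (simp add: residue_ring_def)
  have fin: "finite (carrier (nilp (int p) n))"
    using m_gt_one by (intro finite_nilp) simp
  have "ideal_count (residue_ring (int p)) (extend_scalars ?L (residue_ring (int p))) i = ideal_num p n i" for i
    using ideal_count_card[OF is_field _ module_residue_nilp nonassoc_algebra_nilp fin g g0, of i]
      prime_gt_1_nat[OF p]
    unfolding ideal_num_def cardK by blast
  moreover have "module_rank \<Z> ?L = n"
    by (rule module_rank_int[OF alg_epi_module[OF module_int_nilp h]
          has_rank_iso[OF module_int_nilp h has_rank_nilp h0]])
  ultimately show ?thesis by (simp add: ideal_zeta_mod_def Let_def)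
qed

theorem theorem3p7:
  fixes p :: nat and s t :: complex
  assumes "Factorial_Ring.prime p"
    and "t = of_nat p powr (- s)"
  shows "ideal_zeta_mod (free_nilpotent_lie_ring 2 2) p s
           = 1 + (1 + of_nat p) * t + t ^ 2 + t ^ 3
       \<and> ideal_zeta_mod (free_nilpotent_lie_ring 3 2) p s
           = ideal_zeta_mod (free_nilpotent_lie_ring 2 2) p s + (1 + of_nat p) * t ^ 4 + t ^ 5
       \<and> ideal_zeta_mod (free_nilpotent_lie_ring 4 2) p s
           = ideal_zeta_mod (free_nilpotent_lie_ring 3 2) p s
             + (of_nat p + of_nat p ^ 2) * t ^ 5
             + (1 + of_nat p + of_nat p ^ 2) * t ^ 6
             + (1 + of_nat p + of_nat p ^ 2) * t ^ 7 + t ^ 8"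
proof -
  note counts = ideal_num_2[OF assms(1)] ideal_num_3[OF assms(1)] ideal_num_5[OF assms(1)]
    ideal_num_8[OF assms(1)]
  have sum3: "sum f {0..3} = f 0 + f 1 + f 2 + f 3" for f :: "nat \<Rightarrow> complex"
    by (simp add: eval_nat_numeral)
  have sum5: "sum f {0..5} = f 0 + f 1 + f 2 + f 3 + f 4 + f 5" for f :: "nat \<Rightarrow> complex"
    by (simp add: eval_nat_numeral)
  have sum8: "sum f {0..8} = f 0 + f 1 + f 2 + f 3 + f 4 + f 5 + f 6 + f 7 + f 8" for f :: "nat \<Rightarrow> complex"
    by (simp add: eval_nat_numeral)
  have 2: "ideal_zeta_mod (free_nilpotent_lie_ring 2 2) p s = 1 + (1 + of_nat p) * t + t ^ 2 + t ^ 3"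
    using ideal_zeta_mod_eq[OF assms(1) free_nilpotent_kernel(1)]
    by (simp add: sum3 counts flip: assms(2))
  have 3: "ideal_zeta_mod (free_nilpotent_lie_ring 3 2) p s =
      1 + (1 + of_nat p) * t + t ^ 2 + t ^ 3 + (1 + of_nat p) * t ^ 4 + t ^ 5"
    using ideal_zeta_mod_eq[OF assms(1) free_nilpotent_kernel(2)]
    by (simp add: sum5 counts flip: assms(2))
  have 4: "ideal_zeta_mod (free_nilpotent_lie_ring 4 2) p s =
      1 + (1 + of_nat p) * t + t ^ 2 + t ^ 3 + (1 + of_nat p) * t ^ 4 + t ^ 5 +
      (of_nat p + of_nat p ^ 2) * t ^ 5 + (1 + of_nat p + of_nat p ^ 2) * t ^ 6 +
      (1 + of_nat p + of_nat p ^ 2) * t ^ 7 + t ^ 8"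
    using ideal_zeta_mod_eq[OF assms(1) free_nilpotent_kernel(3)]
    by (simp add: sum8 counts algebra_simps flip: assms(2))
  show ?thesis by (simp add: 2 3 4)
qed

end
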